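(* Let $T>0$, let $a,b\in\mathbb{R}$ satisfy $a\ge1$ and $2|b|\le1$, and set $\theta_1=a^2$, $\theta_2=-2b$. Consider the stochastic wave equation $$\frac{\partial^2 u}{\partial t^2}=\theta_1\frac{\partial^2 u}{\partial x^2}+\theta_2\frac{\partial u}{\partial t}+\dot W(t),\quad 0<t<T,\ 0<x<\pi,$$ with $u|_{t=0}=\frac{\partial u}{\partial t}|_{t=0}=0$ and $u|_{x=0}=u|_{x=\pi}=0$, where $W$ is a cylindrical Brownian motion over $L_2((0,\pi))$. Let $u_k,v_k$, $k\ge1$, be the Fourier coefficients of $u$ and $v=\partial u/\partial t$, i.e. the processes satisfying $$u_k(t)=\int_0^tv_k(s)\,ds,\qquad v_k(t)=-\theta_1k^2\int_0^tu_k(s)\,ds+\theta_2\int_0^tv_k(s)\,ds+w_k(t),\quad t\in[0,T],$$ with independent standard Brownian motions $w_k$, and let $$\hat\theta_{1,N}=\frac{B_{1,N}J_{2,N}+B_{2,N}J_{12,N}}{J_{1,N}J_{2,N}-J_{12,N}^2},\qquad \hat\theta_{2,N}=\frac{B_{1,N}J_{12,N}+B_{2,N}J_{1,N}}{J_{1,N}J_{2,N}-J_{12,N}^2}$$ be the maximum likelihood estimators of $\theta_1,\theta_2$ from the observations $\{u_k(t),v_k(t),\ k=1,\ldots,N,\ t\in[0,T]\}$, where $$J_{1,N}=\sum_{k=1}^Nk^4\int_0^Tu_k^2(t)\,dt,\quad J_{2,N}=\sum_{k=1}^N\int_0^Tv_k^2(t)\,dt,\quad J_{12,N}=\sum_{k=1}^Nk^2\int_0^Tu_k(t)v_k(t)\,dt,$$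 $$B_{1,N}=-\sum_{k=1}^Nk^2\int_0^Tu_k(t)\,dv_k(t),\qquad B_{2,N}=\sum_{k=1}^N\int_0^Tv_k(t)\,dv_k(t).$$ Then $$\lim_{N\to\infty}\hat\theta_{1,N}=\theta_1,\qquad\lim_{N\to\infty}\hat\theta_{2,N}=\theta_2$$ with probability one, and $$\lim_{N\to\infty}N^{3/2}(\hat\theta_{1,N}-\theta_1)=\mathcal{N}\left(0,\frac{3\theta_1}{C(\theta_2,T)}\right),\qquad \lim_{N\to\infty}N^{1/2}(\hat\theta_{2,N}-\theta_2)=\mathcal{N}\left(0,\frac{1}{C(\theta_2,T)}\right)$$ in distribution, where $$C(\theta_2,T)=\begin{cases}\dfrac{e^{\theta_2T}-\theta_2T-1}{2\theta_2^2},&\theta_2\neq0,\\[2mm]\dfrac{T^2}{4},&\theta_2=0.\end{cases}$$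
   Context: Fix a stochastic basis $(\Omega,\mathcal{F},\{\mathcal{F}_t\}_{t\ge0},\mathbb{P})$ with the usual assumptions (completeness of $\mathcal{F}_0$, right-continuity of $\mathcal{F}_t$), large enough to support countably many independent standard Brownian motions. $\mathcal{N}(m,\sigma^2)$ denotes a Gaussian random variable with mean $m$ and variance $\sigma^2$. A cylindrical Brownian motion $W$ over $L_2((0,\pi))$ is a linear map $f\mapsto W_f(\cdot)$ from $L_2((0,\pi))$ to zero-mean Gaussian processes with $\mathbb{E}(W_f(t)W_g(s))=\min(t,s)\int_0^\pi fg\,dx$; equivalently $W_f(t)=\sum_{k\ge1}(f,h_k)w_k(t)$ with $h_k(x)=\sqrt{2/\pi}\,\sin(kx)$ and $w_k=W_{h_k}$, $k\ge1$, independent standard Brownian motions (adapted to $\{\mathcal{F}_t\}$). The equation is interpreted as the system $du=v\,dt$, $dv=(\theta_1u_{xx}+\theta_2v)\,dt+dW(t)$ with zero initial and boundary conditions; the solution is $u(t,x)=\sqrt{2/\pi}\sum_{k\ge1}u_k(t)\sin(kx)$, $v(t,x)=\sqrt{2/\pi}\sum_{k\ge1}v_k(t)\sin(kx)$ with $u_k,v_k$ satisfying the system in the claim. The estimators are the solution of $\partial Z_N/\partial\theta_1=\partial Z_N/\partial\theta_2=0$ for the log-likelihood ratio $$Z_N(\theta_1,\theta_2)=\sum_{k=1}^N\Big(\int_0^T(-\theta_1k^2u_k(t)+\theta_2v_k(t))\,dv_k(t)-\frac12\int_0^T(-\theta_1k^2u_k(t)+\theta_2v_k(t))^2\,dt\Big)$$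 (with $\theta_1,\theta_2$ treated as free variables), which gives the explicit formulas in the claim. Integrals with respect to $dv_k$ are It\^o integrals. The processes $u_k,v_k$ are those generated with the true parameter values $\theta_1,\theta_2$. *)

theory Defs
  imports "HOL-Probability.Probability"
begin

section \<open>Stochastic basis\<close>

text \<open>
  The library's filtrations are indexed by the whole type of the time variable. Negative times are
  never used below; a filtration indexed by the half line is extended to them by its value at 0.
  Every set of probability zero is an event (\<open>complete_measure\<close>) and lies in \<open>F 0\<close>.
\<close>

locale stochastic_basis = prob_space M + complete_measure M + filtration "space M" F
  for M :: "'a measure" and F :: "real \<Rightarrow> 'a measure" +
  assumes subalgebra_F: "\<And>t. subalgebra M (F t)"
    and null_sets_F: "null_sets M \<subseteq> sets (F 0)"
    and right_continuous_F: "\<And>t. 0 \<le> t \<Longrightarrow> sets (F t) = (\<Inter>s\<in>{t<..}. sets (F s))"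

definition adapted_on :: "(real \<Rightarrow> 'a measure) \<Rightarrow> real set \<Rightarrow> (real \<Rightarrow> 'a \<Rightarrow> real) \<Rightarrow> bool" where
  "adapted_on F I X \<longleftrightarrow> (\<forall>t\<in>I. X t \<in> borel_measurable (F t))"

definition continuous_paths_on :: "'a measure \<Rightarrow> real set \<Rightarrow> (real \<Rightarrow> 'a \<Rightarrow> real) \<Rightarrow> bool" where
  "continuous_paths_on M I X \<longleftrightarrow> (\<forall>\<omega>\<in>space M. continuous_on I (\<lambda>t. X t \<omega>))"

definition jointly_measurable :: "'a measure \<Rightarrow> real \<Rightarrow> (real \<Rightarrow> 'a \<Rightarrow> real) \<Rightarrow> bool" where
  "jointly_measurable M T X \<longleftrightarrow>
     (\<lambda>(t, \<omega>). X t \<omega>) \<in> borel_measurable (restrict_space lborel {0..T} \<Otimes>\<^sub>M M)"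

section \<open>Gaussian processes and Brownian motions\<close>

definition normal_law :: "real \<Rightarrow> real \<Rightarrow> real measure" where
  "normal_law m s2 =
     (if s2 = 0 then return borel m else density lborel (\<lambda>x. ennreal (normal_density m (sqrt s2) x)))"

definition centered_gaussian_process :: "'a measure \<Rightarrow> (real \<Rightarrow> 'a \<Rightarrow> real) \<Rightarrow> bool" where
  "centered_gaussian_process M X \<longleftrightarrow>
     (\<forall>t\<ge>0. X t \<in> borel_measurable M) \<and>
     (\<forall>(n::nat) (c::nat \<Rightarrow> real) (\<tau>::nat \<Rightarrow> real). (\<forall>j<n. 0 \<le> \<tau> j) \<longrightarrow>
        (\<exists>s2\<ge>0. distr M borel (\<lambda>\<omega>. \<Sum>j<n. c j * X (\<tau> j) \<omega>) = normal_law 0 s2))"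

definition brownian_motion ::
  "'a measure \<Rightarrow> (real \<Rightarrow> 'a measure) \<Rightarrow> (real \<Rightarrow> 'a \<Rightarrow> real) \<Rightarrow> bool" where
  "brownian_motion M F w \<longleftrightarrow>
     adapted_on F {0..} w \<and> continuous_paths_on M {0..} w \<and> (AE \<omega> in M. w 0 \<omega> = 0) \<and>
     (\<forall>s t. 0 \<le> s \<and> s < t \<longrightarrow>
        distr M borel (\<lambda>\<omega>. w t \<omega> - w s \<omega>) = normal_law 0 (t - s) \<and>
        prob_space.indep_set M (sets (F s))
          {(\<lambda>\<omega>. w t \<omega> - w s \<omega>) -` A \<inter> space M |A. A \<in> sets borel})"

definition L2_0pi :: "(real \<Rightarrow> real) set" where
  "L2_0pi = {f. set_borel_measurable lborel {0<..<pi} f \<and>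
                set_integrable lborel {0<..<pi} (\<lambda>x. (f x)\<^sup>2)}"

definition inner_0pi :: "(real \<Rightarrow> real) \<Rightarrow> (real \<Rightarrow> real) \<Rightarrow> real" where
  "inner_0pi f g = (LINT x:{0<..<pi}|lborel. f x * g x)"

definition sine_basis :: "nat \<Rightarrow> real \<Rightarrow> real" where
  "sine_basis k x = sqrt (2 / pi) * sin (real k * x)"

text \<open>
  Elements of \<open>L\<^sub>2((0,\<pi>))\<close> are represented by functions; linearity and the covariance imply that
  functions equal almost everywhere have almost surely equal images. The processes \<open>w\<^sub>k\<close> are
  jointly independent as processes, that is, as random elements of \<open>\<real>\<^bsup>[0,\<infinity>)\<^esup>\<close>.
\<close>

definition cylindrical_brownian_motion ::
  "'a measure \<Rightarrow> (real \<Rightarrow> 'a measure) \<Rightarrow> ((real \<Rightarrow> real) \<Rightarrow> real \<Rightarrow> 'a \<Rightarrow> real) \<Rightarrow> bool" where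
  "cylindrical_brownian_motion M F W \<longleftrightarrow>
     (\<forall>f\<in>L2_0pi. centered_gaussian_process M (W f)) \<and>
     (\<forall>f\<in>L2_0pi. \<forall>g\<in>L2_0pi. \<forall>c d. \<forall>t\<ge>0.
        AE \<omega> in M. W (\<lambda>x. c * f x + d * g x) t \<omega> = c * W f t \<omega> + d * W g t \<omega>) \<and>
     (\<forall>f\<in>L2_0pi. \<forall>g\<in>L2_0pi. \<forall>t\<ge>0. \<forall>s\<ge>0.
        (LINT \<omega>|M. W f t \<omega> * W g s \<omega>) = min t s * inner_0pi f g) \<and>
     (\<forall>k\<ge>1. brownian_motion M F (W (sine_basis k))) \<and>
     prob_space.indep_vars M (\<lambda>_. Pi\<^sub>M {0..} (\<lambda>_. borel))
       (\<lambda>k \<omega>. \<lambda>t\<in>{0..}. W (sine_basis k) t \<omega>) {1..}"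

section \<open>The Ito integral\<close>

text \<open>
  A simple adapted process on \<open>[0,T]\<close> is given by a partition \<open>s 0 \<le> \<dots> \<le> s n\<close> of \<open>[0,T]\<close> and
  bounded random variables \<open>e j\<close>, measurable with respect to \<open>F (s j)\<close>, its value on
  \<open>(s j, s (j + 1)]\<close> being \<open>e j\<close>.
\<close>

definition simple_adapted ::
  "'a measure \<Rightarrow> (real \<Rightarrow> 'a measure) \<Rightarrow> real \<Rightarrow> nat \<Rightarrow> (nat \<Rightarrow> real) \<Rightarrow> (nat \<Rightarrow> 'a \<Rightarrow> real) \<Rightarrow> bool"
where
  "simple_adapted M F T n s e \<longleftrightarrow>
     s 0 = 0 \<and> s n = T \<and> (\<forall>j<n. s j \<le> s (Suc j)) \<and>
     (\<forall>j<n. e j \<in> borel_measurable (F (s j)) \<and> (\<exists>c. \<forall>\<omega>\<in>space M. \<bar>e j \<omega>\<bar> \<le> c))"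

definition simple_process ::
  "nat \<Rightarrow> (nat \<Rightarrow> real) \<Rightarrow> (nat \<Rightarrow> 'a \<Rightarrow> real) \<Rightarrow> real \<Rightarrow> 'a \<Rightarrow> real" where
  "simple_process n s e t \<omega> = (\<Sum>j<n. e j \<omega> * indicator {s j<..s (Suc j)} t)"

definition simple_integral ::
  "(real \<Rightarrow> 'a \<Rightarrow> real) \<Rightarrow> nat \<Rightarrow> (nat \<Rightarrow> real) \<Rightarrow> (nat \<Rightarrow> 'a \<Rightarrow> real) \<Rightarrow> 'a \<Rightarrow> real" where
  "simple_integral w n s e \<omega> = (\<Sum>j<n. e j \<omega> * (w (s (Suc j)) \<omega> - w (s j) \<omega>))"

text \<open>
  \<open>K\<close> is a version of \<open>\<integral>\<^sub>0\<^sup>T H dw\<close>, for \<open>w\<close> a Brownian motion: the mean-square limit of the integrals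
  of simple adapted processes converging to \<open>H\<close> in \<open>L\<^sub>2([0,T] \<times> \<Omega>)\<close>. Such a \<open>K\<close> is determined up to
  almost sure equality.
\<close>

definition has_ito_integral ::
  "'a measure \<Rightarrow> (real \<Rightarrow> 'a measure) \<Rightarrow> (real \<Rightarrow> 'a \<Rightarrow> real) \<Rightarrow> real \<Rightarrow>
     (real \<Rightarrow> 'a \<Rightarrow> real) \<Rightarrow> ('a \<Rightarrow> real) \<Rightarrow> bool" where
  "has_ito_integral M F w T H K \<longleftrightarrow>
     K \<in> borel_measurable M \<and> adapted_on F {0..T} H \<and> jointly_measurable M T H \<and>
     (\<exists>n s e. (\<forall>m. simple_adapted M F T (n m) (s m) (e m)) \<and>
        (\<lambda>m. \<integral>\<^sup>+\<omega>. (\<integral>\<^sup>+t\<in>{0..T}. ennreal ((H t \<omega> - simple_process (n m) (s m) (e m) t \<omega>)\<^sup>2) \<partial>lborel) \<partial>M)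
          \<longlonglongrightarrow> 0 \<and>
        (\<lambda>m. \<integral>\<^sup>+\<omega>. ennreal ((K \<omega> - simple_integral w (n m) (s m) (e m) \<omega>)\<^sup>2) \<partial>M) \<longlonglongrightarrow> 0)"

text \<open>
  \<open>X\<close> is an Ito process \<open>dX = \<mu> dt + dw\<close> on \<open>[0,T]\<close>.
\<close>

definition ito_process ::
  "'a measure \<Rightarrow> (real \<Rightarrow> 'a measure) \<Rightarrow> (real \<Rightarrow> 'a \<Rightarrow> real) \<Rightarrow> real \<Rightarrow>
     (real \<Rightarrow> 'a \<Rightarrow> real) \<Rightarrow> (real \<Rightarrow> 'a \<Rightarrow> real) \<Rightarrow> bool" where
  "ito_process M F w T \<mu> X \<longleftrightarrow>
     adapted_on F {0..T} \<mu> \<and> jointly_measurable M T \<mu> \<and>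
     (AE \<omega> in M. set_integrable lborel {0..T} (\<lambda>t. \<mu> t \<omega>)) \<and>
     (AE \<omega> in M. \<forall>t\<in>{0..T}. X t \<omega> = X 0 \<omega> + (LINT s:{0..t}|lborel. \<mu> s \<omega>) + (w t \<omega> - w 0 \<omega>))"

text \<open>
  \<open>K\<close> is a version of \<open>\<integral>\<^sub>0\<^sup>T H dX = \<integral>\<^sub>0\<^sup>T H \<mu> dt + \<integral>\<^sub>0\<^sup>T H dw\<close>. The drift \<open>\<mu>\<close> is determined by \<open>X\<close> and \<open>w\<close>
  up to null sets of \<open>[0,T] \<times> \<Omega>\<close>.
\<close>

definition has_ito_process_integral ::
  "'a measure \<Rightarrow> (real \<Rightarrow> 'a measure) \<Rightarrow> (real \<Rightarrow> 'a \<Rightarrow> real) \<Rightarrow> real \<Rightarrow>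
     (real \<Rightarrow> 'a \<Rightarrow> real) \<Rightarrow> (real \<Rightarrow> 'a \<Rightarrow> real) \<Rightarrow> ('a \<Rightarrow> real) \<Rightarrow> bool" where
  "has_ito_process_integral M F w T X H K \<longleftrightarrow>
     K \<in> borel_measurable M \<and>
     (\<exists>\<mu> L. ito_process M F w T \<mu> X \<and> has_ito_integral M F w T H L \<and>
        (AE \<omega> in M. set_integrable lborel {0..T} (\<lambda>t. H t \<omega> * \<mu> t \<omega>)) \<and>
        (AE \<omega> in M. K \<omega> = (LINT t:{0..T}|lborel. H t \<omega> * \<mu> t \<omega>) + L \<omega>))"

section \<open>The stochastic wave equation\<close>

text \<open>
  The equation \<open>u\<^sub>t\<^sub>t = \<theta>\<^sub>1 u\<^sub>x\<^sub>x + \<theta>\<^sub>2 u\<^sub>t + W'\<close> with zero initial and boundary conditions is the system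
  \<open>du = v dt\<close>, \<open>dv = (\<theta>\<^sub>1 u\<^sub>x\<^sub>x + \<theta>\<^sub>2 v) dt + dW\<close>. Its solution is the pair of sine series
  \<open>u(t,x) = \<Sum>\<^sub>k u\<^sub>k(t) h\<^sub>k(x)\<close>, \<open>v(t,x) = \<Sum>\<^sub>k v\<^sub>k(t) h\<^sub>k(x)\<close>, where \<open>h\<^sub>k = sine_basis k\<close>. The series for \<open>v\<close>
  does not converge in \<open>L\<^sub>2((0,\<pi>))\<close>, so the solution is represented by its families of Fourier
  coefficients. The second derivative acts on \<open>h\<^sub>k\<close> as multiplication by \<open>- k\<^sup>2\<close>.
\<close>

definition wave_solution ::
  "'a measure \<Rightarrow> (real \<Rightarrow> 'a measure) \<Rightarrow> real \<Rightarrow> real \<Rightarrow> real \<Rightarrow>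
     ((real \<Rightarrow> real) \<Rightarrow> real \<Rightarrow> 'a \<Rightarrow> real) \<Rightarrow>
     (nat \<Rightarrow> real \<Rightarrow> 'a \<Rightarrow> real) \<Rightarrow> (nat \<Rightarrow> real \<Rightarrow> 'a \<Rightarrow> real) \<Rightarrow> bool" where
  "wave_solution M F T \<theta>\<^sub>1 \<theta>\<^sub>2 W u v \<longleftrightarrow>
     (\<forall>k\<ge>1.
        adapted_on F {0..T} (u k) \<and> continuous_paths_on M {0..T} (u k) \<and>
        adapted_on F {0..T} (v k) \<and> continuous_paths_on M {0..T} (v k) \<and>
        (AE \<omega> in M. \<forall>t\<in>{0..T}.
           u k t \<omega> = (LINT s:{0..t}|lborel. v k s \<omega>) \<and>
           v k t \<omega> = - \<theta>\<^sub>1 * (real k)\<^sup>2 * (LINT s:{0..t}|lborel. u k s \<omega>)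
                      + \<theta>\<^sub>2 * (LINT s:{0..t}|lborel. v k s \<omega>) + W (sine_basis k) t \<omega>))"

section \<open>The maximum likelihood estimators\<close>

definition J1 :: "real \<Rightarrow> (nat \<Rightarrow> real \<Rightarrow> 'a \<Rightarrow> real) \<Rightarrow> nat \<Rightarrow> 'a \<Rightarrow> real" where
  "J1 T u N \<omega> = (\<Sum>k=1..N. real k ^ 4 * (LINT t:{0..T}|lborel. (u k t \<omega>)\<^sup>2))"

definition J2 :: "real \<Rightarrow> (nat \<Rightarrow> real \<Rightarrow> 'a \<Rightarrow> real) \<Rightarrow> nat \<Rightarrow> 'a \<Rightarrow> real" where
  "J2 T v N \<omega> = (\<Sum>k=1..N. (LINT t:{0..T}|lborel. (v k t \<omega>)\<^sup>2))"

definition J12 ::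
  "real \<Rightarrow> (nat \<Rightarrow> real \<Rightarrow> 'a \<Rightarrow> real) \<Rightarrow> (nat \<Rightarrow> real \<Rightarrow> 'a \<Rightarrow> real) \<Rightarrow> nat \<Rightarrow> 'a \<Rightarrow> real" where
  "J12 T u v N \<omega> = (\<Sum>k=1..N. (real k)\<^sup>2 * (LINT t:{0..T}|lborel. u k t \<omega> * v k t \<omega>))"

text \<open>\<open>P k\<close> and \<open>Q k\<close> stand for \<open>\<integral>\<^sub>0\<^sup>T u\<^sub>k dv\<^sub>k\<close> and \<open>\<integral>\<^sub>0\<^sup>T v\<^sub>k dv\<^sub>k\<close>.\<close>

definition B1 :: "(nat \<Rightarrow> 'a \<Rightarrow> real) \<Rightarrow> nat \<Rightarrow> 'a \<Rightarrow> real" where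
  "B1 P N \<omega> = - (\<Sum>k=1..N. (real k)\<^sup>2 * P k \<omega>)"

definition B2 :: "(nat \<Rightarrow> 'a \<Rightarrow> real) \<Rightarrow> nat \<Rightarrow> 'a \<Rightarrow> real" where
  "B2 Q N \<omega> = (\<Sum>k=1..N. Q k \<omega>)"

definition mle1 ::
  "real \<Rightarrow> (nat \<Rightarrow> real \<Rightarrow> 'a \<Rightarrow> real) \<Rightarrow> (nat \<Rightarrow> real \<Rightarrow> 'a \<Rightarrow> real) \<Rightarrow>
     (nat \<Rightarrow> 'a \<Rightarrow> real) \<Rightarrow> (nat \<Rightarrow> 'a \<Rightarrow> real) \<Rightarrow> nat \<Rightarrow> 'a \<Rightarrow> real" where
  "mle1 T u v P Q N \<omega> =
     (B1 P N \<omega> * J2 T v N \<omega> + B2 Q N \<omega> * J12 T u v N \<omega>) /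
     (J1 T u N \<omega> * J2 T v N \<omega> - (J12 T u v N \<omega>)\<^sup>2)"

definition mle2 ::
  "real \<Rightarrow> (nat \<Rightarrow> real \<Rightarrow> 'a \<Rightarrow> real) \<Rightarrow> (nat \<Rightarrow> real \<Rightarrow> 'a \<Rightarrow> real) \<Rightarrow>
     (nat \<Rightarrow> 'a \<Rightarrow> real) \<Rightarrow> (nat \<Rightarrow> 'a \<Rightarrow> real) \<Rightarrow> nat \<Rightarrow> 'a \<Rightarrow> real" where
  "mle2 T u v P Q N \<omega> =
     (B1 P N \<omega> * J12 T u v N \<omega> + B2 Q N \<omega> * J1 T u N \<omega>) /
     (J1 T u N \<omega> * J2 T v N \<omega> - (J12 T u v N \<omega>)\<^sup>2)"

definition C_const :: "real \<Rightarrow> real \<Rightarrow> real" where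
  "C_const \<theta>\<^sub>2 T =
     (if \<theta>\<^sub>2 = 0 then T\<^sup>2 / 4 else (exp (\<theta>\<^sub>2 * T) - \<theta>\<^sub>2 * T - 1) / (2 * \<theta>\<^sub>2\<^sup>2))"

end

theory Submission
  imports Defs "HOL-Library.Discrete_Functions"
begin

text \<open>
  Write \<open>M\<^sub>1 = \<Sum>k\<le>N. k\<^sup>2 \<integral> u\<^sub>k dw\<^sub>k\<close> and \<open>M\<^sub>2 = \<Sum>k\<le>N. \<integral> v\<^sub>k dw\<^sub>k\<close>. Inserting
  \<open>dv\<^sub>k = (- \<theta>\<^sub>1 k\<^sup>2 u\<^sub>k + \<theta>\<^sub>2 v\<^sub>k) dt + dw\<^sub>k\<close> into the estimators leaves the exact error formulas
  (\<open>mle_error_formulas\<close>)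

    estimator of \<open>\<theta>\<^sub>1\<close>: error \<open>(M\<^sub>2 J\<^sub>1\<^sub>2 - M\<^sub>1 J\<^sub>2) / (J\<^sub>1 J\<^sub>2 - J\<^sub>1\<^sub>2\<^sup>2)\<close>,
    estimator of \<open>\<theta>\<^sub>2\<close>: error \<open>(M\<^sub>2 J\<^sub>1 - M\<^sub>1 J\<^sub>1\<^sub>2) / (J\<^sub>1 J\<^sub>2 - J\<^sub>1\<^sub>2\<^sup>2)\<close>,

  so that only the growth of five sums of independent random variables matters.

  The mode \<open>u\<^sub>k\<close> is a damped oscillator of frequency about \<open>a k\<close> driven by \<open>w\<^sub>k\<close>. Averaging over its rapid
  oscillations, \<open>E k\<^sup>2 \<integral> u\<^sub>k\<^sup>2 \<rightarrow> C / \<theta>\<^sub>1\<close> and \<open>E \<integral> v\<^sub>k\<^sup>2 \<rightarrow> C\<close> with \<open>C = C_const \<theta>\<^sub>2 T\<close>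
  (\<open>displacement_variance_integral_tendsto\<close>), and by the strong law
  \<open>J\<^sub>1 / N\<^sup>3 \<rightarrow> C / (3 \<theta>\<^sub>1)\<close> and \<open>J\<^sub>2 / N \<rightarrow> C\<close>. Since \<open>v\<^sub>k\<close> is the derivative of \<open>u\<^sub>k\<close>, the mixed sum is
  \<open>J\<^sub>1\<^sub>2 = (\<Sum>k\<le>N. k\<^sup>2 u\<^sub>k(T)\<^sup>2) / 2\<close>, which is of order \<open>N\<close> and negligible against the geometric mean
  \<open>N\<^sup>2\<close> of the other two: asymptotically the two parameters are estimated separately. By Ito's
  isometry the variances of \<open>k \<integral> u\<^sub>k dw\<^sub>k\<close> and \<open>\<integral> v\<^sub>k dw\<^sub>k\<close> have the limits \<open>C / \<theta>\<^sub>1\<close> and \<open>C\<close> as well. The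
  strong law gives \<open>M\<^sub>1 = o(N\<^sup>2)\<close> and \<open>M\<^sub>2 = o(N)\<close>, hence consistency; the central limit theorem
  gives Gaussian limits of \<open>M\<^sub>1 / N\<^bsup>3/2\<^esup>\<close> and \<open>M\<^sub>2 / N\<^bsup>1/2\<^esup>\<close> with variances \<open>C / (3 \<theta>\<^sub>1)\<close> and \<open>C\<close>, and
  multiplication by the limits \<open>- 3 \<theta>\<^sub>1 / C\<close> and \<open>1 / C\<close> of the random coefficients gives the
  asserted limit laws (\<open>slutsky_char\<close>).

  Both limit theorems need bounds, uniform in \<open>k\<close>, on the fourth moments of \<open>k u\<^sub>k\<close>, \<open>v\<^sub>k\<close> or of the Ito
  integrals. All of them come from
  one recursion (\<open>wsum_moments\<close>) for the sums \<open>\<Sum>j. e\<^sub>j (w(s\<^sub>j\<^sub>+\<^sub>1) - w(s\<^sub>j))\<close>, used twice: with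
  deterministic \<open>e\<^sub>j\<close>, where the sums converge to \<open>u\<^sub>k(t)\<close> and \<open>v\<^sub>k(t)\<close> by variation of constants
  (\<open>damped_oscillator_duality\<close>, \<open>wiener_integral_moments\<close>), and with \<open>e\<^sub>j = u\<^sub>k(s\<^sub>j)\<close> or \<open>v\<^sub>k(s\<^sub>j)\<close>, where
  they converge to the Ito integrals (\<open>ito_integral_moments\<close>). The second convergence also settles
  independence. The filtration is common to all modes, so the simple processes that define an Ito
  integral over \<open>w\<^sub>k\<close> may depend on the other noises; the Riemann sums do not. Everything attached to
  the mode \<open>k\<close> is therefore almost surely a function of the path of \<open>w\<^sub>k\<close> (\<open>factors_through\<close>).
\<close>

section \<open>Moments and almost sure limits\<close>

lemma square_add_le: "(x + y)\<^sup>2 \<le> 2 * x\<^sup>2 + 2 * y\<^sup>2" for x y :: real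
  using zero_le_power2[of "x - y"] by (simp add: power2_eq_square algebra_simps)

lemma square_le_one_plus_fourth_power: "x\<^sup>2 \<le> 1 + x ^ 4" for x :: real
proof -
  have "1 + x ^ 4 - x\<^sup>2 = (1 - x\<^sup>2)\<^sup>2 + x\<^sup>2"
    by (simp add: power2_eq_square power4_eq_xxxx algebra_simps)
  then show ?thesis
    using zero_le_power2[of "1 - x\<^sup>2"] zero_le_power2[of x] by linarith
qed

lemma square_sum_le_card_sum_squares:
  fixes x :: "'b \<Rightarrow> real"
  shows "(\<Sum>k\<in>I. x k)\<^sup>2 \<le> real (card I) * (\<Sum>k\<in>I. (x k)\<^sup>2)"
  using Cauchy_Schwarz_ineq_sum[of "\<lambda>_. 1" x I] by simp

text \<open>
  Bounded second moments make the sequence uniformly integrable: the part of \<open>D\<close> above a level \<open>R\<close>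
  contributes at most \<open>K / R\<close> to the expectation.
\<close>

lemma (in prob_space) expectation_abs_tendsto_0:
  fixes D :: "nat \<Rightarrow> 'a \<Rightarrow> real"
  assumes [measurable]: "\<And>n. D n \<in> borel_measurable M"
    and int: "\<And>n. integrable M (\<lambda>\<omega>. (D n \<omega>)\<^sup>2)"
    and bound: "\<And>n. expectation (\<lambda>\<omega>. (D n \<omega>)\<^sup>2) \<le> K"
    and lim: "AE \<omega> in M. (\<lambda>n. D n \<omega>) \<longlonglongrightarrow> 0"
  shows "(\<lambda>n. expectation (\<lambda>\<omega>. \<bar>D n \<omega>\<bar>)) \<longlonglongrightarrow> 0"
proof (rule tendstoI)
  fix e :: real assume "0 < e"
  have intD: "integrable M (D n)" for n
    by (rule square_integrable_imp_integrable[OF _ int]) simp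
  have K: "0 \<le> K"
    using bound[of 0] by (rule order_trans[rotated]) (simp add: integral_nonneg_AE)
  \<comment> \<open>The level above which the square bound makes the tail contribute at most \<open>e / 2\<close>.\<close>
  define R where "R = 2 * (K + 1) / e"
  have R: "0 < R" using K \<open>0 < e\<close> by (simp add: R_def)
  have "(\<lambda>n. expectation (\<lambda>\<omega>. min \<bar>D n \<omega>\<bar> R)) \<longlonglongrightarrow> expectation (\<lambda>\<omega>. 0)"
  proof (rule integral_dominated_convergence[where w = "\<lambda>_. R"])
    show "AE \<omega> in M. (\<lambda>n. min \<bar>D n \<omega>\<bar> R) \<longlonglongrightarrow> 0"
      using lim
    proof eventually_elim
      case (elim \<omega>)
      then have "(\<lambda>n. min \<bar>D n \<omega>\<bar> R) \<longlonglongrightarrow> min \<bar>0\<bar> R"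
        by (intro tendsto_intros)
      then show ?case using R by simp
    qed
  qed (use R in auto)
  then have "\<forall>\<^sub>F n in sequentially. expectation (\<lambda>\<omega>. min \<bar>D n \<omega>\<bar> R) < e / 2"
    by (rule order_tendstoD) (use \<open>0 < e\<close> in simp)
  then show "\<forall>\<^sub>F n in sequentially. dist (expectation (\<lambda>\<omega>. \<bar>D n \<omega>\<bar>)) 0 < e"
  proof eventually_elim
    case (elim n)
    have i1: "integrable M (\<lambda>\<omega>. min \<bar>D n \<omega>\<bar> R)"
      by (rule integrable_const_bound[where B = R]) (use R in auto)
    have le: "\<bar>x\<bar> \<le> min \<bar>x\<bar> R + x\<^sup>2 / R" for x :: real
    proof (cases "\<bar>x\<bar> \<le> R")
      case False
      then have "\<bar>x\<bar> * R \<le> x\<^sup>2" using R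
        by (metis abs_ge_zero linear mult_left_mono power2_abs power2_eq_square)
      then have "\<bar>x\<bar> \<le> x\<^sup>2 / R" using R by (simp add: field_simps)
      then show ?thesis using R by simp
    qed (use R in \<open>simp add: min_def\<close>)
    have "expectation (\<lambda>\<omega>. \<bar>D n \<omega>\<bar>) \<le> expectation (\<lambda>\<omega>. min \<bar>D n \<omega>\<bar> R + (D n \<omega>)\<^sup>2 / R)"
      by (rule integral_mono) (use intD int i1 le in auto)
    also have "\<dots> = expectation (\<lambda>\<omega>. min \<bar>D n \<omega>\<bar> R) + expectation (\<lambda>\<omega>. (D n \<omega>)\<^sup>2) / R"
      using i1 int by simp
    also have "\<dots> < e / 2 + K / R"
      using elim bound[of n] R by (intro add_less_le_mono divide_right_mono) auto
    also have "K / R \<le> e / 2"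
      using K \<open>0 < e\<close> by (simp add: R_def field_simps)
    finally have "expectation (\<lambda>\<omega>. \<bar>D n \<omega>\<bar>) < e" by simp
    then show ?case by (simp add: integral_nonneg_AE)
  qed
qed

text \<open>
  The bound is Fatou's lemma. Applied to the squares of a sequence with bounded fourth moments, the
  last claim is the convergence of the second moments.
\<close>

lemma (in prob_space) limit_second_moment:
  fixes X :: "nat \<Rightarrow> 'a \<Rightarrow> real"
  assumes [measurable]: "\<And>n. X n \<in> borel_measurable M" "Y \<in> borel_measurable M"
    and int: "\<And>n. integrable M (\<lambda>\<omega>. (X n \<omega>)\<^sup>2)"
    and bound: "\<And>n. expectation (\<lambda>\<omega>. (X n \<omega>)\<^sup>2) \<le> K"
    and lim: "AE \<omega> in M. (\<lambda>n. X n \<omega>) \<longlonglongrightarrow> Y \<omega>"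
  shows "integrable M (\<lambda>\<omega>. (Y \<omega>)\<^sup>2)" and "expectation (\<lambda>\<omega>. (Y \<omega>)\<^sup>2) \<le> K"
    and "integrable M Y" and "(\<lambda>n. expectation (X n)) \<longlonglongrightarrow> expectation Y"
proof -
  have K: "0 \<le> K"
    using bound[of 0] by (rule order_trans[rotated]) (simp add: integral_nonneg_AE)
  have "(\<integral>\<^sup>+\<omega>. ennreal ((Y \<omega>)\<^sup>2) \<partial>M) = (\<integral>\<^sup>+\<omega>. liminf (\<lambda>n. ennreal ((X n \<omega>)\<^sup>2)) \<partial>M)"
  proof (rule nn_integral_cong_AE, use lim in eventually_elim)
    case (elim \<omega>)
    then have "(\<lambda>n. ennreal ((X n \<omega>)\<^sup>2)) \<longlonglongrightarrow> ennreal ((Y \<omega>)\<^sup>2)"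
      by (intro tendsto_intros)
    then show ?case by (metis lim_imp_Liminf sequentially_bot)
  qed
  also have "\<dots> \<le> liminf (\<lambda>n. \<integral>\<^sup>+\<omega>. ennreal ((X n \<omega>)\<^sup>2) \<partial>M)"
    by (rule nn_integral_liminf) simp
  also have "\<dots> \<le> liminf (\<lambda>n. ennreal K)"
    by (intro Liminf_mono always_eventually allI, subst nn_integral_eq_integral)
       (use int bound in \<open>auto intro!: ennreal_leI\<close>)
  also have "\<dots> = ennreal K" by (simp add: Liminf_const)
  finally have nn: "(\<integral>\<^sup>+\<omega>. ennreal ((Y \<omega>)\<^sup>2) \<partial>M) \<le> ennreal K" .
  show intY: "integrable M (\<lambda>\<omega>. (Y \<omega>)\<^sup>2)"
    by (rule integrableI_bounded) (use nn in \<open>auto simp: top_unique less_top[symmetric]\<close>)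
  show EY: "expectation (\<lambda>\<omega>. (Y \<omega>)\<^sup>2) \<le> K"
    using nn intY K by (simp add: nn_integral_eq_integral)
  show iY: "integrable M Y"
    by (rule square_integrable_imp_integrable[OF _ intY]) simp
  have iX: "integrable M (X n)" for n
    by (rule square_integrable_imp_integrable[OF _ int]) simp
  have sq: "(X n \<omega> - Y \<omega>)\<^sup>2 \<le> 2 * (X n \<omega>)\<^sup>2 + 2 * (Y \<omega>)\<^sup>2" for n \<omega>
    using square_add_le[of "X n \<omega>" "- Y \<omega>"] by simp
  have iD: "integrable M (\<lambda>\<omega>. (X n \<omega> - Y \<omega>)\<^sup>2)" for n
    by (rule Bochner_Integration.integrable_bound[of _ "\<lambda>\<omega>. 2 * (X n \<omega>)\<^sup>2 + 2 * (Y \<omega>)\<^sup>2"])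
       (use int intY sq in auto)
  have "expectation (\<lambda>\<omega>. (X n \<omega> - Y \<omega>)\<^sup>2) \<le> expectation (\<lambda>\<omega>. 2 * (X n \<omega>)\<^sup>2 + 2 * (Y \<omega>)\<^sup>2)" for n
    by (rule integral_mono) (use int intY iD sq in auto)
  also have "expectation (\<lambda>\<omega>. 2 * (X n \<omega>)\<^sup>2 + 2 * (Y \<omega>)\<^sup>2) \<le> 4 * K" for n
    using int[of n] intY bound[of n] EY by simp
  finally have ED: "expectation (\<lambda>\<omega>. (X n \<omega> - Y \<omega>)\<^sup>2) \<le> 4 * K" for n .
  have lim0: "(\<lambda>n. expectation (\<lambda>\<omega>. \<bar>X n \<omega> - Y \<omega>\<bar>)) \<longlonglongrightarrow> 0"
    by (rule expectation_abs_tendsto_0[OF _ iD ED]) (use lim in \<open>auto simp: LIM_zero_iff\<close>)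
  have "\<bar>expectation (X n) - expectation Y\<bar> \<le> expectation (\<lambda>\<omega>. \<bar>X n \<omega> - Y \<omega>\<bar>)" for n
    using iX iY integral_abs_bound[of M "\<lambda>\<omega>. X n \<omega> - Y \<omega>"] by simp
  then have "\<forall>\<^sub>F n in sequentially. norm (expectation (X n) - expectation Y)
      \<le> expectation (\<lambda>\<omega>. \<bar>X n \<omega> - Y \<omega>\<bar>)"
    by simp
  then have "(\<lambda>n. expectation (X n) - expectation Y) \<longlonglongrightarrow> 0"
    using lim0 by (rule Lim_null_comparison)
  then show "(\<lambda>n. expectation (X n)) \<longlonglongrightarrow> expectation Y"
    by (simp add: LIM_zero_iff)
qed

text \<open>
  \<open>Suc n\<close> cells instead of \<open>n\<close>, so that every \<open>n\<close> gives a subdivision.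
\<close>

definition grid :: "real \<Rightarrow> nat \<Rightarrow> nat \<Rightarrow> real" where
  "grid t n j = t * real j / real (Suc n)"

lemma grid_0 [simp]: "grid t n 0 = 0"
  and grid_last [simp]: "grid t n (Suc n) = t"
  by (simp_all add: grid_def del: of_nat_Suc)

lemma grid_step: "grid t n (Suc j) - grid t n j = t / real (Suc n)"
  by (simp add: grid_def diff_divide_distrib[symmetric] algebra_simps)

lemma square_mean_sum_le:
  fixes x :: "nat \<Rightarrow> real"
  shows "(\<Sum>j<Suc n. d / real (Suc n) * x j)\<^sup>2 \<le> d * (d / real (Suc n)) * (\<Sum>j<Suc n. (x j)\<^sup>2)"
proof -
  have "(\<Sum>j<Suc n. d / real (Suc n) * x j)\<^sup>2 = (d / real (Suc n))\<^sup>2 * (\<Sum>j<Suc n. x j)\<^sup>2"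
    unfolding sum_distrib_left[symmetric] power_mult_distrib ..
  also have "\<dots> \<le> (d / real (Suc n))\<^sup>2 * (real (card {..<Suc n}) * (\<Sum>j<Suc n. (x j)\<^sup>2))"
    by (intro mult_left_mono square_sum_le_card_sum_squares) simp
  also have "\<dots> = d * (d / real (Suc n)) * (\<Sum>j<Suc n. (x j)\<^sup>2)"
    by (simp add: power2_eq_square del: sum.lessThan_Suc of_nat_Suc)
  finally show ?thesis .
qed

lemma grid_mono: "0 \<le> t \<Longrightarrow> i \<le> j \<Longrightarrow> grid t n i \<le> grid t n j"
  by (simp add: grid_def divide_right_mono mult_left_mono)

lemma grid_mem: "0 \<le> t \<Longrightarrow> j \<le> Suc n \<Longrightarrow> grid t n j \<in> {0..t}"
  using grid_mono[of t 0 j n] grid_mono[of t j "Suc n" n] by simp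

text \<open>
  By the mean value theorem the increments of \<open>h\<close> and of a primitive \<open>\<Phi>\<close> of \<open>g * h'\<close> over a cell are the
  length of the cell times values of \<open>h'\<close> and \<open>g * h'\<close> inside it, so uniform continuity makes each
  summand agree with the increment of \<open>\<Phi>\<close> up to a small multiple of the length. The evaluation points
  are arbitrary because summation by parts produces right end points.
\<close>

lemma stieltjes_sum_tendsto:
  fixes g h h' :: "real \<Rightarrow> real"
  assumes t: "0 \<le> t" and g: "continuous_on {0..t} g" and h': "continuous_on {0..t} h'"
    and h: "\<And>x. x \<in> {0..t} \<Longrightarrow> (h has_real_derivative h' x) (at x within {0..t})"
    and \<tau>: "\<And>n j. j \<le> n \<Longrightarrow> \<tau> n j \<in> {grid t n j..grid t n (Suc j)}"
  shows "(\<lambda>n. \<Sum>j<Suc n. g (\<tau> n j) * (h (grid t n (Suc j)) - h (grid t n j)))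
           \<longlonglongrightarrow> (LINT s:{0..t}|lborel. g s * h' s)"
proof (cases "t = 0")
  case True
  have "(LINT s:{0..t}|lborel. g s * h' s) = 0"
    unfolding set_lebesgue_integral_def
    by (rule integral_eq_zero_AE) (use AE_lborel_singleton[of 0] in \<open>rule eventually_mono, use True
        in auto\<close>)
  then show ?thesis using True by (simp add: grid_def)
next
  case False
  with t have "0 < t" by simp
  define \<Phi> where "\<Phi> x = integral {0..x} (\<lambda>s. g s * h' s)" for x
  have cont: "continuous_on {0..t} (\<lambda>s. g s * h' s)"
    by (intro continuous_intros g h')
  have d\<Phi>: "(\<Phi> has_real_derivative g x * h' x) (at x within {0..t})" if "x \<in> {0..t}" for x
    unfolding \<Phi>_def using integral_has_real_derivative[OF cont that] .
  have LI: "(LINT s:{0..t}|lborel. g s * h' s) = \<Phi> t - \<Phi> 0"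
  proof -
    have "(LINT s:{0..t}|lborel. g s * h' s) = \<Phi> t"
      unfolding \<Phi>_def
      using borel_integrable_compact[OF compact_Icc cont]
      by (intro set_borel_integral_eq_integral)
         (simp add: set_integrable_def mult.commute indicator_scaleR_eq_if if_distrib cong: if_cong)
    then show ?thesis by (simp add: \<Phi>_def)
  qed
  obtain G where G: "\<And>x. x \<in> {0..t} \<Longrightarrow> \<bar>g x\<bar> \<le> G"
    using compact_imp_bounded[OF compact_continuous_image[OF g compact_Icc]]
    by (force simp: bounded_iff)
  obtain H where H: "\<And>x. x \<in> {0..t} \<Longrightarrow> \<bar>h' x\<bar> \<le> H"
    using compact_imp_bounded[OF compact_continuous_image[OF h' compact_Icc]]
    by (force simp: bounded_iff)
  have GH: "0 \<le> G" "0 \<le> H" using G[of 0] H[of 0] \<open>0 < t\<close> by force+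
  have mvt: "\<exists>\<xi>\<in>{x..y}. f y - f x = (y - x) * f' \<xi>"
    if "0 \<le> x" "x < y" "y \<le> t"
      and f: "\<And>x. x \<in> {0..t} \<Longrightarrow> (f has_real_derivative f' x) (at x within {0..t})"
    for x y and f f' :: "real \<Rightarrow> real"
  proof -
    have "\<exists>\<xi>. x < \<xi> \<and> \<xi> < y \<and> f y - f x = (y - x) * f' \<xi>"
    proof -
      have "\<exists>\<xi>\<in>{x<..<y}. f y - f x = (\<lambda>z. f' \<xi> * z) (y - x)"
      proof (rule mvt_simple[OF \<open>x < y\<close>, where f' = "\<lambda>z u. f' z * u"])
        fix z assume "x \<le> z" "z \<le> y"
        then have "(f has_real_derivative f' z) (at z within {x..y})"
          using that by (intro DERIV_subset[OF f]) auto
        then show "(f has_derivative (\<lambda>u. f' z * u)) (at z within {x..y})"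
          by (simp add: has_field_derivative_def)
      qed
      then show ?thesis by (auto simp: mult.commute)
    qed
    then show ?thesis by force
  qed
  show ?thesis
    unfolding LI
  proof (rule tendstoI)
    fix e :: real assume "0 < e"
    define \<epsilon> where "\<epsilon> = e / (2 * t * (G + H + 1))"
    have \<epsilon>: "0 < \<epsilon>" using \<open>0 < e\<close> \<open>0 < t\<close> GH by (simp add: \<epsilon>_def)
    obtain d1 where d1: "d1 > 0" "\<And>x y. x \<in> {0..t} \<Longrightarrow> y \<in> {0..t} \<Longrightarrow> \<bar>y - x\<bar> < d1 \<Longrightarrow> \<bar>g y - g x\<bar> < \<epsilon>"
      using compact_uniformly_continuous[OF g compact_Icc] \<epsilon>
      unfolding uniformly_continuous_on_def dist_real_def by meson
    obtain d2 where d2: "d2 > 0" "\<And>x y. x \<in> {0..t} \<Longrightarrow> y \<in> {0..t} \<Longrightarrow> \<bar>y - x\<bar> < d2 \<Longrightarrow> \<bar>h' y - h' x\<bar> < \<epsilon>"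
      using compact_uniformly_continuous[OF h' compact_Icc] \<epsilon>
      unfolding uniformly_continuous_on_def dist_real_def by meson
    have "(\<lambda>n. t / real (Suc n)) \<longlonglongrightarrow> 0"
      by (rule LIMSEQ_Suc) (rule lim_const_over_n)
    then have "\<forall>\<^sub>F n in sequentially. t / real (Suc n) < min d1 d2"
      by (rule order_tendstoD) (use d1 d2 in auto)
    then show "\<forall>\<^sub>F n in sequentially. dist (\<Sum>j<Suc n. g (\<tau> n j) *
        (h (grid t n (Suc j)) - h (grid t n j))) (\<Phi> t - \<Phi> 0) < e"
    proof eventually_elim
      case (elim n)
      let ?s = "grid t n"
      define \<delta> where "\<delta> = t / real (Suc n)"
      have \<delta>: "0 < \<delta>" "\<delta> < d1" "\<delta> < d2" using elim \<open>0 < t\<close> by (auto simp: \<delta>_def simp del: of_nat_Suc)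
      have step: "\<bar>g (\<tau> n j) * (h (?s (Suc j)) - h (?s j)) - (\<Phi> (?s (Suc j)) - \<Phi> (?s j))\<bar>
          \<le> \<delta> * ((G + H) * \<epsilon>)" if "j < Suc n" for j
      proof -
        have j: "?s (Suc j) = ?s j + \<delta>" using grid_step[of t n j] by (simp add: \<delta>_def)
        have mem: "0 \<le> ?s j" "?s (Suc j) \<le> t"
          using grid_mem[of t j n] grid_mem[of t "Suc j" n] that t by auto
        obtain \<xi> where \<xi>: "\<xi> \<in> {?s j..?s (Suc j)}"
            "\<Phi> (?s (Suc j)) - \<Phi> (?s j) = \<delta> * (g \<xi> * h' \<xi>)"
          using mvt[of "?s j" "?s (Suc j)" \<Phi> "\<lambda>x. g x * h' x"] mem \<delta> d\<Phi> by (auto simp: j)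
        obtain \<eta> where \<eta>: "\<eta> \<in> {?s j..?s (Suc j)}"
            "h (?s (Suc j)) - h (?s j) = \<delta> * h' \<eta>"
          using mvt[of "?s j" "?s (Suc j)" h h'] mem \<delta> h by (auto simp: j)
        have \<tau>j: "\<tau> n j \<in> {?s j..?s (Suc j)}" using \<tau>[of j n] that by simp
        have a: "\<bar>g (\<tau> n j) - g \<xi>\<bar> \<le> \<epsilon>"
          by (rule less_imp_le, rule d1(2)) (use mem j \<xi> \<tau>j \<delta> in auto)
        have b: "\<bar>h' \<eta> - h' \<xi>\<bar> \<le> \<epsilon>"
          by (rule less_imp_le, rule d2(2)) (use mem j \<xi> \<eta> \<delta> in auto)
        have "g (\<tau> n j) * (\<delta> * h' \<eta>) - \<delta> * (g \<xi> * h' \<xi>)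
            = \<delta> * ((g (\<tau> n j) - g \<xi>) * h' \<eta> + g \<xi> * (h' \<eta> - h' \<xi>))"
          by (simp add: algebra_simps)
        also have "\<bar>\<dots>\<bar> \<le> \<delta> * (\<bar>(g (\<tau> n j) - g \<xi>) * h' \<eta>\<bar> + \<bar>g \<xi> * (h' \<eta> - h' \<xi>)\<bar>)"
          using \<delta> abs_triangle_ineq[of "(g (\<tau> n j) - g \<xi>) * h' \<eta>" "g \<xi> * (h' \<eta> - h' \<xi>)"]
          by (simp add: abs_mult)
        also have "\<dots> \<le> \<delta> * (\<epsilon> * H + G * \<epsilon>)"
          unfolding abs_mult using \<delta> \<epsilon> GH a b H[of \<eta>] G[of \<xi>] mem \<xi> \<eta>
          by (intro mult_left_mono add_mono mult_mono) auto
        finally show ?thesis using \<xi>(2) \<eta>(2) by (simp add: algebra_simps)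
      qed
      have "\<Phi> t - \<Phi> 0 = (\<Sum>j<Suc n. \<Phi> (?s (Suc j)) - \<Phi> (?s j))"
        by (subst sum_lessThan_telescope) simp
      then have "\<bar>(\<Sum>j<Suc n. g (\<tau> n j) * (h (?s (Suc j)) - h (?s j))) - (\<Phi> t - \<Phi> 0)\<bar>
          = \<bar>\<Sum>j<Suc n. g (\<tau> n j) * (h (?s (Suc j)) - h (?s j)) - (\<Phi> (?s (Suc j)) - \<Phi> (?s j))\<bar>"
        by (simp only: sum_subtractf)
      also have "\<dots> \<le> (\<Sum>j<Suc n. \<delta> * ((G + H) * \<epsilon>))"
        by (rule order_trans[OF sum_abs sum_mono]) (use step in auto)
      also have "\<dots> = t * ((G + H) * \<epsilon>)" by (simp add: \<delta>_def)
      also have "\<dots> \<le> t * ((G + H + 1) * \<epsilon>)"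
        using \<epsilon> \<open>0 < t\<close> by (intro mult_left_mono mult_right_mono) auto
      also have "\<dots> = e / 2"
      proof -
        have "t \<noteq> 0" "G + H + 1 \<noteq> 0" using \<open>0 < t\<close> GH by linarith+
        then show ?thesis by (simp only: \<epsilon>_def) (simp add: divide_simps)
      qed
      also have "\<dots> < e" using \<open>0 < e\<close> by simp
      finally show ?case by (simp add: dist_real_def)
    qed
  qed
qed

lemma riemann_sum_tendsto:
  fixes g :: "real \<Rightarrow> real"
  assumes t: "0 \<le> t" and g: "continuous_on {0..t} g"
  shows "(\<lambda>n. \<Sum>j<Suc n. t / real (Suc n) * g (grid t n j)) \<longlonglongrightarrow> (LINT s:{0..t}|lborel. g s)"
proof -
  have "(\<lambda>n. \<Sum>j<Suc n. g (grid t n j) * (grid t n (Suc j) - grid t n j))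
          \<longlonglongrightarrow> (LINT s:{0..t}|lborel. g s * 1)"
    by (rule stieltjes_sum_tendsto[where h = "\<lambda>x. x" and h' = "\<lambda>_. 1"])
       (use t g in \<open>auto intro!: grid_mono derivative_eq_intros\<close>)
  then show ?thesis by (simp only: grid_step mult.commute[of "g _"] mult_1_right)
qed

section \<open>Limit theorems for independent and uncorrelated variables\<close>

text \<open>
  The series of the \<open>X j\<close> has finite expectation, so it converges almost surely.
\<close>

lemma AE_tendsto_0_of_summable_expectation:
  fixes X :: "nat \<Rightarrow> 'a \<Rightarrow> real"
  assumes int: "\<And>j. integrable M (X j)" and nn: "\<And>j \<omega>. 0 \<le> X j \<omega>"
    and bound: "\<And>j. (LINT \<omega>|M. X j \<omega>) \<le> c j" and c: "summable c"
  shows "AE \<omega> in M. (\<lambda>j. X j \<omega>) \<longlonglongrightarrow> 0"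
proof -
  have [measurable]: "X j \<in> borel_measurable M" for j using int by auto
  have c0: "0 \<le> c j" for j
    by (rule order_trans[OF _ bound]) (simp add: nn)
  have "(\<integral>\<^sup>+\<omega>. (\<Sum>j. ennreal (X j \<omega>)) \<partial>M) = (\<Sum>j. \<integral>\<^sup>+\<omega>. ennreal (X j \<omega>) \<partial>M)"
    by (rule nn_integral_suminf) simp
  also have "\<dots> \<le> (\<Sum>j. ennreal (c j))"
    by (intro suminf_le) (use int nn bound in \<open>auto simp: nn_integral_eq_integral intro!: ennreal_leI\<close>)
  also have "\<dots> = ennreal (\<Sum>j. c j)"
    by (rule suminf_ennreal2) (use c c0 in auto)
  finally have "(\<integral>\<^sup>+\<omega>. (\<Sum>j. ennreal (X j \<omega>)) \<partial>M) \<noteq> \<infinity>"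
    by (auto simp: top_unique)
  then have "AE \<omega> in M. (\<Sum>j. ennreal (X j \<omega>)) \<noteq> \<infinity>"
    by (intro nn_integral_PInf_AE) auto
  then show ?thesis
  proof eventually_elim
    case (elim \<omega>)
    then have "summable (\<lambda>j. X j \<omega>)"
      by (intro summable_suminf_not_top) (use nn in auto)
    then show ?case by (rule summable_LIMSEQ_zero)
  qed
qed

lemma integrable_mult_of_squares:
  fixes X Y :: "'a \<Rightarrow> real"
  assumes [measurable]: "X \<in> borel_measurable M" "Y \<in> borel_measurable M"
    and "integrable M (\<lambda>\<omega>. (X \<omega>)\<^sup>2)" "integrable M (\<lambda>\<omega>. (Y \<omega>)\<^sup>2)"
  shows "integrable M (\<lambda>\<omega>. X \<omega> * Y \<omega>)"
proof (rule Bochner_Integration.integrable_bound)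
  show "integrable M (\<lambda>\<omega>. (X \<omega>)\<^sup>2 + (Y \<omega>)\<^sup>2)" using assms by simp
  have "\<bar>x * y\<bar> \<le> x\<^sup>2 + y\<^sup>2" for x y :: real
    using sum_squares_bound[of "\<bar>x\<bar>" "\<bar>y\<bar>"] abs_ge_zero[of "x * y"]
    unfolding power2_abs abs_mult by linarith
  then show "AE \<omega> in M. norm (X \<omega> * Y \<omega>) \<le> norm ((X \<omega>)\<^sup>2 + (Y \<omega>)\<^sup>2)"
    by simp
qed simp

lemma (in prob_space) expectation_square_sum_uncorrelated:
  fixes X :: "nat \<Rightarrow> 'a \<Rightarrow> real"
  assumes [measurable]: "\<And>k. k \<in> I \<Longrightarrow> X k \<in> borel_measurable M" and fin: "finite I"
    and int: "\<And>k. k \<in> I \<Longrightarrow> integrable M (\<lambda>\<omega>. (X k \<omega>)\<^sup>2)"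
    and orth: "\<And>k l. k \<in> I \<Longrightarrow> l \<in> I \<Longrightarrow> k \<noteq> l \<Longrightarrow> expectation (\<lambda>\<omega>. X k \<omega> * X l \<omega>) = 0"
  shows "integrable M (\<lambda>\<omega>. (\<Sum>k\<in>I. X k \<omega>)\<^sup>2)"
    and "expectation (\<lambda>\<omega>. (\<Sum>k\<in>I. X k \<omega>)\<^sup>2) = (\<Sum>k\<in>I. expectation (\<lambda>\<omega>. (X k \<omega>)\<^sup>2))"
proof -
  have prod: "integrable M (\<lambda>\<omega>. X k \<omega> * X l \<omega>)" if "k \<in> I" "l \<in> I" for k l
    using that by (intro integrable_mult_of_squares int) auto
  have sq: "(\<Sum>k\<in>I. X k \<omega>)\<^sup>2 = (\<Sum>k\<in>I. \<Sum>l\<in>I. X k \<omega> * X l \<omega>)" for \<omega>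
    by (simp add: power2_eq_square sum_product)
  show "integrable M (\<lambda>\<omega>. (\<Sum>k\<in>I. X k \<omega>)\<^sup>2)"
    unfolding sq by (intro Bochner_Integration.integrable_sum prod)
  have "expectation (\<lambda>\<omega>. (\<Sum>k\<in>I. X k \<omega>)\<^sup>2) = (\<Sum>k\<in>I. \<Sum>l\<in>I. expectation (\<lambda>\<omega>. X k \<omega> * X l \<omega>))"
    unfolding sq using prod by (simp add: Bochner_Integration.integral_sum)
  also have "\<dots> = (\<Sum>k\<in>I. \<Sum>l\<in>I. if l = k then expectation (\<lambda>\<omega>. (X k \<omega>)\<^sup>2) else 0)"
    by (intro sum.cong refl) (auto simp: orth power2_eq_square)
  also have "\<dots> = (\<Sum>k\<in>I. expectation (\<lambda>\<omega>. (X k \<omega>)\<^sup>2))"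
    using fin by simp
  finally show "expectation (\<lambda>\<omega>. (\<Sum>k\<in>I. X k \<omega>)\<^sup>2) = (\<Sum>k\<in>I. expectation (\<lambda>\<omega>. (X k \<omega>)\<^sup>2))" .
qed

text \<open>
  Along the squares \<open>N = m\<^sup>2\<close> the normalised sum has second moment of order \<open>1 / m\<^sup>2\<close>, which is summable.
  Between \<open>m\<^sup>2\<close> and \<open>(m + 1)\<^sup>2\<close> the sum changes by at most the sum of \<open>2 m + 1\<close> absolute values, whose
  normalised square is again of order \<open>1 / m\<^sup>2\<close> by the Cauchy-Schwarz inequality. All estimates are in
  mean square, where orthogonality suffices.
\<close>

theorem (in prob_space) strong_law_uncorrelated:
  fixes X :: "nat \<Rightarrow> 'a \<Rightarrow> real" and p :: nat
  assumes meas[measurable]: "\<And>k. X k \<in> borel_measurable M"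
    and int: "\<And>k. 1 \<le> k \<Longrightarrow> integrable M (\<lambda>\<omega>. (X k \<omega>)\<^sup>2)"
    and bound: "\<And>k. 1 \<le> k \<Longrightarrow> expectation (\<lambda>\<omega>. (X k \<omega>)\<^sup>2) \<le> K * real k ^ (2 * p)"
    and orth: "\<And>k l. 1 \<le> k \<Longrightarrow> 1 \<le> l \<Longrightarrow> k \<noteq> l \<Longrightarrow> expectation (\<lambda>\<omega>. X k \<omega> * X l \<omega>) = 0"
  shows "AE \<omega> in M. (\<lambda>N. (\<Sum>k=1..N. X k \<omega>) / real N ^ (p + 1)) \<longlonglongrightarrow> 0"
proof -
  define S where "S N \<omega> = (\<Sum>k=1..N. X k \<omega>)" for N \<omega>
  define D where "D m \<omega> = (\<Sum>k\<in>{m\<^sup>2<..(m + 1)\<^sup>2}. \<bar>X k \<omega>\<bar>)" for m \<omega>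
  define A where "A j \<omega> = (S ((Suc j)\<^sup>2) \<omega> / real ((Suc j)\<^sup>2) ^ (p + 1))\<^sup>2" for j \<omega>
  define B where "B j \<omega> = (D (Suc j) \<omega> / real ((Suc j)\<^sup>2) ^ (p + 1))\<^sup>2" for j \<omega>
  have [measurable]: "S N \<in> borel_measurable M" "D N \<in> borel_measurable M" for N
    unfolding S_def D_def by measurable
  have K: "0 \<le> K"
    by (rule order_trans[OF _ bound[of 1, simplified]]) (simp add: integral_nonneg_AE)
  have bound': "expectation (\<lambda>\<omega>. (X k \<omega>)\<^sup>2) \<le> K * real n ^ (2 * p)" if "1 \<le> k" "k \<le> n" for k n
    by (rule order_trans[OF bound[OF that(1)]]) (use that K in \<open>auto intro!: mult_left_mono power_mono\<close>)
  have sum2: "summable (\<lambda>j. C / (real (Suc j))\<^sup>2)" for C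
    using summable_mult[OF summable_Suc_iff[THEN iffD2, OF inverse_power_summable[of 2,
        where 'a=real]], of C]
    by (simp add: divide_inverse)
  \<comment> \<open>Both kinds of second moments reduce to this quotient, with \<open>n = m\<^sup>2\<close>.\<close>
  have quot: "n * (L * n ^ (2 * p)) / (n ^ (p + 1))\<^sup>2 = L / n" if "0 < n" for n L :: real
    unfolding power2_eq_square power_add mult_2 using that by (simp add: field_simps)
  have "AE \<omega> in M. (\<lambda>j. A j \<omega>) \<longlonglongrightarrow> 0"
  proof (rule AE_tendsto_0_of_summable_expectation[OF _ _ _ sum2])
    fix j
    let ?m = "Suc j"
    let ?n = "?m\<^sup>2"
    have i: "integrable M (\<lambda>\<omega>. (S ?n \<omega>)\<^sup>2)"
      and E: "expectation (\<lambda>\<omega>. (S ?n \<omega>)\<^sup>2) = (\<Sum>k=1..?n. expectation (\<lambda>\<omega>. (X k \<omega>)\<^sup>2))"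
      unfolding S_def by (rule expectation_square_sum_uncorrelated; use int orth in force)+
    show "integrable M (A j)" using i by (simp add: A_def[abs_def] power_divide)
    have "expectation (A j) = expectation (\<lambda>\<omega>. (S ?n \<omega>)\<^sup>2) / (real ?n ^ (p + 1))\<^sup>2"
      by (simp add: A_def[abs_def] power_divide)
    also have "\<dots> \<le> (\<Sum>k=1..?n. K * real ?n ^ (2 * p)) / (real ?n ^ (p + 1))\<^sup>2"
      unfolding E by (intro divide_right_mono sum_mono bound') auto
    also have "\<dots> = K / (real ?m)\<^sup>2"
      using quot[of "real ?n" K] by (simp del: of_nat_Suc)
    finally show "expectation (A j) \<le> K / (real ?m)\<^sup>2" .
  qed (simp add: A_def)
  moreover have "AE \<omega> in M. (\<lambda>j. B j \<omega>) \<longlonglongrightarrow> 0"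
  proof (rule AE_tendsto_0_of_summable_expectation[OF _ _ _ sum2])
    fix j
    let ?m = "Suc j"
    let ?I = "{?m\<^sup>2<..(?m + 1)\<^sup>2}"
    have card: "real (card ?I) = 2 * real ?m + 1"
      by (simp add: power2_eq_square algebra_simps)
    have Dle: "(D ?m \<omega>)\<^sup>2 \<le> (2 * real ?m + 1) * (\<Sum>k\<in>?I. (X k \<omega>)\<^sup>2)" for \<omega>
      unfolding D_def card[symmetric] using square_sum_le_card_sum_squares[of "\<lambda>k. \<bar>X k \<omega>\<bar>" ?I] by simp
    have i0: "integrable M (\<lambda>\<omega>. (2 * real ?m + 1) * (\<Sum>k\<in>?I. (X k \<omega>)\<^sup>2))"
      by (intro Bochner_Integration.integrable_sum integrable_mult_right int) (auto simp: Suc_le_eq)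
    have i: "integrable M (\<lambda>\<omega>. (D ?m \<omega>)\<^sup>2)"
      by (rule Bochner_Integration.integrable_bound[OF i0])
         (use Dle in \<open>auto intro!: AE_I2 order_trans[OF Dle]\<close>)
    show "integrable M (B j)" using i by (simp add: B_def[abs_def] power_divide)
    have "expectation (B j) = expectation (\<lambda>\<omega>. (D ?m \<omega>)\<^sup>2) / (real (?m\<^sup>2) ^ (p + 1))\<^sup>2"
      by (simp add: B_def[abs_def] power_divide)
    also have "expectation (\<lambda>\<omega>. (D ?m \<omega>)\<^sup>2) \<le> expectation (\<lambda>\<omega>. (2 * real ?m + 1) * (\<Sum>k\<in>?I. (X k \<omega>)\<^sup>2))"
      by (rule integral_mono[OF i i0 Dle])
    also have "\<dots> = (2 * real ?m + 1) * (\<Sum>k\<in>?I. expectation (\<lambda>\<omega>. (X k \<omega>)\<^sup>2))"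
      by (subst integral_mult_right_zero, subst Bochner_Integration.integral_sum)
         (auto intro!: int simp: Suc_le_eq)
    also have "\<dots> \<le> (2 * real ?m + 1) * (\<Sum>k\<in>?I. K * real ((?m + 1)\<^sup>2) ^ (2 * p))"
      by (intro mult_left_mono sum_mono bound') (auto simp: Suc_le_eq)
    also have "\<dots> = (2 * real ?m + 1)\<^sup>2 * (K * real ((?m + 1)\<^sup>2) ^ (2 * p))"
      unfolding sum_constant card by (simp add: power2_eq_square)
    also have "\<dots> \<le> (3 * real ?m)\<^sup>2 * (K * (4 * real (?m\<^sup>2)) ^ (2 * p))"
    proof (intro mult_mono power_mono mult_left_mono)
      have "real (?m + 1) \<le> 2 * real ?m" by simp
      then have "(real (?m + 1))\<^sup>2 \<le> (2 * real ?m)\<^sup>2" by (rule power_mono) simp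
      then show "real ((?m + 1)\<^sup>2) \<le> 4 * real (?m\<^sup>2)" by (simp del: of_nat_Suc add: power_mult_distrib)
    qed (use K in auto)
    finally have "expectation (B j)
        \<le> (3 * real ?m)\<^sup>2 * (K * (4 * real (?m\<^sup>2)) ^ (2 * p)) / (real (?m\<^sup>2) ^ (p + 1))\<^sup>2"
      by (simp add: divide_right_mono)
    also have "\<dots> = (9 * K * 4 ^ (2 * p)) / (real ?m)\<^sup>2"
      using quot[of "real (?m\<^sup>2)" "9 * K * 4 ^ (2 * p)"]
      by (simp add: power_mult_distrib mult_ac del: of_nat_Suc)
    finally show "expectation (B j) \<le> (9 * K * 4 ^ (2 * p)) / (real ?m)\<^sup>2" .
  qed (simp add: B_def)
  ultimately show ?thesis
  proof eventually_elim
    case (elim \<omega>)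
    show ?case
    proof (rule tendstoI)
      fix e :: real assume "0 < e"
      then have "\<forall>\<^sub>F j in sequentially. A j \<omega> < (e / 2)\<^sup>2 \<and> B j \<omega> < (e / 2)\<^sup>2"
        using elim by (intro eventually_conj order_tendstoD) auto
      then obtain j0 where j0: "\<And>j. j0 \<le> j \<Longrightarrow> A j \<omega> < (e / 2)\<^sup>2 \<and> B j \<omega> < (e / 2)\<^sup>2"
        by (auto simp: eventually_sequentially)
      show "\<forall>\<^sub>F N in sequentially. dist ((\<Sum>k=1..N. X k \<omega>) / real N ^ (p + 1)) 0 < e"
        unfolding eventually_sequentially
      proof (intro exI[of _ "(Suc j0)\<^sup>2"] allI impI)
        fix N assume N: "(Suc j0)\<^sup>2 \<le> N"
        define m where "m = floor_sqrt N"
        have m: "m\<^sup>2 \<le> N" "N < (m + 1)\<^sup>2" "Suc j0 \<le> m"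
          using N Suc_floor_sqrt_power2_gt[of N] le_floor_sqrtI[OF N]
          by (auto simp: m_def)
        then obtain j where j: "m = Suc j" "j0 \<le> j" by (cases m) auto
        let ?d = "real (m\<^sup>2) ^ (p + 1)"
        have d: "0 < ?d" using j by simp
        have sq: "\<bar>S (m\<^sup>2) \<omega> / ?d\<bar>\<^sup>2 < (e / 2)\<^sup>2" "\<bar>D m \<omega> / ?d\<bar>\<^sup>2 < (e / 2)\<^sup>2"
          using j0[OF j(2)] by (simp_all only: A_def B_def j(1) power2_abs)
        have lt: "\<bar>S (m\<^sup>2) \<omega> / ?d\<bar> < e / 2" "\<bar>D m \<omega> / ?d\<bar> < e / 2"
          by (rule power_less_imp_less_base[OF sq(1)] power_less_imp_less_base[OF sq(2)],
              use \<open>0 < e\<close> in simp)+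
        have "S N \<omega> = S (m\<^sup>2) \<omega> + (\<Sum>k\<in>{m\<^sup>2<..N}. X k \<omega>)"
          unfolding S_def using m(1)
          by (subst sum.union_disjoint[symmetric]) (auto intro!: sum.cong)
        also have "\<bar>\<dots>\<bar> \<le> \<bar>S (m\<^sup>2) \<omega>\<bar> + D m \<omega>"
        proof -
          have "\<bar>\<Sum>k\<in>{m\<^sup>2<..N}. X k \<omega>\<bar> \<le> (\<Sum>k\<in>{m\<^sup>2<..N}. \<bar>X k \<omega>\<bar>)" by (rule sum_abs)
          also have "\<dots> \<le> D m \<omega>" unfolding D_def using m by (intro sum_mono2) auto
          finally show ?thesis by linarith
        qed
        finally have "\<bar>S N \<omega>\<bar> \<le> \<bar>S (m\<^sup>2) \<omega>\<bar> + D m \<omega>" .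
        moreover have "?d \<le> real N ^ (p + 1)" using m(1) by (intro power_mono) auto
        ultimately have "\<bar>S N \<omega>\<bar> / real N ^ (p + 1) \<le> (\<bar>S (m\<^sup>2) \<omega>\<bar> + D m \<omega>) / ?d"
          using d by (intro frac_le) auto
        also have "\<dots> = \<bar>S (m\<^sup>2) \<omega> / ?d\<bar> + D m \<omega> / ?d"
          using d by (simp add: add_divide_distrib abs_divide)
        also have "\<dots> < e" using lt abs_ge_self[of "D m \<omega> / ?d"] by linarith
        finally show "dist ((\<Sum>k=1..N. X k \<omega>) / real N ^ (p + 1)) 0 < e"
          by (simp add: S_def dist_real_def abs_divide)
      qed
    qed
  qed
qed

text \<open>
  The characteristic function of the sum is a product of factors within \<open>O(N\<^bsup>- 3/2\<^esup>)\<close> of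
  \<open>exp (- t\<^sup>2 (c N k)\<^sup>2 E (Y k)\<^sup>2 / 2)\<close>, because the third absolute moments are bounded; products of \<open>N\<close> numbers
  in the unit disc then differ by at most \<open>O(N\<^bsup>- 1/2\<^esup>)\<close>. The weights depend on \<open>N\<close> to cover sums whose
  variances grow with the index.
\<close>

theorem (in prob_space) lyapunov_clt_char:
  fixes Y :: "nat \<Rightarrow> 'a \<Rightarrow> real" and c :: "nat \<Rightarrow> nat \<Rightarrow> real"
  assumes indep: "indep_vars (\<lambda>_. borel) Y {1..}"
    and mean: "\<And>k. 1 \<le> k \<Longrightarrow> expectation (Y k) = 0"
    and int: "\<And>k. 1 \<le> k \<Longrightarrow> integrable M (\<lambda>\<omega>. (Y k \<omega>) ^ 4)"
    and bound: "\<And>k. 1 \<le> k \<Longrightarrow> expectation (\<lambda>\<omega>. (Y k \<omega>) ^ 4) \<le> K"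
    and c: "\<And>N k. k \<in> {1..N} \<Longrightarrow> \<bar>c N k\<bar> \<le> d / sqrt (real N)"
    and var: "(\<lambda>N. \<Sum>k=1..N. (c N k)\<^sup>2 * expectation (\<lambda>\<omega>. (Y k \<omega>)\<^sup>2)) \<longlonglongrightarrow> s2"
  shows "(\<lambda>N. char (distr M borel (\<lambda>\<omega>. \<Sum>k=1..N. c N k * Y k \<omega>)) t)
           \<longlonglongrightarrow> complex_of_real (exp (- (t\<^sup>2 * s2) / 2))"
proof -
  have meas: "Y k \<in> borel_measurable M" if "1 \<le> k" for k
    using indep that unfolding indep_vars_def2 by auto
  define s where "s k = expectation (\<lambda>\<omega>. (Y k \<omega>)\<^sup>2)" for k
  define z where "z N k = char (distr M borel (\<lambda>\<omega>. c N k * Y k \<omega>)) t" for N k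
  define e where "e N k = exp (- (t\<^sup>2 * ((c N k)\<^sup>2 * s k)) / 2)" for N k
  have K: "0 \<le> K" by (rule order_trans[OF _ bound[of 1]]) (auto simp: integral_nonneg_AE)
  have d: "0 \<le> d" using c[of 1 1] by auto
  have int2: "integrable M (\<lambda>\<omega>. (Y k \<omega>)\<^sup>2)" if "1 \<le> k" for k
    by (rule square_integrable_imp_integrable)
       (use int[OF that] meas[OF that] in \<open>simp_all add: power_mult[symmetric]\<close>)
  have int1: "integrable M (Y k)" if "1 \<le> k" for k
    using meas[OF that] int2[OF that] by (rule square_integrable_imp_integrable)
  have pow3: "\<bar>x\<bar> ^ 3 \<le> 1 + x ^ 4" for x :: real
  proof (cases "\<bar>x\<bar> \<le> 1")
    case True
    then have "\<bar>x\<bar> ^ 3 \<le> 1" by (intro power_le_one) auto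
    then show ?thesis by (smt (verit) zero_le_even_power even_numeral)
  next
    case False
    then have "\<bar>x\<bar> ^ 3 \<le> \<bar>x\<bar> ^ 4" by (intro power_increasing) auto
    then show ?thesis by simp
  qed
  have int3: "integrable M (\<lambda>\<omega>. \<bar>Y k \<omega>\<bar> ^ 3)" if "1 \<le> k" for k
    by (rule Bochner_Integration.integrable_bound[of _ "\<lambda>\<omega>. 1 + (Y k \<omega>) ^ 4"])
       (use int[OF that] meas[OF that] pow3 in \<open>auto intro!: AE_I2 intro: order_trans[OF pow3]\<close>)
  have s: "0 \<le> s k" "s k \<le> 1 + K" if "1 \<le> k" for k
  proof -
    show "0 \<le> s k" by (simp add: s_def integral_nonneg_AE)
    have "s k \<le> expectation (\<lambda>\<omega>. 1 + (Y k \<omega>) ^ 4)"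
      unfolding s_def by (rule integral_mono)
          (use int2[OF that] int[OF that] square_le_one_plus_fourth_power in auto)
    also have "\<dots> \<le> 1 + K" using int[OF that] bound[OF that] by (simp add: prob_space)
    finally show "s k \<le> 1 + K" .
  qed
  have E3: "expectation (\<lambda>\<omega>. \<bar>Y k \<omega>\<bar> ^ 3) \<le> 1 + K" if "1 \<le> k" for k
  proof -
    have "expectation (\<lambda>\<omega>. \<bar>Y k \<omega>\<bar> ^ 3) \<le> expectation (\<lambda>\<omega>. 1 + (Y k \<omega>) ^ 4)"
      by (rule integral_mono) (use int3[OF that] int[OF that] pow3 in auto)
    also have "\<dots> \<le> 1 + K" using int[OF that] bound[OF that] by (simp add: prob_space)
    finally show ?thesis .
  qed
  define a where "a = \<bar>t\<bar> ^ 3 * d ^ 3 * (1 + K) / 6"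
  define b where "b = t ^ 4 * d ^ 4 * (1 + K)\<^sup>2 / 8"
  have step: "cmod (z N k - of_real (e N k)) \<le> a / (real N * sqrt (real N)) + b / (real N)\<^sup>2"
    if k: "k \<in> {1..N}" for N k
  proof -
    have k1: "1 \<le> k" using k by simp
    have N: "0 < real N" using k by simp
    note [measurable] = meas[OF k1]
    let ?c = "c N k"
    have "cmod (z N k - (1 - t\<^sup>2 * (?c\<^sup>2 * s k) / 2))
        \<le> (t\<^sup>2 / 6) * expectation (\<lambda>\<omega>. min (6 * (?c * Y k \<omega>)\<^sup>2) (\<bar>t\<bar> * \<bar>?c * Y k \<omega>\<bar> ^ 3))"
      unfolding z_def
      using mean[OF k1] int1[OF k1] int2[OF k1]
      by (intro char_approx3') (auto simp: power_mult_distrib s_def)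
    also have "\<dots> \<le> (t\<^sup>2 / 6) * expectation (\<lambda>\<omega>. \<bar>t\<bar> * (\<bar>?c\<bar> ^ 3 * \<bar>Y k \<omega>\<bar> ^ 3))"
    proof (intro mult_left_mono integral_mono)
      show "integrable M (\<lambda>\<omega>. \<bar>t\<bar> * (\<bar>?c\<bar> ^ 3 * \<bar>Y k \<omega>\<bar> ^ 3))" using int3[OF k1] by simp
      then show "integrable M (\<lambda>\<omega>. min (6 * (?c * Y k \<omega>)\<^sup>2) (\<bar>t\<bar> * \<bar>?c * Y k \<omega>\<bar> ^ 3))"
        by (rule Bochner_Integration.integrable_bound) (auto simp: abs_mult power_mult_distrib)
    qed (auto simp: abs_mult power_mult_distrib)
    also have "\<dots> = \<bar>t\<bar> ^ 3 / 6 * (\<bar>?c\<bar> ^ 3 * expectation (\<lambda>\<omega>. \<bar>Y k \<omega>\<bar> ^ 3))"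
      by (simp add: power3_eq_cube power2_eq_square abs_mult_self_eq)
    also have "\<dots> \<le> \<bar>t\<bar> ^ 3 / 6 * ((d / sqrt (real N)) ^ 3 * (1 + K))"
      using c[OF k] E3[OF k1] K d
      by (intro mult_left_mono mult_mono power_mono) (auto simp: integral_nonneg_AE)
    also have "\<dots> = a / (real N * sqrt (real N))"
      using N by (simp add: a_def power_divide power3_eq_cube field_simps)
    finally have 1: "cmod (z N k - (1 - t\<^sup>2 * (?c\<^sup>2 * s k) / 2)) \<le> a / (real N * sqrt (real N))" .
    define x where "x = t\<^sup>2 * (?c\<^sup>2 * s k) / 2"
    have x: "0 \<le> x" using s[OF k1] by (simp add: x_def)
    have ex: "\<bar>(1 - x) - exp (- x)\<bar> \<le> x\<^sup>2 / 2"
    proof -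
      have "1 - x \<le> exp (- x)" using exp_ge_add_one_self[of "-x"] by simp
      moreover have "exp (- x) \<le> 1 - x + x\<^sup>2 / 2"
      proof -
        define f where "f y = 1 - y + y\<^sup>2 / 2 - exp (- y)" for y :: real
        have "f 0 \<le> f x"
        proof (rule DERIV_nonneg_imp_nondecreasing[OF x])
          fix y :: real assume "0 \<le> y"
          show "\<exists>v. (f has_real_derivative v) (at y) \<and> 0 \<le> v"
            by (rule exI[of _ "- 1 + y + exp (- y)"])
               (use exp_ge_add_one_self[of "-y"] in \<open>auto simp: f_def[abs_def] intro!:
                   derivative_eq_intros\<close>)
        qed
        then show ?thesis by (simp add: f_def)
      qed
      ultimately show ?thesis by (simp add: abs_le_iff)
    qed
    have "x \<le> t\<^sup>2 * ((d / sqrt (real N))\<^sup>2 * (1 + K)) / 2"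
      unfolding x_def power2_abs[of ?c, symmetric]
      using c[OF k] s[OF k1] d K by (intro divide_right_mono mult_left_mono mult_mono power_mono) auto
    then have "x\<^sup>2 \<le> (t\<^sup>2 * ((d / sqrt (real N))\<^sup>2 * (1 + K)) / 2)\<^sup>2"
      using x by (rule power_mono)
    also have "\<dots> = 2 * (b / (real N)\<^sup>2)"
      using N by (simp add: b_def power_divide power_mult_distrib power2_eq_square power4_eq_xxxx
          field_simps)
    finally have "\<bar>(1 - x) - exp (- x)\<bar> \<le> b / (real N)\<^sup>2" using ex by simp
    moreover have "exp (- x) = e N k" by (simp add: x_def e_def)
    ultimately have 2: "cmod (of_real (1 - x) - of_real (e N k)) \<le> b / (real N)\<^sup>2"
      by (metis norm_of_real of_real_diff)
    have "z N k - of_real (e N k) = (z N k - (1 - t\<^sup>2 * (?c\<^sup>2 * s k) / 2))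
        + (of_real (1 - x) - of_real (e N k))"
      by (simp add: x_def)
    then show ?thesis using 1 2 by (metis (no_types, lifting) add_mono norm_triangle_le)
  qed
  have char: "char (distr M borel (\<lambda>\<omega>. \<Sum>k=1..N. c N k * Y k \<omega>)) t = (\<Prod>k=1..N. z N k)" for N
  proof -
    have "indep_vars (\<lambda>_. borel) (\<lambda>k \<omega>. c N k * Y k \<omega>) {1..N}"
      by (rule indep_vars_compose2[OF indep_vars_subset[OF indep]]) auto
    from char_distr_sum[OF this] show ?thesis by (simp add: z_def)
  qed
  have z1: "cmod (z N k) \<le> 1" if "1 \<le> k" for N k
    unfolding z_def using meas[OF that]
    by (intro real_distribution.cmod_char_le_1 real_distribution_distr) simp
  have e1: "cmod (of_real (e N k)) \<le> 1" if "1 \<le> k" for N k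
    using s[OF that] by (simp add: e_def)
  have "cmod ((\<Prod>k=1..N. z N k) - (\<Prod>k=1..N. of_real (e N k))) \<le> a / sqrt (real N) + b / real N" if "1
      \<le> N" for N
  proof -
    have "cmod ((\<Prod>k=1..N. z N k) - (\<Prod>k=1..N. of_real (e N k)))
        \<le> (\<Sum>k=1..N. cmod (z N k - of_real (e N k)))"
      by (rule norm_prod_diff) (use z1 e1 in auto)
    also have "\<dots> \<le> (\<Sum>k=1..N. a / (real N * sqrt (real N)) + b / (real N)\<^sup>2)"
      by (rule sum_mono) (rule step)
    also have "\<dots> = a / sqrt (real N) + b / real N"
      using that by (simp add: power2_eq_square field_simps)
    finally show ?thesis .
  qed
  then have "\<forall>\<^sub>F N in sequentially. cmod ((\<Prod>k=1..N. z N k) - (\<Prod>k=1..N. of_real (e N k)))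
      \<le> a / sqrt (real N) + b / real N"
    by (auto simp: eventually_sequentially)
  moreover have "(\<lambda>N. a / sqrt (real N) + b / real N) \<longlonglongrightarrow> 0"
  proof -
    have "(\<lambda>N. a / sqrt (real N)) \<longlonglongrightarrow> 0"
      by (intro tendsto_divide_0[OF tendsto_const] filterlim_at_top_imp_at_infinity
            filterlim_compose[OF sqrt_at_top] filterlim_real_sequentially)
    from tendsto_add[OF this lim_const_over_n[of b]] show ?thesis by simp
  qed
  ultimately have "(\<lambda>N. (\<Prod>k=1..N. z N k) - (\<Prod>k=1..N. of_real (e N k))) \<longlonglongrightarrow> 0"
    by (rule Lim_null_comparison)
  moreover have "(\<lambda>N. \<Prod>k=1..N. complex_of_real (e N k)) \<longlonglongrightarrow> complex_of_real (exp (- (t\<^sup>2 * s2) / 2))"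
  proof -
    have "(\<Prod>k=1..N. complex_of_real (e N k))
        = complex_of_real (exp (- (t\<^sup>2 * (\<Sum>k=1..N. (c N k)\<^sup>2 * s k)) / 2))" for N
    proof -
      have "(\<Prod>k=1..N. e N k) = exp (\<Sum>k=1..N. - (t\<^sup>2 * ((c N k)\<^sup>2 * s k)) / 2)"
        unfolding e_def by (rule exp_sum[symmetric]) simp
      also have "(\<Sum>k=1..N. - (t\<^sup>2 * ((c N k)\<^sup>2 * s k)) / 2) = - (t\<^sup>2 * (\<Sum>k=1..N. (c N k)\<^sup>2 * s k)) / 2"
        by (simp add: sum_distrib_left sum_negf sum_divide_distrib)
      finally show ?thesis by (simp flip: of_real_prod)
    qed
    then show ?thesis using var unfolding s_def[symmetric]
      by (simp only:) (intro tendsto_of_real tendsto_intros tendsto_minus; simp)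
  qed
  ultimately have "(\<lambda>N. ((\<Prod>k=1..N. z N k) - (\<Prod>k=1..N. of_real (e N k))) + (\<Prod>k=1..N. of_real (e N k)))
      \<longlonglongrightarrow> 0 + complex_of_real (exp (- (t\<^sup>2 * s2) / 2))"
    by (rule tendsto_add)
  then show ?thesis unfolding char by simp
qed

lemma (in prob_space) char_distr:
  assumes [measurable]: "X \<in> borel_measurable M"
  shows "char (distr M borel X) t = (CLINT \<omega>|M. iexp (t * X \<omega>))"
  by (simp add: char_def integral_distr)

text \<open>
  Slutsky's theorem with random coefficients: \<open>\<alpha> N\<close> and \<open>\<beta> N\<close> converge almost surely while \<open>X N\<close> and \<open>Y N\<close>
  are only bounded in mean square. The product of the two kinds of quantities is separated by
  \<open>\<bar>p x\<bar> \<le> p\<^sup>2 / (4 \<epsilon>) + \<epsilon> x\<^sup>2\<close>, where the first term tends to 0 almost surely and the second has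
  expectation at most \<open>\<epsilon> K\<close>.
\<close>

lemma (in prob_space) slutsky_char:
  fixes Z X Y :: "nat \<Rightarrow> 'a \<Rightarrow> real"
  assumes [measurable]: "\<And>N. Z N \<in> borel_measurable M" "\<And>N. X N \<in> borel_measurable M"
      "\<And>N. Y N \<in> borel_measurable M"
    and intX: "\<And>N. integrable M (\<lambda>\<omega>. (X N \<omega>)\<^sup>2)" and EX: "\<And>N. expectation (\<lambda>\<omega>. (X N \<omega>)\<^sup>2) \<le> K"
    and intY: "\<And>N. integrable M (\<lambda>\<omega>. (Y N \<omega>)\<^sup>2)" and EY: "\<And>N. expectation (\<lambda>\<omega>. (Y N \<omega>)\<^sup>2) \<le> K"
    and eq: "AE \<omega> in M. (\<forall>\<^sub>F N in sequentially. Z N \<omega> = \<alpha> N \<omega> * X N \<omega> + \<beta> N \<omega> * Y N \<omega>) \<and>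
        (\<lambda>N. \<alpha> N \<omega>) \<longlonglongrightarrow> c \<and> (\<lambda>N. \<beta> N \<omega>) \<longlonglongrightarrow> 0"
    and lim: "(\<lambda>N. char (distr M borel (X N)) (t * c)) \<longlonglongrightarrow> l"
  shows "(\<lambda>N. char (distr M borel (Z N)) t) \<longlonglongrightarrow> l"
proof -
  define Q where "Q N \<omega> = (X N \<omega>)\<^sup>2 + (Y N \<omega>)\<^sup>2" for N \<omega>
  define D where "D N \<omega> = min 2 \<bar>t * (Z N \<omega> - c * X N \<omega>)\<bar>" for N \<omega>
  have [measurable]: "Q N \<in> borel_measurable M" "D N \<in> borel_measurable M" for N
    unfolding Q_def D_def by measurable
  have Q0: "0 \<le> Q N \<omega>" for N \<omega> by (simp add: Q_def)
  have intQ: "integrable M (Q N)" for N unfolding Q_def using intX intY by simp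
  have EQ: "expectation (Q N) \<le> 2 * K" for N
    unfolding Q_def using intX[of N] intY[of N] EX[of N] EY[of N] by simp
  have K: "0 \<le> K"
    using EX[of 0] by (rule order_trans[rotated]) (simp add: integral_nonneg_AE)
  have D: "0 \<le> D N \<omega>" "D N \<omega> \<le> 2" for N \<omega> by (auto simp: D_def)
  have intD: "integrable M (D N)" for N
    by (rule integrable_const_bound[where B = 2]) (use D in auto)
  have D_lim: "(\<lambda>N. expectation (D N)) \<longlonglongrightarrow> 0"
  proof (rule tendstoI)
    fix e :: real assume e: "0 < e"
    define \<epsilon> where "\<epsilon> = e / (4 * (K + 1))"
    have \<epsilon>: "0 < \<epsilon>" using e K by (simp add: \<epsilon>_def)
    \<comment> \<open>The excess of \<open>D\<close> over its mean square part: bounded, and almost surely convergent to 0.\<close>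
    define G where "G N \<omega> = max 0 (D N \<omega> - \<epsilon> * Q N \<omega>)" for N \<omega>
    have [measurable]: "G N \<in> borel_measurable M" for N
      unfolding G_def by measurable
    have G: "0 \<le> G N \<omega>" "G N \<omega> \<le> 2" for N \<omega>
      using D[of N \<omega>] mult_nonneg_nonneg[OF less_imp_le[OF \<epsilon>] Q0[of N \<omega>]]
      unfolding G_def by linarith+
    have "(\<lambda>N. expectation (G N)) \<longlonglongrightarrow> expectation (\<lambda>_. 0)"
    proof (rule integral_dominated_convergence[where w = "\<lambda>_. 2"])
      show "AE \<omega> in M. (\<lambda>N. G N \<omega>) \<longlonglongrightarrow> 0"
        using eq
      proof eventually_elim
        case (elim \<omega>)
        define b where "b N = t\<^sup>2 * (\<alpha> N \<omega> - c)\<^sup>2 / (4 * \<epsilon>) + t\<^sup>2 * (\<beta> N \<omega>)\<^sup>2 / (4 * \<epsilon>)" for N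
        have "(\<lambda>N. t\<^sup>2 * (\<alpha> N \<omega> - c)\<^sup>2 / (4 * \<epsilon>) + t\<^sup>2 * (\<beta> N \<omega>)\<^sup>2 / (4 * \<epsilon>))
            \<longlonglongrightarrow> t\<^sup>2 * (c - c)\<^sup>2 / (4 * \<epsilon>) + t\<^sup>2 * 0\<^sup>2 / (4 * \<epsilon>)"
          using elim \<epsilon> by (intro tendsto_intros) auto
        then have blim: "b \<longlonglongrightarrow> 0" by (simp add: b_def[abs_def])
        have amgm: "\<bar>p * x\<bar> \<le> p\<^sup>2 / (4 * \<epsilon>) + \<epsilon> * x\<^sup>2" for p x :: real
        proof -
          have "0 \<le> (\<bar>p\<bar> - 2 * \<epsilon> * \<bar>x\<bar>)\<^sup>2" by simp
          then have "4 * \<epsilon> * \<bar>p * x\<bar> \<le> p\<^sup>2 + 4 * \<epsilon> * (\<epsilon> * x\<^sup>2)"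
            by (simp add: power2_diff power_mult_distrib abs_mult power2_eq_square algebra_simps)
          then show ?thesis using \<epsilon> by (simp add: field_simps)
        qed
        have "\<forall>\<^sub>F N in sequentially. \<bar>G N \<omega>\<bar> \<le> b N"
          using elim[THEN conjunct1]
        proof eventually_elim
          case (elim N)
          have "t * (Z N \<omega> - c * X N \<omega>) = (t * (\<alpha> N \<omega> - c)) * X N \<omega> + (t * \<beta> N \<omega>) * Y N \<omega>"
            by (simp add: elim algebra_simps)
          then have "D N \<omega> \<le> \<bar>(t * (\<alpha> N \<omega> - c)) * X N \<omega>\<bar> + \<bar>(t * \<beta> N \<omega>) * Y N \<omega>\<bar>"
            unfolding D_def by (metis abs_triangle_ineq min.coboundedI2)
          also have "\<dots> \<le> b N + \<epsilon> * Q N \<omega>"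
            using amgm[of "t * (\<alpha> N \<omega> - c)" "X N \<omega>"] amgm[of "t * \<beta> N \<omega>" "Y N \<omega>"]
            unfolding b_def Q_def power_mult_distrib[symmetric] distrib_left by linarith
          finally have "D N \<omega> - \<epsilon> * Q N \<omega> \<le> b N" by simp
          moreover have "0 \<le> b N" using \<epsilon> by (simp add: b_def)
          ultimately show ?case by (simp add: G_def)
        qed
        then show ?case
          by (intro Lim_null_comparison[OF _ blim]) simp
      qed
    qed (use G in auto)
    then have "\<forall>\<^sub>F N in sequentially. expectation (G N) < e / 2"
      by (rule order_tendstoD) (use e in simp)
    then show "\<forall>\<^sub>F N in sequentially. dist (expectation (D N)) 0 < e"
    proof eventually_elim
      case (elim N)
      have iG: "integrable M (G N)"
        by (rule integrable_const_bound[where B = 2]) (use G in auto)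
      have "expectation (D N) \<le> expectation (\<lambda>\<omega>. G N \<omega> + \<epsilon> * Q N \<omega>)"
        by (rule integral_mono) (use intD iG intQ in \<open>auto simp: G_def\<close>)
      also have "\<dots> = expectation (G N) + \<epsilon> * expectation (Q N)"
        using iG intQ by simp
      also have "\<dots> < e / 2 + \<epsilon> * (2 * K)"
        using elim EQ[of N] \<epsilon> by (intro add_less_le_mono mult_left_mono) auto
      also have "\<epsilon> * (2 * K) \<le> e / 2"
        using K e by (simp add: \<epsilon>_def field_simps)
      finally have "expectation (D N) < e" by simp
      then show ?case using D by (simp add: integral_nonneg_AE)
    qed
  qed
  have cmod_iexp: "cmod (iexp x - iexp y) \<le> min 2 \<bar>x - y\<bar>" for x y
  proof -
    have "cmod (iexp x - iexp y) = cmod (iexp y * (iexp (x - y) - 1))"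
      by (simp add: algebra_simps exp_add[symmetric] exp_minus)
    also have "\<dots> = cmod (iexp (x - y) - 1)" by (simp add: norm_mult)
    also have "\<dots> \<le> \<bar>x - y\<bar>" using iexp_approx1[of "x - y" 0] by simp
    finally have "cmod (iexp x - iexp y) \<le> \<bar>x - y\<bar>" .
    moreover have "cmod (iexp x - iexp y) \<le> 2"
      using norm_triangle_ineq4[of "iexp x" "iexp y"] by simp
    ultimately show ?thesis by simp
  qed
  have int_iexp: "complex_integrable M (\<lambda>\<omega>. iexp (f \<omega>))" if [measurable]: "f \<in> borel_measurable M" for f
    by (rule integrable_const_bound[where B = 1]) auto
  have "cmod (char (distr M borel (Z N)) t - char (distr M borel (X N)) (t * c))
      \<le> expectation (D N)" for N
  proof -
    have "char (distr M borel (Z N)) t - char (distr M borel (X N)) (t * c)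
        = (CLINT \<omega>|M. iexp (t * Z N \<omega>) - iexp (t * c * X N \<omega>))"
      by (subst (1 2) char_distr, measurable)
         (rule Bochner_Integration.integral_diff[symmetric]; rule int_iexp; measurable)
    also have "cmod \<dots> \<le> (LINT \<omega>|M. cmod (iexp (t * Z N \<omega>) - iexp (t * c * X N \<omega>)))"
      by (rule integral_norm_bound)
    also have "\<dots> \<le> expectation (D N)"
    proof (rule integral_mono)
      show "integrable M (\<lambda>\<omega>. cmod (iexp (t * Z N \<omega>) - iexp (t * c * X N \<omega>)))"
        by (intro integrable_norm Bochner_Integration.integrable_diff int_iexp) auto
      show "cmod (iexp (t * Z N \<omega>) - iexp (t * c * X N \<omega>)) \<le> D N \<omega>" for \<omega>
        using cmod_iexp[of "t * Z N \<omega>" "t * c * X N \<omega>"] by (simp add: D_def algebra_simps)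
    qed (rule intD)
    finally show ?thesis .
  qed
  then have "(\<lambda>N. char (distr M borel (Z N)) t - char (distr M borel (X N)) (t * c)) \<longlonglongrightarrow> 0"
    by (intro Lim_null_comparison[OF always_eventually[OF allI] D_lim])
  from tendsto_add[OF this lim] show ?thesis by simp
qed

lemma char_normal_law:
  assumes "0 < s2"
  shows "char (normal_law 0 s2) t = complex_of_real (exp (- (t\<^sup>2 * s2) / 2))"
proof -
  interpret N: prob_space std_normal_distribution
    by (rule prob_space_normal_density) simp
  have "distributed std_normal_distribution lborel (\<lambda>x. x) std_normal_density"
    by (auto simp: distributed_def distr_id2 cong: distr_cong)
  then have "distributed std_normal_distribution lborel (\<lambda>x. 0 + sqrt s2 * x)
      (normal_density (0 + sqrt s2 * 0) (\<bar>sqrt s2\<bar> * 1))"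
    by (rule N.normal_density_affine) (use assms in auto)
  then have "distr std_normal_distribution lborel (\<lambda>x. sqrt s2 * x) = normal_law 0 s2"
    using assms by (auto simp: distributed_def normal_law_def)
  then have eq: "normal_law 0 s2 = distr std_normal_distribution borel (\<lambda>x. sqrt s2 * x)"
    by (metis distr_cong sets_lborel)
  have "char (normal_law 0 s2) t = char std_normal_distribution (t * sqrt s2)"
    unfolding eq char_def by (subst integral_distr) (auto simp: mult.assoc)
  also have "\<dots> = complex_of_real (exp (- (t\<^sup>2 * s2) / 2))"
    using assms by (simp add: char_std_normal_distribution power_mult_distrib)
  finally show ?thesis .
qed

lemma real_distribution_normal_law:
  assumes "0 < s2"
  shows "real_distribution (normal_law 0 s2)"
  using assms prob_space_normal_density[of "sqrt s2" 0]
  by (simp add: real_distribution_def real_distribution_axioms_def normal_law_def)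

section \<open>Random variables determined by a path\<close>

text \<open>
  A random variable that is almost surely a function of \<open>p\<close>. The exceptional null set makes the class
  closed under almost sure limits, although the sigma-algebra generated by \<open>p\<close> is not complete.
\<close>

definition factors_through :: "'a measure \<Rightarrow> 'b measure \<Rightarrow> ('a \<Rightarrow> 'b) \<Rightarrow> ('a \<Rightarrow> real) \<Rightarrow> bool" where
  "factors_through M N p X \<longleftrightarrow> (\<exists>\<Phi>\<in>borel_measurable N. AE \<omega> in M. X \<omega> = \<Phi> (p \<omega>))"

lemma factors_throughI:
  "\<Phi> \<in> borel_measurable N \<Longrightarrow> (AE \<omega> in M. X \<omega> = \<Phi> (p \<omega>)) \<Longrightarrow> factors_through M N p X"
  unfolding factors_through_def by blast

lemma factors_through_const: "factors_through M N p (\<lambda>_. c)"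
  by (rule factors_throughI[of "\<lambda>_. c"]) auto

lemma factors_through_combine:
  assumes "factors_through M N p X" "factors_through M N p Y"
    and [measurable]: "case_prod f \<in> borel_measurable (borel \<Otimes>\<^sub>M borel)"
  shows "factors_through M N p (\<lambda>\<omega>. f (X \<omega>) (Y \<omega>))"
proof -
  obtain \<Phi> \<Psi> where [measurable]: "\<Phi> \<in> borel_measurable N" "\<Psi> \<in> borel_measurable N"
    and ae: "AE \<omega> in M. X \<omega> = \<Phi> (p \<omega>)" "AE \<omega> in M. Y \<omega> = \<Psi> (p \<omega>)"
    using assms(1,2) unfolding factors_through_def by blast
  show ?thesis
  proof (rule factors_throughI)
    have "(\<lambda>x. case_prod f (\<Phi> x, \<Psi> x)) \<in> borel_measurable N" by measurable
    then show "(\<lambda>x. f (\<Phi> x) (\<Psi> x)) \<in> borel_measurable N" by simp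
    show "AE \<omega> in M. f (X \<omega>) (Y \<omega>) = f (\<Phi> (p \<omega>)) (\<Psi> (p \<omega>))"
      using ae by eventually_elim simp
  qed
qed

lemmas factors_through_add = factors_through_combine[where f = "(+)", simplified]
  and factors_through_diff = factors_through_combine[where f = "(-)", simplified]
  and factors_through_mult = factors_through_combine[where f = "(*)", simplified]

lemma factors_through_sum:
  assumes "\<And>i. i \<in> I \<Longrightarrow> factors_through M N p (X i)"
  shows "factors_through M N p (\<lambda>\<omega>. \<Sum>i\<in>I. X i \<omega>)"
  using assms
proof (induction I rule: infinite_finite_induct)
  case (insert i I)
  then have "factors_through M N p (\<lambda>\<omega>. X i \<omega> + (\<Sum>i\<in>I. X i \<omega>))"
    by (intro factors_through_add) simp_all
  with insert show ?case by simp
qed (simp_all add: factors_through_const)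

lemma factors_through_limit:
  assumes "\<And>n. factors_through M N p (X n)" and lim: "AE \<omega> in M. (\<lambda>n. X n \<omega>) \<longlonglongrightarrow> Y \<omega>"
  shows "factors_through M N p Y"
proof -
  obtain \<Phi> where [measurable]: "\<And>n. \<Phi> n \<in> borel_measurable N"
    and ae: "\<And>n. AE \<omega> in M. X n \<omega> = \<Phi> n (p \<omega>)"
    using assms(1) unfolding factors_through_def by metis
  show ?thesis
  proof (rule factors_throughI)
    show "(\<lambda>x. lim (\<lambda>n. \<Phi> n x)) \<in> borel_measurable N" by measurable
    have "AE \<omega> in M. \<forall>n. X n \<omega> = \<Phi> n (p \<omega>)" using ae by (simp add: AE_all_countable)
    with lim show "AE \<omega> in M. Y \<omega> = lim (\<lambda>n. \<Phi> n (p \<omega>))"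
      by eventually_elim (simp add: limI)
  qed
qed

lemma (in prob_space) factors_through_indep:
  assumes indep: "indep_vars (\<lambda>_. N) p I" and fac: "\<And>i. i \<in> I \<Longrightarrow> factors_through M N (p i) (X i)"
  shows "\<exists>X'. indep_vars (\<lambda>_. borel) X' I \<and> (\<forall>i\<in>I. AE \<omega> in M. X i \<omega> = X' i \<omega>)"
proof -
  obtain \<Phi> where \<Phi>: "\<And>i. i \<in> I \<Longrightarrow> \<Phi> i \<in> borel_measurable N \<and> (AE \<omega> in M. X i \<omega> = \<Phi> i (p i \<omega>))"
    using fac unfolding factors_through_def by metis
  have "indep_vars (\<lambda>_. borel) (\<lambda>i \<omega>. \<Phi> i (p i \<omega>)) I"
    by (rule indep_vars_compose2[OF indep]) (use \<Phi> in auto)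
  then show ?thesis using \<Phi> by blast
qed

section \<open>Increments of a Brownian motion and the isometry\<close>

text \<open>
  The filtration may be larger than the one generated by \<open>w\<close>; in the application it carries all the
  noises at once.
\<close>

locale brownian_basis = stochastic_basis M F
  for M :: "'a measure" and F :: "real \<Rightarrow> 'a measure" +
  fixes w :: "real \<Rightarrow> 'a \<Rightarrow> real"
  assumes brownian: "brownian_motion M F w"
begin

lemma measurable_F_mono: "X \<in> borel_measurable (F s) \<Longrightarrow> s \<le> t \<Longrightarrow> X \<in> borel_measurable (F t)"
  by (rule measurable_from_subalg[rotated]) (auto simp: subalgebra_def space_F dest: sets_F_mono)

lemma measurable_F_M: "X \<in> borel_measurable (F s) \<Longrightarrow> X \<in> borel_measurable M"
  by (rule measurable_from_subalg[OF subalgebra_F])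

lemma w_measurable_F: "0 \<le> s \<Longrightarrow> s \<le> t \<Longrightarrow> w s \<in> borel_measurable (F t)"
  using brownian by (auto simp: brownian_motion_def adapted_on_def intro: measurable_F_mono)

lemma w_measurable: "0 \<le> s \<Longrightarrow> w s \<in> borel_measurable M"
  by (rule measurable_F_M[OF w_measurable_F[of s s]]) auto

definition incr :: "real \<Rightarrow> real \<Rightarrow> 'a \<Rightarrow> real" where
  "incr a b \<omega> = w b \<omega> - w a \<omega>"

lemma incr_measurable_F: "0 \<le> a \<Longrightarrow> a \<le> b \<Longrightarrow> b \<le> c \<Longrightarrow> incr a b \<in> borel_measurable (F c)"
  unfolding incr_def by (intro borel_measurable_diff w_measurable_F) auto

lemma incr_measurable: "0 \<le> a \<Longrightarrow> a \<le> b \<Longrightarrow> incr a b \<in> borel_measurable M"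
  using measurable_F_M[OF incr_measurable_F[of a b b]] by auto

lemma incr_power_has_integral:
  assumes ab: "0 \<le> a" "a \<le> b"
  shows "has_bochner_integral M (\<lambda>\<omega>. incr a b \<omega> ^ (2 * k)) (fact (2 * k) / (2 ^ k * fact k) * (b -
      a) ^ k)"
    and "has_bochner_integral M (\<lambda>\<omega>. incr a b \<omega> ^ (2 * k + 1)) 0"
proof -
  note [measurable] = incr_measurable[OF ab]
  show "has_bochner_integral M (\<lambda>\<omega>. incr a b \<omega> ^ (2 * k)) (fact (2 * k) / (2 ^ k * fact k) * (b - a) ^ k)"
  proof (cases "a = b")
    case True
    then show ?thesis
      by (cases k) (auto simp: incr_def has_bochner_integral_iff prob_space)
  next
    case False
    let ?\<sigma> = "sqrt (b - a)"
    have D: "distr M borel (incr a b) = density lborel (\<lambda>x. ennreal (normal_density 0 ?\<sigma> x))"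
      using brownian ab False unfolding brownian_motion_def normal_law_def incr_def by auto
    have "has_bochner_integral lborel (\<lambda>x. normal_density 0 ?\<sigma> x * x ^ (2 * k))
        (fact (2 * k) / ((2 / (b - a)) ^ k * fact k))"
      using normal_moment_even[of ?\<sigma> 0 k] ab False by simp
    then have "has_bochner_integral (distr M borel (incr a b)) (\<lambda>x. x ^ (2 * k))
        (fact (2 * k) / ((2 / (b - a)) ^ k * fact k))"
      unfolding D by (intro has_bochner_integral_density) auto
    then have "has_bochner_integral M (\<lambda>\<omega>. incr a b \<omega> ^ (2 * k)) (fact (2 * k) / ((2 / (b - a)) ^ k
        * fact k))"
      by (simp add: has_bochner_integral_iff integrable_distr_eq integral_distr del: power_Suc)
    then show ?thesis using ab False by (simp add: power_divide field_simps)
  qed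
  show "has_bochner_integral M (\<lambda>\<omega>. incr a b \<omega> ^ (2 * k + 1)) 0"
  proof (cases "a = b")
    case True
    then show ?thesis by (simp add: incr_def has_bochner_integral_zero)
  next
    case False
    let ?\<sigma> = "sqrt (b - a)"
    have D: "distr M borel (incr a b) = density lborel (\<lambda>x. ennreal (normal_density 0 ?\<sigma> x))"
      using brownian ab False unfolding brownian_motion_def normal_law_def incr_def by auto
    have "has_bochner_integral lborel (\<lambda>x. normal_density 0 ?\<sigma> x * x ^ (2 * k + 1)) 0"
      using normal_moment_odd[of ?\<sigma> 0 k] ab False by simp
    then have "has_bochner_integral (distr M borel (incr a b)) (\<lambda>x. x ^ (2 * k + 1)) 0"
      unfolding D by (intro has_bochner_integral_density) (auto simp del: power_Suc)
    then show "has_bochner_integral M (\<lambda>\<omega>. incr a b \<omega> ^ (2 * k + 1)) 0"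
      by (simp add: has_bochner_integral_iff integrable_distr_eq integral_distr del: power_Suc)
  qed
qed

lemma incr_moments:
  assumes "0 \<le> a" "a \<le> b"
  shows "integrable M (\<lambda>\<omega>. incr a b \<omega> ^ n)"
    and "expectation (\<lambda>\<omega>. incr a b \<omega>) = 0"
    and "expectation (\<lambda>\<omega>. incr a b \<omega> ^ 2) = b - a"
    and "expectation (\<lambda>\<omega>. incr a b \<omega> ^ 3) = 0"
    and "expectation (\<lambda>\<omega>. incr a b \<omega> ^ 4) = 3 * (b - a)\<^sup>2"
proof -
  show "integrable M (\<lambda>\<omega>. incr a b \<omega> ^ n)"
  proof (cases "even n")
    case True
    then show ?thesis
      using incr_power_has_integral(1)[OF assms, of "n div 2"] by (auto simp: has_bochner_integral_iff)
  next
    case False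
    then show ?thesis
      using incr_power_has_integral(2)[OF assms, of "n div 2"] by (auto simp: has_bochner_integral_iff)
  qed
qed (use incr_power_has_integral(2)[OF assms, of 0] incr_power_has_integral(1)[OF assms, of 1]
    incr_power_has_integral(2)[OF assms, of 1] incr_power_has_integral(1)[OF assms, of 2]
  in \<open>auto simp: has_bochner_integral_iff fact_numeral\<close>)

text \<open>
  The case \<open>a = b\<close> is separate because the independence of increments is postulated for strictly
  increasing times only.
\<close>

lemma incr_indep:
  assumes ab: "0 \<le> a" "a \<le> b" and X: "X \<in> borel_measurable (F a)" and iX: "integrable M X"
  shows "integrable M (\<lambda>\<omega>. X \<omega> * incr a b \<omega> ^ n)"
    and "expectation (\<lambda>\<omega>. X \<omega> * incr a b \<omega> ^ n) = expectation X * expectation (\<lambda>\<omega>. incr a b \<omega> ^ n)"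
proof -
  note [measurable] = measurable_F_M[OF X] incr_measurable[OF ab]
  have "integrable M (\<lambda>\<omega>. X \<omega> * incr a b \<omega> ^ n) \<and>
    expectation (\<lambda>\<omega>. X \<omega> * incr a b \<omega> ^ n) = expectation X * expectation (\<lambda>\<omega>. incr a b \<omega> ^ n)"
  proof (cases "a = b")
    case True
    then show ?thesis using iX by (cases n) (auto simp: incr_def prob_space)
  next
    case False
    let ?I = "{incr a b -` A \<inter> space M |A. A \<in> sets borel}"
    have ind: "indep_set (sets (F a)) ?I"
      using brownian ab False unfolding brownian_motion_def incr_def[abs_def] by auto
    have "indep_set (sigma_sets (space M) (sets (F a))) (sigma_sets (space M) ?I)"
    proof (rule indep_set_sigma_sets[OF ind])
      show "Int_stable (sets (F a))" by (auto simp: Int_stable_def)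
      show "Int_stable ?I"
      proof (rule Int_stableI)
        fix A B assume "A \<in> ?I" "B \<in> ?I"
        then obtain A' B' where "A = incr a b -` A' \<inter> space M" "B = incr a b -` B' \<inter> space M"
          "A' \<in> sets borel" "B' \<in> sets borel" by auto
        then show "A \<inter> B \<in> ?I" by (auto intro!: exI[of _ "A' \<inter> B'"])
      qed
    qed
    then have "indep_set (sigma_sets (space M) {X -` A \<inter> space M |A. A
        \<in> sets borel}) (sigma_sets (space M) ?I)"
    proof (unfold indep_sets2_eq, safe)
      fix A assume "A \<in> sigma_sets (space M) {X -` A \<inter> space M |A. A \<in> sets borel}"
      moreover have "{X -` A \<inter> space M |A. A \<in> sets borel} \<subseteq> sets (F a)"
        using measurable_sets[OF X] by (auto simp: space_F)
      ultimately have "A \<in> sigma_sets (space M) (sets (F a))"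
        using sigma_sets_mono'[of _ "sets (F a)" "space M"] by blast
      moreover assume *: "sigma_sets (space M) (sets (F a)) \<subseteq> events"
        "\<forall>A\<in>sigma_sets (space M) (sets (F a)). \<forall>B\<in>sigma_sets (space M) ?I. prob (A \<inter> B) = prob A * prob B"
      ultimately show "A \<in> events" by auto
      fix B assume "B \<in> sigma_sets (space M) ?I"
      with * \<open>A \<in> sigma_sets (space M) (sets (F a))\<close> show "prob (A \<inter> B) = prob A * prob B" by auto
    qed
    then have "indep_var borel X borel (incr a b)"
      unfolding indep_var_eq by auto
    from indep_var_compose[OF this, of "\<lambda>x. x" borel "\<lambda>x. x ^ n" borel]
    have "indep_var borel X borel (\<lambda>\<omega>. incr a b \<omega> ^ n)" by (simp add: comp_def)
    then show ?thesis
      using iX incr_moments(1)[OF ab] by (auto intro: indep_var_integrable indep_var_lebesgue_integral)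
  qed
  then show "integrable M (\<lambda>\<omega>. X \<omega> * incr a b \<omega> ^ n)"
    and "expectation (\<lambda>\<omega>. X \<omega> * incr a b \<omega> ^ n) = expectation X * expectation (\<lambda>\<omega>. incr a b \<omega> ^ n)"
    by auto
qed

lemmas incr_indep_1 = incr_indep[where n = 1, simplified]

text \<open>
  Over the shorter of the two intervals the product of the increments is a square; the rest of the
  longer increment is independent of the past and centred.
\<close>

lemma expectation_incr_product:
  assumes "0 \<le> c" "c \<le> b" "c \<le> d" and X: "X \<in> borel_measurable (F c)" and iX: "integrable M X"
  shows "integrable M (\<lambda>\<omega>. X \<omega> * (incr c b \<omega> * incr c d \<omega>))
      \<and> expectation (\<lambda>\<omega>. X \<omega> * (incr c b \<omega> * incr c d \<omega>)) = expectation X * (min b d - c)"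
proof -
  have *: "integrable M (\<lambda>\<omega>. X \<omega> * (incr c b \<omega> * incr c d \<omega>))
      \<and> expectation (\<lambda>\<omega>. X \<omega> * (incr c b \<omega> * incr c d \<omega>)) = expectation X * (b - c)"
    if bd: "c \<le> b" "b \<le> d" for b d
  proof -
    note sq = incr_indep[OF assms(1) bd(1) X iX, of 2]
    note lin = incr_indep_1[OF assms(1) bd(1) X iX]
    have mF: "(\<lambda>\<omega>. X \<omega> * incr c b \<omega>) \<in> borel_measurable (F b)"
      using measurable_F_mono[OF X bd(1)] incr_measurable_F[OF assms(1) bd(1), of b] by simp
    have cross: "integrable M (\<lambda>\<omega>. X \<omega> * incr c b \<omega> * incr b d \<omega>)"
      "expectation (\<lambda>\<omega>. X \<omega> * incr c b \<omega> * incr b d \<omega>) = 0"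
      using incr_indep_1[OF _ bd(2) mF lin(1)] assms(1) bd incr_moments(2)[of b d] by auto
    have eq: "X \<omega> * (incr c b \<omega> * incr c d \<omega>)
        = X \<omega> * incr c b \<omega> ^ 2 + X \<omega> * incr c b \<omega> * incr b d \<omega>" for \<omega>
      by (simp add: incr_def power2_eq_square algebra_simps)
    show ?thesis
      unfolding eq using sq cross incr_moments(3)[OF assms(1) bd(1)] by simp
  qed
  show ?thesis
  proof (cases "b \<le> d")
    case True
    then show ?thesis using *[of b d] assms by simp
  next
    case False
    then show ?thesis using *[of d b] assms by (simp add: mult.commute[of "incr c d _"])
  qed
qed

definition overlap :: "real \<Rightarrow> real \<Rightarrow> real \<Rightarrow> real \<Rightarrow> real" where
  "overlap a b c d = max 0 (min b d - max a c)"

lemma overlap_nonneg: "0 \<le> overlap a b c d"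
  by (simp add: overlap_def)

lemma incr_mult_L2:
  assumes ab: "0 \<le> a" "a \<le> b" and e: "e \<in> borel_measurable (F a)" "integrable M (\<lambda>\<omega>. (e \<omega>)\<^sup>2)"
  shows "integrable M (\<lambda>\<omega>. (e \<omega> * incr a b \<omega>)\<^sup>2)"
  using incr_indep(1)[OF ab, of "\<lambda>\<omega>. (e \<omega>)\<^sup>2" 2] e by (simp add: power_mult_distrib)

text \<open>
  If \<open>a \<le> c\<close>, cut the first increment at \<open>c\<close>. Its part before \<open>c\<close> belongs to the past of the centred
  second increment, and both increments start at \<open>c\<close> in what remains. This works for any two intervals,
  whatever partitions they come from.
\<close>

lemma expectation_elementary_product:
  assumes ab: "0 \<le> a" "a \<le> b" and cd: "0 \<le> c" "c \<le> d"
    and e: "e \<in> borel_measurable (F a)" "integrable M (\<lambda>\<omega>. (e \<omega>)\<^sup>2)"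
    and f: "f \<in> borel_measurable (F c)" "integrable M (\<lambda>\<omega>. (f \<omega>)\<^sup>2)"
  shows "expectation (\<lambda>\<omega>. (e \<omega> * incr a b \<omega>) * (f \<omega> * incr c d \<omega>))
    = expectation (\<lambda>\<omega>. e \<omega> * f \<omega>) * overlap a b c d"
proof -
  have main: "expectation (\<lambda>\<omega>. (e \<omega> * incr a b \<omega>) * (f \<omega> * incr c d \<omega>))
    = expectation (\<lambda>\<omega>. e \<omega> * f \<omega>) * overlap a b c d"
    if ab: "0 \<le> a" "a \<le> b" and cd: "0 \<le> c" "c \<le> d" and ac: "a \<le> c"
    and e: "e \<in> borel_measurable (F a)" "integrable M (\<lambda>\<omega>. (e \<omega>)\<^sup>2)"
    and f: "f \<in> borel_measurable (F c)" "integrable M (\<lambda>\<omega>. (f \<omega>)\<^sup>2)"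
    for a b c d and e f :: "'a \<Rightarrow> real"
  proof -
    define m where "m = min b c"
    have m: "a \<le> m" "m \<le> c" "m \<le> b" using ab ac by (auto simp: m_def)
    note [measurable] = measurable_F_M[OF e(1)] measurable_F_M[OF f(1)]
      incr_measurable[OF ab(1) m(1)]
    have eF: "e \<in> borel_measurable (F c)" by (rule measurable_F_mono[OF e(1) ac])
    define X where "X \<omega> = (e \<omega> * incr a m \<omega>) * f \<omega>" for \<omega>
    have XF: "X \<in> borel_measurable (F c)"
      unfolding X_def using eF f(1) incr_measurable_F[OF ab(1) m(1,2)] by simp
    have iX: "integrable M X"
      unfolding X_def
      by (intro integrable_mult_of_squares incr_mult_L2[OF ab(1) m(1) e] f) auto
    note 1 = incr_indep_1[OF cd XF iX] incr_moments(2)[OF cd]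
    have ief: "integrable M (\<lambda>\<omega>. e \<omega> * f \<omega>)"
      by (intro integrable_mult_of_squares e f) auto
    show ?thesis
    proof (cases "b \<le> c")
      case True
      then have eq: "(e \<omega> * incr a b \<omega>) * (f \<omega> * incr c d \<omega>) = X \<omega> * incr c d \<omega>" for \<omega>
        by (simp add: X_def m_def)
      show ?thesis unfolding eq using True 1 ac cd by (simp add: overlap_def)
    next
      case False
      then have mc: "m = c" by (simp add: m_def)
      have eq: "(e \<omega> * incr a b \<omega>) * (f \<omega> * incr c d \<omega>)
          = X \<omega> * incr c d \<omega> + (e \<omega> * f \<omega>) * (incr c b \<omega> * incr c d \<omega>)" for \<omega>
        by (simp add: X_def mc incr_def algebra_simps)
      have "integrable M (\<lambda>\<omega>. e \<omega> * f \<omega> * (incr c b \<omega> * incr c d \<omega>))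
        \<and> expectation (\<lambda>\<omega>. e \<omega> * f \<omega> * (incr c b \<omega> * incr c d \<omega>))
            = expectation (\<lambda>\<omega>. e \<omega> * f \<omega>) * (min b d - c)"
        by (rule expectation_incr_product) (use cd False eF f ief in auto)
      then show ?thesis unfolding eq using 1 False ac cd by (simp add: overlap_def)
    qed
  qed
  show ?thesis
  proof (cases "a \<le> c")
    case True
    then show ?thesis using main[OF ab cd True e f] by simp
  next
    case False
    then show ?thesis using main[OF cd ab _ f e]
      by (simp add: mult.commute overlap_def min.commute max.commute)
  qed
qed

lemma overlap_has_integral:
  "has_bochner_integral lborel (\<lambda>t. indicator {a<..b} t * indicator {c<..d} t :: real) (overlap a b c d)"
proof -
  have "(\<lambda>t. indicator {a<..b} t * indicator {c<..d} t :: real) = indicator {max a c<..min b d}"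
    by (auto simp: indicator_def)
  moreover have "emeasure lborel {max a c<..min b d} = ennreal (overlap a b c d)"
    by (cases "max a c \<le> min b d") (auto simp: overlap_def max_absorb2 max_absorb1 ennreal_neg)
  ultimately show ?thesis
    using has_bochner_integral_real_indicator[of "{max a c<..min b d}" lborel]
    by (simp add: measure_def enn2real_ennreal[of "overlap a b c d"] overlap_nonneg)
qed

text \<open>
  Ito's isometry for a finite family of integrands \<open>e i\<close> on \<open>(a i, b i]\<close> whose intervals may overlap.
  It therefore applies to the difference of two simple processes with unrelated partitions.
\<close>

lemma elementary_isometry:
  fixes a b :: "'i \<Rightarrow> real" and e :: "'i \<Rightarrow> 'a \<Rightarrow> real"
  assumes fin: "finite I" and ab: "\<And>i. i \<in> I \<Longrightarrow> 0 \<le> a i" "\<And>i. i \<in> I \<Longrightarrow> a i \<le> b i"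
    and e: "\<And>i. i \<in> I \<Longrightarrow> e i \<in> borel_measurable (F (a i))" "\<And>i. i \<in> I \<Longrightarrow> integrable M (\<lambda>\<omega>. (e i \<omega>)\<^sup>2)"
  shows "(\<integral>\<^sup>+\<omega>. ennreal ((\<Sum>i\<in>I. e i \<omega> * incr (a i) (b i) \<omega>)\<^sup>2) \<partial>M)
       = (\<integral>\<^sup>+\<omega>. (\<integral>\<^sup>+t. ennreal ((\<Sum>i\<in>I. e i \<omega> * indicator {a i<..b i} t)\<^sup>2) \<partial>lborel) \<partial>M)"
proof -
  have eM[measurable]: "e i \<in> borel_measurable M" if "i \<in> I" for i
    using measurable_F_M[OF e(1)[OF that]] .
  have xM[measurable]: "incr (a i) (b i) \<in> borel_measurable M" if "i \<in> I" for i
    using incr_measurable[OF ab[OF that]] .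
  have iee: "integrable M (\<lambda>\<omega>. e i \<omega> * e j \<omega>)" if "i \<in> I" "j \<in> I" for i j
    using that by (intro integrable_mult_of_squares e) auto
  have ixx: "integrable M (\<lambda>\<omega>. (e i \<omega> * incr (a i) (b i) \<omega>) * (e j \<omega> * incr (a j) (b j) \<omega>))"
    if "i \<in> I" "j \<in> I" for i j
    using that by (intro integrable_mult_of_squares incr_mult_L2 e ab) auto
  let ?O = "\<lambda>i j. overlap (a i) (b i) (a j) (b j)"
  have sq: "(\<Sum>i\<in>I. e i \<omega> * incr (a i) (b i) \<omega>)\<^sup>2
      = (\<Sum>i\<in>I. \<Sum>j\<in>I. (e i \<omega> * incr (a i) (b i) \<omega>) * (e j \<omega> * incr (a j) (b j) \<omega>))" for \<omega>
    by (simp add: power2_eq_square sum_product)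
  have "(\<integral>\<^sup>+\<omega>. ennreal ((\<Sum>i\<in>I. e i \<omega> * incr (a i) (b i) \<omega>)\<^sup>2) \<partial>M)
      = ennreal (expectation (\<lambda>\<omega>. (\<Sum>i\<in>I. e i \<omega> * incr (a i) (b i) \<omega>)\<^sup>2))"
    unfolding sq
    by (intro nn_integral_eq_integral Bochner_Integration.integrable_sum ixx) (auto simp flip: sq)
  also have "expectation (\<lambda>\<omega>. (\<Sum>i\<in>I. e i \<omega> * incr (a i) (b i) \<omega>)\<^sup>2)
      = (\<Sum>i\<in>I. \<Sum>j\<in>I. expectation (\<lambda>\<omega>. e i \<omega> * e j \<omega>) * ?O i j)"
    unfolding sq using ixx ab e
    by (simp add: Bochner_Integration.integral_sum expectation_elementary_product)
  also have "\<dots> = expectation (\<lambda>\<omega>. \<Sum>i\<in>I. \<Sum>j\<in>I. e i \<omega> * e j \<omega> * ?O i j)"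
    using iee by (simp add: Bochner_Integration.integral_sum)
  also have "ennreal \<dots> = (\<integral>\<^sup>+\<omega>. (\<integral>\<^sup>+t. ennreal ((\<Sum>i\<in>I. e i \<omega> * indicator {a i<..b i} t)\<^sup>2) \<partial>lborel) \<partial>M)"
  proof -
    have inner: "has_bochner_integral lborel (\<lambda>t. (\<Sum>i\<in>I. e i \<omega> * indicator {a i<..b i} t)\<^sup>2)
        (\<Sum>i\<in>I. \<Sum>j\<in>I. e i \<omega> * e j \<omega> * ?O i j)" for \<omega>
    proof -
      have "(\<Sum>i\<in>I. e i \<omega> * indicator {a i<..b i} t)\<^sup>2
        = (\<Sum>i\<in>I. \<Sum>j\<in>I. (e i \<omega> * e j \<omega>) * (indicator {a i<..b i} t * indicator {a j<..b j} t))" for t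
        by (simp add: power2_eq_square sum_product mult_ac)
      then show ?thesis
        by (simp only:) (intro has_bochner_integral_sum has_bochner_integral_mult_right
            overlap_has_integral)
    qed
    have nn: "0 \<le> (\<Sum>i\<in>I. \<Sum>j\<in>I. e i \<omega> * e j \<omega> * ?O i j)" for \<omega>
      by (subst has_bochner_integral_integral_eq[OF inner, symmetric]) (simp add: integral_nonneg_AE)
    have "(\<integral>\<^sup>+t. ennreal ((\<Sum>i\<in>I. e i \<omega> * indicator {a i<..b i} t)\<^sup>2) \<partial>lborel)
        = ennreal (\<Sum>i\<in>I. \<Sum>j\<in>I. e i \<omega> * e j \<omega> * ?O i j)" for \<omega>
      using inner[of \<omega>] by (simp add: has_bochner_integral_iff nn_integral_eq_integral)
    then show ?thesis
      using iee nn
      by (simp add: nn_integral_eq_integral Bochner_Integration.integrable_sum)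
  qed
  finally show ?thesis .
qed

end

section \<open>Fourth moments of Ito integrals\<close>

context prob_space
begin

text \<open>
  Integrability of the fourth power, which makes all mixed moments of degree at most four finite.
\<close>

definition L4 :: "('a \<Rightarrow> real) \<Rightarrow> bool" where
  "L4 X \<longleftrightarrow> X \<in> borel_measurable M \<and> integrable M (\<lambda>\<omega>. X \<omega> ^ 4)"

lemma L4_measurable: "L4 X \<Longrightarrow> X \<in> borel_measurable M"
  and L4_integrable_4: "L4 X \<Longrightarrow> integrable M (\<lambda>\<omega>. X \<omega> ^ 4)"
  by (auto simp: L4_def)

lemma L4_integrable_2: "L4 X \<Longrightarrow> integrable M (\<lambda>\<omega>. X \<omega> ^ 2)"
  by (rule square_integrable_imp_integrable) (auto simp: L4_def power_mult[symmetric])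

lemma L4_integrable_mult: "L4 X \<Longrightarrow> L4 Y \<Longrightarrow> integrable M (\<lambda>\<omega>. X \<omega> * Y \<omega>)"
  by (intro integrable_mult_of_squares L4_integrable_2) (auto simp: L4_def)

lemma L4_integrable_1: "L4 X \<Longrightarrow> integrable M X"
  by (rule square_integrable_imp_integrable) (auto simp: L4_integrable_2 L4_measurable)

lemma L4_integrable_22: "L4 X \<Longrightarrow> L4 Y \<Longrightarrow> integrable M (\<lambda>\<omega>. X \<omega> ^ 2 * Y \<omega> ^ 2)"
  by (intro integrable_mult_of_squares) (auto simp: L4_def power_mult[symmetric])

lemma L4_integrable_31:
  assumes X: "L4 X" and Y: "L4 Y"
  shows "integrable M (\<lambda>\<omega>. X \<omega> ^ 3 * Y \<omega>)"
proof -
  note [measurable] = L4_measurable[OF X] L4_measurable[OF Y]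
  have "integrable M (\<lambda>\<omega>. X \<omega> ^ 2 * (X \<omega> * Y \<omega>))"
  proof (rule integrable_mult_of_squares)
    show "integrable M (\<lambda>\<omega>. (X \<omega> * Y \<omega>)\<^sup>2)"
      using L4_integrable_22[OF X Y] by (simp add: power_mult_distrib)
    show "integrable M (\<lambda>\<omega>. ((X \<omega>)\<^sup>2)\<^sup>2)"
      using X by (simp add: L4_def power_mult[symmetric])
  qed auto
  then show ?thesis by (simp add: power2_eq_square power3_eq_cube mult.assoc)
qed

end

text \<open>
  The factor between a bound on the fourth moments of an integrand on \<open>[0,T]\<close> and the fourth moment of
  its integral, see \<open>riemann_sum_moments\<close>.
\<close>

definition moment_const :: "real \<Rightarrow> real" where
  "moment_const T = (1 + T) * (exp (3 * T) - 1)"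

context brownian_basis
begin

definition wsum :: "(nat \<Rightarrow> real) \<Rightarrow> (nat \<Rightarrow> 'a \<Rightarrow> real) \<Rightarrow> nat \<Rightarrow> 'a \<Rightarrow> real" where
  "wsum s e n \<omega> = (\<Sum>j<n. e j \<omega> * incr (s j) (s (Suc j)) \<omega>)"

text \<open>
  Expand the powers of \<open>I + e \<Delta>\<close>, where \<open>I\<close> and \<open>e\<close> are known at the start of the last cell, of length \<open>\<delta>\<close>, and
  \<open>\<Delta>\<close> is the increment over it. The terms with odd powers of \<open>\<Delta>\<close> have expectation 0. With \<open>2 I\<^sup>2 e\<^sup>2 \<le> I\<^sup>4 + e\<^sup>4\<close>
  the fourth moments satisfy \<open>E I\<^sub>n\<^sub>+\<^sub>1\<^sup>4 \<le> (1 + 3 \<delta>) E I\<^sub>n\<^sup>4 + 3 \<delta> (1 + D) K\<close>, a discrete Gronwall inequality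
  whose solution is bounded by the exponential in the claim.
\<close>

lemma wsum_moments:
  assumes s0: "0 \<le> s 0" and mono: "\<And>j. j < n \<Longrightarrow> s j \<le> s (Suc j)"
    and e: "\<And>j. j < n \<Longrightarrow> e j \<in> borel_measurable (F (s j))" "\<And>j. j < n \<Longrightarrow> integrable M (\<lambda>\<omega>. e j \<omega> ^ 4)"
    and K: "\<And>j. j < n \<Longrightarrow> expectation (\<lambda>\<omega>. e j \<omega> ^ 4) \<le> K" "0 \<le> K"
    and D: "\<And>j. j < n \<Longrightarrow> s (Suc j) - s j \<le> D"
  shows "wsum s e n \<in> borel_measurable (F (s n)) \<and> L4 (wsum s e n) \<and>
    expectation (wsum s e n) = 0 \<and>
    expectation (\<lambda>\<omega>. (wsum s e n \<omega>)\<^sup>2) = (\<Sum>j<n. (s (Suc j) - s j) * expectation (\<lambda>\<omega>. (e j \<omega>)\<^sup>2)) \<and>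
    expectation (\<lambda>\<omega>. wsum s e n \<omega> ^ 4) \<le> K * (1 + D) * (exp (3 * (s n - s 0)) - 1) \<and> s 0 \<le> s n"
  using mono e K D
proof (induction n)
  case 0
  then show ?case by (simp add: wsum_def[abs_def] L4_def)
next
  case (Suc n)
  let ?I = "wsum s e n"
  let ?e = "e n"
  let ?\<Delta> = "incr (s n) (s (Suc n))"
  define \<delta> where "\<delta> = s (Suc n) - s n"
  have IH: "?I \<in> borel_measurable (F (s n))" "L4 ?I" "expectation ?I = 0"
    "expectation (\<lambda>\<omega>. (?I \<omega>)\<^sup>2) = (\<Sum>j<n. (s (Suc j) - s j) * expectation (\<lambda>\<omega>. (e j \<omega>)\<^sup>2))"
    "expectation (\<lambda>\<omega>. ?I \<omega> ^ 4) \<le> K * (1 + D) * (exp (3 * (s n - s 0)) - 1)" "s 0 \<le> s n"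
    using Suc by auto
  have sn: "0 \<le> s n" "s n \<le> s (Suc n)" using IH(6) s0 Suc.prems(1)[of n] by auto
  have \<delta>: "0 \<le> \<delta>" "\<delta> \<le> D" using sn Suc.prems(6)[of n] by (auto simp: \<delta>_def)
  have eF: "?e \<in> borel_measurable (F (s n))" and e4: "L4 ?e"
    using Suc.prems(2,3)[of n] by (auto simp: L4_def intro: measurable_F_M)
  have K: "0 \<le> K" "expectation (\<lambda>\<omega>. ?e \<omega> ^ 4) \<le> K" using Suc.prems(4,5) by auto
  note [measurable] = IH(1) eF incr_measurable_F[OF sn(1) sn(2) order_refl]
    L4_measurable[OF IH(2)] L4_measurable[OF e4] incr_measurable[OF sn]
  note m = incr_moments(2-5)[OF sn, folded \<delta>_def]
  have rec: "wsum s e (Suc n) \<omega> = ?I \<omega> + ?e \<omega> * ?\<Delta> \<omega>" for \<omega> by (simp add: wsum_def)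
  note i0 = incr_indep_1[OF sn eF L4_integrable_1[OF e4], unfolded m, simplified]
  note i1 = incr_indep_1[OF sn _ L4_integrable_mult[OF IH(2) e4], unfolded m, simplified]
  note i2 = incr_indep[OF sn _ L4_integrable_2[OF e4], where n = 2, unfolded m, simplified]
  note j1 = incr_indep_1[OF sn _ L4_integrable_31[OF IH(2) e4], unfolded m, simplified]
  note j2 = incr_indep[OF sn _ L4_integrable_22[OF IH(2) e4], where n = 2, unfolded m, simplified]
  note j3 = incr_indep[OF sn _ L4_integrable_31[OF e4 IH(2)], where n = 3, unfolded m, simplified]
  note j4 = incr_indep[OF sn _ L4_integrable_4[OF e4], where n = 4, unfolded m, simplified]
  have sq: "(wsum s e (Suc n) \<omega>)\<^sup>2 = (?I \<omega>)\<^sup>2 + 2 * (?I \<omega> * ?e \<omega> * ?\<Delta> \<omega>) + (?e \<omega>)\<^sup>2 * (?\<Delta> \<omega>)\<^sup>2" for \<omega>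
    unfolding rec by (simp add: power2_eq_square algebra_simps)
  have qu: "wsum s e (Suc n) \<omega> ^ 4 = ?I \<omega> ^ 4 + 4 * (?I \<omega> ^ 3 * ?e \<omega> * ?\<Delta> \<omega>)
      + 6 * ((?I \<omega>)\<^sup>2 * (?e \<omega>)\<^sup>2 * (?\<Delta> \<omega>)\<^sup>2) + 4 * (?e \<omega> ^ 3 * ?I \<omega> * ?\<Delta> \<omega> ^ 3) + ?e \<omega> ^ 4 * ?\<Delta> \<omega> ^ 4" for \<omega>
    unfolding rec by (simp add: power4_eq_xxxx power3_eq_cube power2_eq_square algebra_simps)
  have "wsum s e (Suc n) \<in> borel_measurable (F (s (Suc n)))"
    unfolding rec[abs_def]
    using measurable_F_mono[OF IH(1) sn(2)] measurable_F_mono[OF eF sn(2)] by simp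
  moreover have "integrable M (\<lambda>\<omega>. wsum s e (Suc n) \<omega> ^ 4)"
    unfolding qu using L4_integrable_4[OF IH(2)] j1 j2 j3 j4 by simp
  moreover have "expectation (wsum s e (Suc n)) = 0"
    unfolding rec[abs_def] using L4_integrable_1[OF IH(2)] i0 IH(3) by simp
  moreover have "expectation (\<lambda>\<omega>. (wsum s e (Suc n) \<omega>)\<^sup>2)
      = (\<Sum>j<Suc n. (s (Suc j) - s j) * expectation (\<lambda>\<omega>. (e j \<omega>)\<^sup>2))"
    unfolding sq using L4_integrable_2[OF IH(2)] i1 i2 IH(4) by (simp add: \<delta>_def)
  moreover have "expectation (\<lambda>\<omega>. wsum s e (Suc n) \<omega> ^ 4)
      \<le> K * (1 + D) * (exp (3 * (s (Suc n) - s 0)) - 1)"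
  proof -
    let ?a = "expectation (\<lambda>\<omega>. ?I \<omega> ^ 4)"
    let ?E = "exp (3 * (s n - s 0))"
    have "expectation (\<lambda>\<omega>. wsum s e (Suc n) \<omega> ^ 4)
        = ?a + 6 * (expectation (\<lambda>\<omega>. (?I \<omega>)\<^sup>2 * (?e \<omega>)\<^sup>2) * \<delta>) + expectation (\<lambda>\<omega>. ?e \<omega> ^ 4) * (3 * \<delta>\<^sup>2)"
      unfolding qu using L4_integrable_4[OF IH(2)] j1 j2 j3 j4 by simp
    also have "expectation (\<lambda>\<omega>. (?I \<omega>)\<^sup>2 * (?e \<omega>)\<^sup>2) \<le> expectation (\<lambda>\<omega>. (?I \<omega> ^ 4 + ?e \<omega> ^ 4) / 2)"
    proof (rule integral_mono)
      show "(?I \<omega>)\<^sup>2 * (?e \<omega>)\<^sup>2 \<le> (?I \<omega> ^ 4 + ?e \<omega> ^ 4) / 2" for \<omega>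
        using sum_squares_bound[of "(?I \<omega>)\<^sup>2" "(?e \<omega>)\<^sup>2"] by (simp add: power_mult[symmetric])
    qed (use L4_integrable_22[OF IH(2) e4] L4_integrable_4[OF IH(2)] L4_integrable_4[OF e4] in auto)
    also have "\<dots> = (?a + expectation (\<lambda>\<omega>. ?e \<omega> ^ 4)) / 2"
      using L4_integrable_4[OF IH(2)] L4_integrable_4[OF e4] by simp
    also have "?a + 6 * ((?a + expectation (\<lambda>\<omega>. ?e \<omega> ^ 4)) / 2 * \<delta>)
        + expectation (\<lambda>\<omega>. ?e \<omega> ^ 4) * (3 * \<delta>\<^sup>2)
        = (1 + 3 * \<delta>) * ?a + 3 * \<delta> * ((1 + \<delta>) * expectation (\<lambda>\<omega>. ?e \<omega> ^ 4))"
      by (simp add: algebra_simps power2_eq_square)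
    also have "\<dots> \<le> (1 + 3 * \<delta>) * (K * (1 + D) * (?E - 1)) + 3 * \<delta> * ((1 + D) * K)"
      using \<delta> K IH(5) by (intro add_mono mult_left_mono mult_mono) (auto simp: integral_nonneg_AE)
    also have "\<dots> = K * (1 + D) * ((1 + 3 * \<delta>) * ?E - 1)"
      by (simp add: algebra_simps)
    also have "\<dots> \<le> K * (1 + D) * (exp (3 * \<delta>) * ?E - 1)"
      using \<delta> K exp_ge_add_one_self[of "3 * \<delta>"]
      by (intro mult_left_mono diff_right_mono mult_right_mono) auto
    also have "exp (3 * \<delta>) * ?E = exp (3 * (s (Suc n) - s 0))"
      by (simp add: exp_add[symmetric] \<delta>_def algebra_simps)
    finally show ?thesis using \<delta> by (simp add: mult_left_mono mult_right_mono)
  qed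
  ultimately show ?case
    using sn IH(6) by (auto simp: L4_def intro: measurable_F_M)
qed

definition riemann_sum :: "real \<Rightarrow> (real \<Rightarrow> 'a \<Rightarrow> real) \<Rightarrow> nat \<Rightarrow> 'a \<Rightarrow> real" where
  "riemann_sum T H n = wsum (grid T n) (\<lambda>j. H (grid T n j)) (Suc n)"

lemma riemann_sum_moments:
  assumes T: "0 \<le> T" and H: "\<And>t. t \<in> {0..T} \<Longrightarrow> H t \<in> borel_measurable (F t)"
    "\<And>t. t \<in> {0..T} \<Longrightarrow> integrable M (\<lambda>\<omega>. H t \<omega> ^ 4)"
    and K: "\<And>t. t \<in> {0..T} \<Longrightarrow> expectation (\<lambda>\<omega>. H t \<omega> ^ 4) \<le> K"
  shows "L4 (riemann_sum T H n)" and "expectation (riemann_sum T H n) = 0"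
    and "expectation (\<lambda>\<omega>. (riemann_sum T H n \<omega>)\<^sup>2)
      = (\<Sum>j<Suc n. T / real (Suc n) * expectation (\<lambda>\<omega>. (H (grid T n j) \<omega>)\<^sup>2))"
    and "expectation (\<lambda>\<omega>. riemann_sum T H n \<omega> ^ 4) \<le> K * moment_const T"
proof -
  have mem: "grid T n j \<in> {0..T}" if "j < Suc n" for j
    using grid_mem[OF T, of j n] that by simp
  have K0: "0 \<le> K" by (rule order_trans[OF _ K[of 0]]) (use T in \<open>auto simp: integral_nonneg_AE\<close>)
  have step: "grid T n (Suc j) - grid T n j \<le> T" for j
    using T divide_left_mono[of 1 "real (Suc n)" T] by (simp only: grid_step) simp
  have "riemann_sum T H n \<in> borel_measurable (F (grid T n (Suc n))) \<and> L4 (riemann_sum T H n) \<and>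
    expectation (riemann_sum T H n) = 0 \<and>
    expectation (\<lambda>\<omega>. (riemann_sum T H n \<omega>)\<^sup>2)
        = (\<Sum>j<Suc n. (grid T n (Suc j) - grid T n j) * expectation (\<lambda>\<omega>. (H (grid T n j) \<omega>)\<^sup>2)) \<and>
    expectation (\<lambda>\<omega>. riemann_sum T H n \<omega> ^ 4)
        \<le> K * (1 + T) * (exp (3 * (grid T n (Suc n) - grid T n 0)) - 1) \<and> grid T n 0 \<le> grid T n (Suc n)"
    unfolding riemann_sum_def
    by (rule wsum_moments) (use T mem H K K0 step in \<open>auto intro!: grid_mono simp del: sum.lessThan_Suc\<close>)
  then show "L4 (riemann_sum T H n)" and "expectation (riemann_sum T H n) = 0"
    and "expectation (\<lambda>\<omega>. (riemann_sum T H n \<omega>)\<^sup>2)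
      = (\<Sum>j<Suc n. T / real (Suc n) * expectation (\<lambda>\<omega>. (H (grid T n j) \<omega>)\<^sup>2))"
    and "expectation (\<lambda>\<omega>. riemann_sum T H n \<omega> ^ 4) \<le> K * moment_const T"
    by (simp_all only: grid_step grid_last grid_0 moment_const_def diff_zero mult.assoc)
qed

lemma ennreal_square_triangle:
  "ennreal ((x + y)\<^sup>2) \<le> 2 * ennreal (x\<^sup>2) + 2 * ennreal (y\<^sup>2)"
proof -
  have "ennreal ((x + y)\<^sup>2) \<le> ennreal (2 * x\<^sup>2 + 2 * y\<^sup>2)"
    by (rule ennreal_leI) (rule square_add_le)
  also have "\<dots> = 2 * ennreal (x\<^sup>2) + 2 * ennreal (y\<^sup>2)"
    by (simp add: ennreal_plus ennreal_mult)
  finally show ?thesis .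
qed

definition step_process :: "real \<Rightarrow> (real \<Rightarrow> 'a \<Rightarrow> real) \<Rightarrow> nat \<Rightarrow> real \<Rightarrow> 'a \<Rightarrow> real" where
  "step_process T H n t \<omega> = (\<Sum>j<Suc n. H (grid T n j) \<omega> * indicator {grid T n j<..grid T n (Suc j)} t)"

text \<open>
  On \<open>(0,T]\<close> exactly one summand of the step process survives.
\<close>

lemma step_process_eq:
  assumes T: "0 < T" and t: "t \<in> {0<..T}"
  obtains j where "j < Suc n" "grid T n j < t" "t \<le> grid T n (Suc j)" "step_process T H n t
      = H (grid T n j)"
proof -
  define j where "j = (LEAST j. t \<le> grid T n (Suc j))"
  have ex: "t \<le> grid T n (Suc n)" using t by simp
  have j1: "t \<le> grid T n (Suc j)" unfolding j_def by (rule LeastI[of "\<lambda>j. t \<le> grid T n (Suc j)", OF ex])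
  have jn: "j \<le> n" unfolding j_def by (rule Least_le[of "\<lambda>j. t \<le> grid T n (Suc j)", OF ex])
  have j2: "grid T n j < t"
  proof (cases j)
    case 0
    then show ?thesis using t by simp
  next
    case (Suc i)
    then have "\<not> t \<le> grid T n (Suc i)"
      using not_less_Least[of i "\<lambda>j. t \<le> grid T n (Suc j)"] by (simp add: j_def)
    then show ?thesis using Suc by simp
  qed
  have "step_process T H n t \<omega> = (\<Sum>i<Suc n. if i = j then H (grid T n j) \<omega> else 0)" for \<omega>
    unfolding step_process_def
  proof (rule sum.cong[OF refl])
    fix i assume "i \<in> {..<Suc n}"
    have "t \<notin> {grid T n i<..grid T n (Suc i)}" if "i \<noteq> j"
    proof (cases "i < j")
      case True
      then have "grid T n (Suc i) \<le> grid T n j" using T by (intro grid_mono) auto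
      then show ?thesis using j2 by simp
    next
      case False
      then have "grid T n (Suc j) \<le> grid T n i" using T that by (intro grid_mono) auto
      then show ?thesis using j1 by simp
    qed
    then show "H (grid T n i) \<omega> * indicator {grid T n i<..grid T n (Suc i)} t = (if i
        = j then H (grid T n j) \<omega> else 0)"
      using j1 j2 by auto
  qed
  then have "step_process T H n t = H (grid T n j)" using jn by (auto simp: fun_eq_iff)
  then show thesis using that[of j] j1 j2 jn by auto
qed

text \<open>
  The integral \<open>L\<close> is known only as the limit of the integrals of some unspecified simple processes. The
  isometry compares these with the step process of \<open>H\<close>; both approximate \<open>H\<close>, the second one with
  the error \<open>C T / (n + 1)\<close> in mean square at each time. The factor 4 comes from two uses of
  \<open>(x + y)\<^sup>2 \<le> 2 x\<^sup>2 + 2 y\<^sup>2\<close>.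
\<close>

lemma ito_integral_riemann_error:
  assumes T: "0 < T" and ito: "has_ito_integral M F w T H L"
    and H4: "\<And>t. t \<in> {0..T} \<Longrightarrow> integrable M (\<lambda>\<omega>. H t \<omega> ^ 4)"
    and mod: "\<And>s t. 0 \<le> s \<Longrightarrow> s \<le> t \<Longrightarrow> t \<le> T \<Longrightarrow> expectation (\<lambda>\<omega>. (H t \<omega> - H s \<omega>)\<^sup>2) \<le> C * (t - s)"
    and C: "0 \<le> C"
  shows "(\<integral>\<^sup>+\<omega>. ennreal ((L \<omega> - riemann_sum T H n \<omega>)\<^sup>2) \<partial>M) \<le> ennreal (4 * C * T * T / real (Suc n))"
proof -
  let ?R = "restrict_space lborel {0..T}"
  let ?V = "step_process T H n"
  obtain N s e where simple: "\<And>m. simple_adapted M F T (N m) (s m) (e m)"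
    and lim1: "(\<lambda>m. \<integral>\<^sup>+\<omega>. (\<integral>\<^sup>+t\<in>{0..T}. ennreal ((H t \<omega> - simple_process (N m) (s m) (e m) t \<omega>)\<^sup>2)
        \<partial>lborel) \<partial>M) \<longlonglongrightarrow> 0"
    and lim2: "(\<lambda>m. \<integral>\<^sup>+\<omega>. ennreal ((L \<omega> - simple_integral w (N m) (s m) (e m) \<omega>)\<^sup>2) \<partial>M) \<longlonglongrightarrow> 0"
    and [measurable]: "L \<in> borel_measurable M"
    and H: "\<And>t. t \<in> {0..T} \<Longrightarrow> H t \<in> borel_measurable (F t)"
    and joint[measurable]: "(\<lambda>(t, \<omega>). H t \<omega>) \<in> borel_measurable (?R \<Otimes>\<^sub>M M)"
    using ito unfolding has_ito_integral_def adapted_on_def jointly_measurable_def by blast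
  have HM[measurable]: "H t \<in> borel_measurable M" if "t \<in> {0..T}" for t
    using measurable_F_M[OF H[OF that]] .
  have HL4: "L4 (H t)" if "t \<in> {0..T}" for t using H4[OF that] HM[OF that] by (simp add: L4_def)
  have gm: "grid T n j \<in> {0..T}" if "j < Suc n" for j using grid_mem[of T j n] T that by simp
  have restr: "(\<integral>\<^sup>+t\<in>{0..T}. f t \<partial>lborel) = (\<integral>\<^sup>+t. f t \<partial>?R)" for f :: "real \<Rightarrow> ennreal"
    by (rule nn_integral_restrict_space[symmetric]) simp
  have V_joint[measurable]: "(\<lambda>(t, \<omega>). ?V t \<omega>) \<in> borel_measurable (?R \<Otimes>\<^sub>M M)"
  proof -
    have "(\<lambda>(t, \<omega>). H (grid T n j) \<omega> * indicator {grid T n j<..grid T n (Suc j)} t)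
        \<in> borel_measurable (?R \<Otimes>\<^sub>M M)"
      if "j < Suc n" for j
    proof -
      note [measurable] = HM[OF gm[OF that]]
      have [measurable]: "(\<lambda>t. indicator {grid T n j<..grid T n (Suc j)} t :: real) \<in> borel_measurable ?R"
        by (rule measurable_restrict_space1) simp
      show ?thesis by measurable
    qed
    then show ?thesis unfolding step_process_def case_prod_unfold
      by (intro borel_measurable_sum) simp
  qed
  interpret R: finite_measure ?R
    by (rule finite_measureI) (use T in \<open>simp add: emeasure_restrict_space space_restrict_space\<close>)
  interpret pair_sigma_finite ?R M ..
  have discr: "(\<integral>\<^sup>+\<omega>. (\<integral>\<^sup>+t. ennreal ((H t \<omega> - ?V t \<omega>)\<^sup>2) \<partial>?R) \<partial>M) \<le> ennreal (C * T * T / real (Suc n))"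
  proof -
    have "(\<integral>\<^sup>+\<omega>. (\<integral>\<^sup>+t. ennreal ((H t \<omega> - ?V t \<omega>)\<^sup>2) \<partial>?R) \<partial>M)
        = (\<integral>\<^sup>+t. (\<integral>\<^sup>+\<omega>. ennreal ((H t \<omega> - ?V t \<omega>)\<^sup>2) \<partial>M) \<partial>?R)"
      by (rule Fubini') measurable
    also have "\<dots> \<le> (\<integral>\<^sup>+t. ennreal (C * (T / real (Suc n))) \<partial>?R)"
    proof (rule nn_integral_mono_AE)
      \<comment> \<open>At time 0 the step process is 0 instead of \<open>H 0\<close>.\<close>
      have "AE t in lborel. t \<noteq> (0::real)" by (rule AE_lborel_singleton)
      then have "AE t in ?R. t \<noteq> 0" by (subst AE_restrict_space_iff) (auto elim: eventually_mono)
      then show "AE t in ?R. (\<integral>\<^sup>+\<omega>. ennreal ((H t \<omega> - ?V t \<omega>)\<^sup>2) \<partial>M) \<le> ennreal (C * (T / real (Suc n)))"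
        using AE_space
      proof eventually_elim
        case (elim t)
        then have t: "t \<in> {0<..T}" "t \<in> {0..T}" by (auto simp: space_restrict_space)
        obtain j where j: "j < Suc n" "grid T n j < t" "t \<le> grid T n (Suc j)" "?V t = H (grid T n j)"
          by (rule step_process_eq[OF T t(1), of n H])
        note g = gm[OF j(1)]
        have iD: "integrable M (\<lambda>\<omega>. (H t \<omega> - H (grid T n j) \<omega>)\<^sup>2)"
        proof -
          have "(H t \<omega> - H (grid T n j) \<omega>)\<^sup>2
              = (H t \<omega>)\<^sup>2 - 2 * (H t \<omega> * H (grid T n j) \<omega>) + (H (grid T n j) \<omega>)\<^sup>2" for \<omega>
            by (simp add: power2_diff)
          then show ?thesis using HL4[OF t(2)] HL4[OF g] L4_integrable_2 L4_integrable_mult by simp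
        qed
        have "(\<integral>\<^sup>+\<omega>. ennreal ((H t \<omega> - ?V t \<omega>)\<^sup>2) \<partial>M)
            = ennreal (expectation (\<lambda>\<omega>. (H t \<omega> - H (grid T n j) \<omega>)\<^sup>2))"
          unfolding j(4) by (rule nn_integral_eq_integral[OF iD]) simp
        also have "\<dots> \<le> ennreal (C * (t - grid T n j))"
          using mod[of "grid T n j" t] g j t by (intro ennreal_leI) auto
        also have "\<dots> \<le> ennreal (C * (T / real (Suc n)))"
          using grid_step[of T n j] j C by (intro ennreal_leI mult_left_mono) linarith+
        finally show ?case .
      qed
    qed
    also have "\<dots> = ennreal (C * (T / real (Suc n))) * ennreal T"
      using T by (simp add: emeasure_restrict_space space_restrict_space)
    also have "\<dots> = ennreal (C * T * T / real (Suc n))"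
      using T C by (simp add: ennreal_mult[symmetric] algebra_simps)
    finally show ?thesis .
  qed
  have bound: "(\<integral>\<^sup>+\<omega>. ennreal ((L \<omega> - riemann_sum T H n \<omega>)\<^sup>2) \<partial>M)
     \<le> 2 * (\<integral>\<^sup>+\<omega>. ennreal ((L \<omega> - simple_integral w (N m) (s m) (e m) \<omega>)\<^sup>2) \<partial>M)
       + 4 * (\<integral>\<^sup>+\<omega>. (\<integral>\<^sup>+t\<in>{0..T}. ennreal ((H t \<omega> - simple_process (N m) (s m) (e m) t \<omega>)\<^sup>2) \<partial>lborel) \<partial>M)
       + ennreal (4 * C * T * T / real (Suc n))" for m
  proof -
    let ?S = "simple_process (N m) (s m) (e m)" and ?I = "simple_integral w (N m) (s m) (e m)"
    note sa = simple[of m, unfolded simple_adapted_def]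
    have smono: "s m i \<le> s m j" if "i \<le> j" "j \<le> N m" for i j
      using that by (induction j rule: dec_induct) (use sa in \<open>auto intro: order_trans\<close>)
    have s0: "0 \<le> s m j" "s m j \<le> T" if "j \<le> N m" for j
      using smono[of 0 j] smono[of j "N m"] sa that by auto
    have eM[measurable]: "e m j \<in> borel_measurable M" if "j < N m" for j
      using sa that measurable_F_M by blast
    have e2: "integrable M (\<lambda>\<omega>. (e m j \<omega>)\<^sup>2)" if jN: "j < N m" for j
    proof -
      obtain c where c: "\<forall>\<omega>\<in>space M. \<bar>e m j \<omega>\<bar> \<le> c"
        using sa[THEN conjunct2, THEN conjunct2, THEN conjunct2, rule_format, OF jN] by auto
      show ?thesis
        by (rule integrable_const_bound[where B = "c\<^sup>2"])
           (use c eM[OF jN] in \<open>auto intro!: AE_I2 abs_le_square_iff[THEN iffD1] order_trans[OF _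
               abs_ge_self]\<close>)
    qed
    \<comment> \<open>One family consisting of the cells of the simple process and, with a minus sign, the cells of the step process.\<close>
    let ?J = "{..<N m} <+> {..<Suc n}"
    let ?a = "case_sum (s m) (grid T n)"
    let ?b = "case_sum (\<lambda>j. s m (Suc j)) (\<lambda>j. grid T n (Suc j))"
    let ?e = "case_sum (e m) (\<lambda>j \<omega>. - H (grid T n j) \<omega>)"
    have "(\<integral>\<^sup>+\<omega>. ennreal ((\<Sum>i\<in>?J. ?e i \<omega> * incr (?a i) (?b i) \<omega>)\<^sup>2) \<partial>M)
       = (\<integral>\<^sup>+\<omega>. (\<integral>\<^sup>+t. ennreal ((\<Sum>i\<in>?J. ?e i \<omega> * indicator {?a i<..?b i} t)\<^sup>2) \<partial>lborel) \<partial>M)"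
    proof (rule elementary_isometry)
      fix i assume "i \<in> ?J"
      then show "0 \<le> ?a i" "?a i \<le> ?b i" "?e i \<in> borel_measurable (F (?a i))"
          "integrable M (\<lambda>\<omega>. (?e i \<omega>)\<^sup>2)"
        using sa s0 e2 gm H T HL4 L4_integrable_2
        by (auto simp: Plus_def intro!: grid_mono split: sum.splits)
    qed simp
    moreover have "(\<Sum>i\<in>?J. ?e i \<omega> * incr (?a i) (?b i) \<omega>) = ?I \<omega> - riemann_sum T H n \<omega>" for \<omega>
      by (simp add: sum.Plus simple_integral_def riemann_sum_def wsum_def incr_def sum_negf del:
          sum.lessThan_Suc)
    moreover have "(\<Sum>i\<in>?J. ?e i \<omega> * indicator {?a i<..?b i} t) = ?S t \<omega> - ?V t \<omega>" for \<omega> t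
      unfolding simple_process_def step_process_def
      by (subst sum.Plus) (simp_all only: comp_def sum.case finite_lessThan mult_minus_left sum_negf
          add_uminus_conv_diff)
    ultimately have iso: "(\<integral>\<^sup>+\<omega>. ennreal ((?I \<omega> - riemann_sum T H n \<omega>)\<^sup>2) \<partial>M)
       = (\<integral>\<^sup>+\<omega>. (\<integral>\<^sup>+t. ennreal ((?S t \<omega> - ?V t \<omega>)\<^sup>2) \<partial>lborel) \<partial>M)"
      by (simp only:)
    have zero: "?S t \<omega> - ?V t \<omega> = 0" if "t \<notin> {0..T}" for t \<omega>
    proof -
      have "t \<notin> {s m j<..s m (Suc j)}" if "j < N m" for j
        using s0[of j] s0[of "Suc j"] that \<open>t \<notin> {0..T}\<close> by auto
      moreover have "t \<notin> {grid T n j<..grid T n (Suc j)}" if "j < Suc n" for j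
        using grid_mem[of T j n] grid_mem[of T "Suc j" n] T that \<open>t \<notin> {0..T}\<close> by auto
      ultimately show ?thesis by (simp add: simple_process_def step_process_def del: sum.lessThan_Suc)
    qed
    have S_joint[measurable]: "(\<lambda>(t, \<omega>). ?S t \<omega>) \<in> borel_measurable (?R \<Otimes>\<^sub>M M)"
    proof -
      have "(\<lambda>(t, \<omega>). e m j \<omega> * indicator {s m j<..s m (Suc j)} t) \<in> borel_measurable (?R \<Otimes>\<^sub>M M)"
        if "j < N m" for j
      proof -
        note [measurable] = eM[OF that]
        have [measurable]: "(\<lambda>t. indicator {s m j<..s m (Suc j)} t :: real) \<in> borel_measurable ?R"
          by (rule measurable_restrict_space1) simp
        show ?thesis by measurable
      qed
      then show ?thesis unfolding simple_process_def case_prod_unfold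
        by (intro borel_measurable_sum) simp
    qed
    have [measurable]: "?I \<in> borel_measurable M"
    proof -
      have "(\<lambda>\<omega>. e m j \<omega> * (w (s m (Suc j)) \<omega> - w (s m j) \<omega>)) \<in> borel_measurable M" if "j < N m" for j
        using eM[OF that] w_measurable[OF s0(1)[of j]] w_measurable[OF s0(1)[of "Suc j"]] that by simp
      then show ?thesis unfolding simple_integral_def[abs_def] by (intro borel_measurable_sum) simp
    qed
    have [measurable]: "riemann_sum T H n \<in> borel_measurable M"
    proof -
      have "(\<lambda>\<omega>. H (grid T n j) \<omega> * incr (grid T n j) (grid T n (Suc j)) \<omega>) \<in> borel_measurable M"
          if "j < Suc n" for j
        using HM[OF gm[OF that]] incr_measurable[of "grid T n j"
            "grid T n (Suc j)"] gm[OF that] T grid_mono[of T j "Suc j" n]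
        by simp
      then show ?thesis unfolding riemann_sum_def wsum_def[abs_def] by (intro borel_measurable_sum) simp
    qed
    have "(\<integral>\<^sup>+\<omega>. ennreal ((?I \<omega> - riemann_sum T H n \<omega>)\<^sup>2) \<partial>M)
        = (\<integral>\<^sup>+\<omega>. (\<integral>\<^sup>+t. ennreal ((?S t \<omega> - ?V t \<omega>)\<^sup>2) \<partial>?R) \<partial>M)"
      unfolding iso restr[symmetric]
      by (intro nn_integral_cong) (use zero in \<open>auto simp: indicator_def\<close>)
    also have "\<dots> \<le> (\<integral>\<^sup>+\<omega>. (\<integral>\<^sup>+t. 2 * ennreal ((H t \<omega> - ?S t \<omega>)\<^sup>2) + 2 * ennreal ((H t \<omega> - ?V t \<omega>)\<^sup>2) \<partial>?R) \<partial>M)"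
    proof (intro nn_integral_mono)
      fix \<omega> t
      show "ennreal ((?S t \<omega> - ?V t \<omega>)\<^sup>2)
          \<le> 2 * ennreal ((H t \<omega> - ?S t \<omega>)\<^sup>2) + 2 * ennreal ((H t \<omega> - ?V t \<omega>)\<^sup>2)"
        using ennreal_square_triangle[of "?S t \<omega> - H t \<omega>" "H t \<omega> - ?V t \<omega>"] by (simp add: power2_commute)
    qed
    also have "\<dots> = (\<integral>\<^sup>+\<omega>. 2 * (\<integral>\<^sup>+t. ennreal ((H t \<omega> - ?S t \<omega>)\<^sup>2) \<partial>?R)
        + 2 * (\<integral>\<^sup>+t. ennreal ((H t \<omega> - ?V t \<omega>)\<^sup>2) \<partial>?R) \<partial>M)"
      by (intro nn_integral_cong) (simp add: nn_integral_add nn_integral_cmult)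
    also have "\<dots> = 2 * (\<integral>\<^sup>+\<omega>. (\<integral>\<^sup>+t. ennreal ((H t \<omega> - ?S t \<omega>)\<^sup>2) \<partial>?R) \<partial>M)
        + 2 * (\<integral>\<^sup>+\<omega>. (\<integral>\<^sup>+t. ennreal ((H t \<omega> - ?V t \<omega>)\<^sup>2) \<partial>?R) \<partial>M)"
      by (subst nn_integral_add; (subst nn_integral_cmult)?; measurable?) (simp add: nn_integral_cmult)
    also have "\<dots> \<le> 2 * (\<integral>\<^sup>+\<omega>. (\<integral>\<^sup>+t. ennreal ((H t \<omega> - ?S t \<omega>)\<^sup>2) \<partial>?R) \<partial>M)
        + 2 * ennreal (C * T * T / real (Suc n))"
      by (intro add_mono mult_left_mono discr) auto
    finally have 1: "(\<integral>\<^sup>+\<omega>. ennreal ((?I \<omega> - riemann_sum T H n \<omega>)\<^sup>2) \<partial>M) \<le> \<dots>" .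
    have "(\<integral>\<^sup>+\<omega>. ennreal ((L \<omega> - riemann_sum T H n \<omega>)\<^sup>2) \<partial>M)
        \<le> (\<integral>\<^sup>+\<omega>. 2 * ennreal ((L \<omega> - ?I \<omega>)\<^sup>2) + 2 * ennreal ((?I \<omega> - riemann_sum T H n \<omega>)\<^sup>2) \<partial>M)"
    proof (intro nn_integral_mono)
      fix \<omega>
      show "ennreal ((L \<omega> - riemann_sum T H n \<omega>)\<^sup>2)
          \<le> 2 * ennreal ((L \<omega> - ?I \<omega>)\<^sup>2) + 2 * ennreal ((?I \<omega> - riemann_sum T H n \<omega>)\<^sup>2)"
        using ennreal_square_triangle[of "L \<omega> - ?I \<omega>" "?I \<omega> - riemann_sum T H n \<omega>"] by simp
    qed
    also have "\<dots> = 2 * (\<integral>\<^sup>+\<omega>. ennreal ((L \<omega> - ?I \<omega>)\<^sup>2) \<partial>M)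
        + 2 * (\<integral>\<^sup>+\<omega>. ennreal ((?I \<omega> - riemann_sum T H n \<omega>)\<^sup>2) \<partial>M)"
      by (simp add: nn_integral_add nn_integral_cmult)
    also have "\<dots> \<le> 2 * (\<integral>\<^sup>+\<omega>. ennreal ((L \<omega> - ?I \<omega>)\<^sup>2) \<partial>M)
        + 2 * (2 * (\<integral>\<^sup>+\<omega>. (\<integral>\<^sup>+t. ennreal ((H t \<omega> - ?S t \<omega>)\<^sup>2) \<partial>?R) \<partial>M)
        + 2 * ennreal (C * T * T / real (Suc n)))"
      by (intro add_mono mult_left_mono 1) auto
    also have "\<dots> = 2 * (\<integral>\<^sup>+\<omega>. ennreal ((L \<omega> - ?I \<omega>)\<^sup>2) \<partial>M)
        + 4 * (\<integral>\<^sup>+\<omega>. (\<integral>\<^sup>+t. ennreal ((H t \<omega> - ?S t \<omega>)\<^sup>2) \<partial>?R) \<partial>M)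
        + ennreal (4 * C * T * T / real (Suc n))"
    proof -
      have "2 * (2 * x + 2 * y) = 4 * x + 4 * y" for x y :: ennreal
        by (simp add: distrib_left mult.assoc[symmetric])
      moreover have "4 * ennreal (C * T * T / real (Suc n)) = ennreal (4 * C * T * T / real (Suc n))"
        using T C by (subst ennreal_numeral[symmetric], subst ennreal_mult[symmetric]) (auto simp:
            mult.assoc)
      ultimately show ?thesis by (simp add: add.assoc)
    qed
    finally show ?thesis unfolding restr .
  qed
  have "(\<lambda>m. 2 * (\<integral>\<^sup>+\<omega>. ennreal ((L \<omega> - simple_integral w (N m) (s m) (e m) \<omega>)\<^sup>2) \<partial>M)
       + 4 * (\<integral>\<^sup>+\<omega>. (\<integral>\<^sup>+t\<in>{0..T}. ennreal ((H t \<omega> - simple_process (N m) (s m) (e m) t \<omega>)\<^sup>2) \<partial>lborel) \<partial>M)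
       + ennreal (4 * C * T * T / real (Suc n)))
     \<longlonglongrightarrow> 2 * 0 + 4 * 0 + ennreal (4 * C * T * T / real (Suc n))"
    by (intro tendsto_add ennreal_tendsto_cmult lim1 lim2 tendsto_const) auto
  then have "(\<integral>\<^sup>+\<omega>. ennreal ((L \<omega> - riemann_sum T H n \<omega>)\<^sup>2) \<partial>M)
      \<le> 2 * 0 + 4 * 0 + ennreal (4 * C * T * T / real (Suc n))"
    by (rule LIMSEQ_le_const) (use bound in auto)
  then show ?thesis by simp
qed

text \<open>
  The Riemann sums converge to \<open>L\<close> in mean square, hence almost surely along a subsequence, and their
  fourth moments are bounded. So the first two moments pass to the limit, the fourth is bounded by
  Fatou's lemma, and \<open>L\<close> depends only on what the Riemann sums depend on.
\<close>

lemma ito_integral_moments: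
  assumes T: "0 < T" and ito: "has_ito_integral M F w T H L"
    and H4: "\<And>t. t \<in> {0..T} \<Longrightarrow> integrable M (\<lambda>\<omega>. H t \<omega> ^ 4)"
    and K: "\<And>t. t \<in> {0..T} \<Longrightarrow> expectation (\<lambda>\<omega>. H t \<omega> ^ 4) \<le> K"
    and mod: "\<And>s t. 0 \<le> s \<Longrightarrow> s \<le> t \<Longrightarrow> t \<le> T \<Longrightarrow> expectation (\<lambda>\<omega>. (H t \<omega> - H s \<omega>)\<^sup>2) \<le> C * (t - s)"
    and var: "(\<lambda>n. \<Sum>j<Suc n. T / real (Suc n) * expectation (\<lambda>\<omega>. (H (grid T n j) \<omega>)\<^sup>2)) \<longlonglongrightarrow> V"
  shows "L4 L" and "expectation L = 0" and "expectation (\<lambda>\<omega>. (L \<omega>)\<^sup>2) = V"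
    and "expectation (\<lambda>\<omega>. L \<omega> ^ 4) \<le> K * moment_const T"
    and "\<And>N p. (\<And>t. t \<in> {0..T} \<Longrightarrow> factors_through M N p (H t)) \<Longrightarrow>
           (\<And>t. t \<in> {0..T} \<Longrightarrow> factors_through M N p (w t)) \<Longrightarrow> factors_through M N p L"
proof -
  have LM[measurable]: "L \<in> borel_measurable M"
    and H: "\<And>t. t \<in> {0..T} \<Longrightarrow> H t \<in> borel_measurable (F t)"
    using ito unfolding has_ito_integral_def adapted_on_def by blast+
  define C' where "C' = max C 0"
  have mod': "expectation (\<lambda>\<omega>. (H t \<omega> - H s \<omega>)\<^sup>2) \<le> C' * (t - s)" if "0 \<le> s" "s \<le> t" "t \<le> T" for s t
    by (rule order_trans[OF mod[OF that]]) (use that in \<open>auto simp: C'_def intro!: mult_right_mono\<close>)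
  note R = riemann_sum_moments[OF less_imp_le[OF T] H H4 K]
  let ?R = "riemann_sum T H"
  note [measurable] = L4_measurable[OF R(1)]
  have err: "(\<integral>\<^sup>+\<omega>. ennreal ((L \<omega> - ?R n \<omega>)\<^sup>2) \<partial>M) \<le> ennreal (4 * C' * T * T / real (Suc n))" for n
    by (rule ito_integral_riemann_error[OF T ito H4 mod']) (auto simp: C'_def)
  have iD: "integrable M (\<lambda>\<omega>. (L \<omega> - ?R n \<omega>)\<^sup>2)" for n
    by (rule integrableI_bounded) (use order_le_less_trans[OF err[of n] ennreal_less_top] in auto)
  have ED: "expectation (\<lambda>\<omega>. (L \<omega> - ?R n \<omega>)\<^sup>2) \<le> 4 * C' * T * T / real (Suc n)" for n
    using err[of n] T by (simp add: nn_integral_eq_integral[OF iD] C'_def)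
  have "(\<lambda>n. expectation (\<lambda>\<omega>. norm ((L \<omega> - ?R n \<omega>)\<^sup>2))) \<longlonglongrightarrow> 0"
  proof (rule tendsto_sandwich[of "\<lambda>_. 0"])
    show "(\<lambda>n. 4 * C' * T * T / real (Suc n)) \<longlonglongrightarrow> 0"
      by (rule LIMSEQ_Suc) (rule lim_const_over_n)
  qed (use ED in \<open>auto simp: integral_nonneg_AE\<close>)
  from tendsto_L1_AE_subseq[OF iD this] obtain r :: "nat \<Rightarrow> nat" where r: "strict_mono r"
    and lim0: "AE \<omega> in M. (\<lambda>n. (L \<omega> - ?R (r n) \<omega>)\<^sup>2) \<longlonglongrightarrow> 0" by blast
  have lim: "AE \<omega> in M. (\<lambda>n. ?R (r n) \<omega>) \<longlonglongrightarrow> L \<omega>"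
    using lim0
  proof eventually_elim
    case (elim \<omega>)
    then have "(\<lambda>n. sqrt ((L \<omega> - ?R (r n) \<omega>)\<^sup>2)) \<longlonglongrightarrow> sqrt 0" by (intro tendsto_intros)
    then have "(\<lambda>n. L \<omega> - ?R (r n) \<omega>) \<longlonglongrightarrow> 0" by (simp add: tendsto_rabs_zero_iff)
    then have "(\<lambda>n. L \<omega> - (L \<omega> - ?R (r n) \<omega>)) \<longlonglongrightarrow> L \<omega> - 0" by (intro tendsto_intros)
    then show ?case by simp
  qed
  have lim2: "AE \<omega> in M. (\<lambda>n. (?R (r n) \<omega>)\<^sup>2) \<longlonglongrightarrow> (L \<omega>)\<^sup>2"
    using lim by eventually_elim (intro tendsto_intros)
  have R4: "integrable M (\<lambda>\<omega>. ((?R n \<omega>)\<^sup>2)\<^sup>2)" "expectation (\<lambda>\<omega>. ((?R n \<omega>)\<^sup>2)\<^sup>2) \<le> K * moment_const T" for n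
    using L4_integrable_4[OF R(1)] R(4) by (simp_all add: power_mult[symmetric])
  note l2 = limit_second_moment[OF _ _ R4 lim2, simplified]
  show L4: "L4 L" "expectation (\<lambda>\<omega>. L \<omega> ^ 4) \<le> K * moment_const T"
    using l2(1,2) by (auto simp: L4_def power_mult[symmetric])
  have R2: "(\<lambda>n. expectation (\<lambda>\<omega>. (?R (r n) \<omega>)\<^sup>2)) \<longlonglongrightarrow> V"
  proof -
    have "(\<lambda>n. expectation (\<lambda>\<omega>. (?R n \<omega>)\<^sup>2))
        = (\<lambda>n. \<Sum>j<Suc n. T / real (Suc n) * expectation (\<lambda>\<omega>. (H (grid T n j) \<omega>)\<^sup>2))"
      by (rule ext) (rule R(3))
    then have "(\<lambda>n. expectation (\<lambda>\<omega>. (?R n \<omega>)\<^sup>2)) \<longlonglongrightarrow> V" using var by (simp only:)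
    from LIMSEQ_subseq_LIMSEQ[OF this r] show ?thesis by (simp only: comp_def)
  qed
  show "expectation (\<lambda>\<omega>. (L \<omega>)\<^sup>2) = V"
    by (rule LIMSEQ_unique[OF l2(4) R2])
  from R2 have "Bseq (\<lambda>n. expectation (\<lambda>\<omega>. (?R (r n) \<omega>)\<^sup>2))"
    by (intro convergent_imp_Bseq convergentI)
  then obtain B where B: "expectation (\<lambda>\<omega>. (?R (r n) \<omega>)\<^sup>2) \<le> B" for n
    unfolding Bseq_def by (auto dest: spec abs_le_D1)
  have "(\<lambda>n. expectation (?R (r n))) \<longlonglongrightarrow> expectation L"
    by (rule limit_second_moment(4)[OF _ LM L4_integrable_2[OF R(1)] B lim]) measurable
  moreover have "(\<lambda>n. expectation (?R (r n))) = (\<lambda>_. 0)" by (rule ext) (rule R(2))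
  ultimately show "expectation L = 0" by (simp only: LIMSEQ_const_iff)
  fix N :: "'b measure" and p
  assume fH: "\<And>t. t \<in> {0..T} \<Longrightarrow> factors_through M N p (H t)"
    and fw: "\<And>t. t \<in> {0..T} \<Longrightarrow> factors_through M N p (w t)"
  have "factors_through M N p (?R n)" for n
    unfolding riemann_sum_def wsum_def[abs_def] incr_def
    using grid_mem[of T _ n] T
    by (intro factors_through_sum factors_through_mult factors_through_diff fH fw) auto
  then show "factors_through M N p L" by (rule factors_through_limit[OF _ lim])
qed

end

section \<open>The damped oscillator with a continuous forcing\<close>

lemma set_lebesgue_integral_Icc_self: "(LINT s:{a..a::real}|lborel. f s) = (0::real)"
proof -
  have "AE s in lborel. indicator {a..a} s *\<^sub>R f s = 0"
    using AE_lborel_singleton[of a] by eventually_elim (auto split: split_indicator)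
  then show ?thesis
    unfolding set_lebesgue_integral_def by (rule integral_eq_zero_AE)
qed

lemma set_lebesgue_integral_eq_diff:
  fixes f g :: "real \<Rightarrow> real"
  assumes "a \<le> b" and "continuous_on {a..b} f"
    and "\<And>x. x \<in> {a..b} \<Longrightarrow> (g has_real_derivative f x) (at x within {a..b})"
  shows "(LINT s:{a..b}|lborel. f s) = g b - g a"
proof -
  have "(f has_integral (g b - g a)) {a..b}"
    by (rule fundamental_theorem_of_calculus[OF assms(1)])
       (use assms(3) in \<open>simp add: has_real_derivative_iff_has_vector_derivative\<close>)
  then show ?thesis
    using set_borel_integral_eq_integral(2)[OF borel_integrable_atLeastAtMost'[OF assms(2)]]
    by (simp add: integral_unique)
qed

lemma set_lebesgue_integral_has_derivative:
  fixes f :: "real \<Rightarrow> real"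
  assumes f: "continuous_on {0..T} f" and x: "x \<in> {0..T}"
  shows "((\<lambda>t. LINT s:{0..t}|lborel. f s) has_real_derivative f x) (at x within {0..T})"
proof -
  have eq: "(LINT s:{0..t}|lborel. f s) = integral {0..t} f" if "t \<in> {0..T}" for t
    using that by (intro set_borel_integral_eq_integral(2) borel_integrable_atLeastAtMost'
        continuous_on_subset[OF f]) auto
  have "((\<lambda>t. integral {0..t} f) has_real_derivative f x) (at x within {0..T})"
    by (rule integral_has_real_derivative[OF f x])
  then show ?thesis
    by (rule has_field_derivative_transform_within[OF _ zero_less_one x]) (simp add: eq)
qed

text \<open>
  The half lines form an intersection-stable generator of the Borel sets, so the integrals of the two
  functions over all Borel subsets of \<open>[0,T]\<close> agree. This identifies the drift of an Ito process.
\<close>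

lemma AE_eq_of_indefinite_integral_eq:
  fixes f g :: "real \<Rightarrow> real"
  assumes f: "set_integrable lborel {0..T} f" and g: "set_integrable lborel {0..T} g"
    and eq: "\<And>t. t \<in> {0..T} \<Longrightarrow> (LINT s:{0..t}|lborel. f s) = (LINT s:{0..t}|lborel. g s)"
  shows "AE t in lborel. t \<in> {0..T} \<longrightarrow> f t = g t"
proof -
  define h where "h t = indicator {0..T} t * (f t - g t)" for t
  have ih: "integrable lborel h"
    using set_integral_diff(1)[OF f g] by (simp add: set_integrable_def h_def[abs_def])
  have ihA: "set_integrable lborel A h" if "A \<in> sets lborel" for A
    unfolding set_integrable_def using integrable_mult_indicator[OF that ih] .
  have base: "(LINT t:{..a}|lborel. h t) = 0" for a
  proof (cases "0 \<le> a \<and> 0 \<le> T")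
    case True
    let ?m = "min a T"
    have sub: "{0..?m} \<subseteq> {0..T}" by auto
    have "(LINT t:{..a}|lborel. h t) = (LINT t:{0..?m}|lborel. f t - g t)"
      unfolding set_lebesgue_integral_def
      by (rule Bochner_Integration.integral_cong) (auto simp: h_def split: split_indicator)
    also have "\<dots> = (LINT t:{0..?m}|lborel. f t) - (LINT t:{0..?m}|lborel. g t)"
      by (intro set_integral_diff set_integrable_subset[OF f] set_integrable_subset[OF g])
          (use sub in auto)
    also have "\<dots> = 0" using eq[of ?m] True by simp
    finally show ?thesis .
  next
    case False
    then have "indicator {..a} t *\<^sub>R h t = 0" for t
      by (auto simp: h_def split: split_indicator)
    then show ?thesis unfolding set_lebesgue_integral_def by (simp only: integral_zero)
  qed
  have total: "(LINT t|lborel. h t) = 0"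
  proof (cases "0 \<le> T")
    case True
    have "(LINT t|lborel. h t) = (LINT t:{..T}|lborel. h t)"
      unfolding set_lebesgue_integral_def
      by (rule Bochner_Integration.integral_cong) (auto simp: h_def split: split_indicator)
    then show ?thesis using base by simp
  next
    case False
    then have "h t = 0" for t by (simp add: h_def)
    then show ?thesis by simp
  qed
  have all: "(LINT t:A|lborel. h t) = 0" if "A \<in> sets lborel" for A
  proof -
    let ?G = "range (\<lambda>a::real. {..a})"
    have S: "sigma_sets UNIV ?G = sets lborel"
      by (simp add: borel_eq_atMost)
    have "Int_stable ?G" by (auto simp: Int_stable_def min_def intro!: exI[of _ "min _ _"])
    moreover have "?G \<subseteq> Pow UNIV" by simp
    moreover have "A \<in> sigma_sets UNIV ?G" using that S by simp
    ultimately show ?thesis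
    proof (induction rule: sigma_sets_induct_disjoint)
      case (compl A)
      have A: "A \<in> sets lborel" using compl(1) S by simp
      then have "(LINT t:A|lborel. h t) + (LINT t:-A|lborel. h t) = (LINT t:A \<union> - A|lborel. h t)"
        by (intro set_integral_Un[symmetric] ihA) auto
      also have "\<dots> = 0" using total by (simp add: set_lebesgue_integral_def)
      finally show ?case using compl(2) by (simp add: Compl_eq_Diff_UNIV)
    next
      case (union A)
      have A: "A i \<in> sets lborel" for i using union(2) S by auto
      have "(LINT t:(\<Union>i. A i)|lborel. h t) = (\<Sum>i. (LINT t:A i|lborel. h t))"
        by (rule lebesgue_integral_countable_add)
           (use A union(1) ihA in \<open>auto simp: disjoint_family_on_def intro!: ihA\<close>)
      then show ?case using union(3) by simp
    qed (use base in \<open>auto simp: set_lebesgue_integral_def\<close>)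
  qed
  have "AE t in lborel. h t = 0"
    by (rule density_unique_real[OF ih, of "\<lambda>_. 0"]) (use all in \<open>auto simp: set_lebesgue_integral_def\<close>)
  then show ?thesis
    by eventually_elim (auto simp: h_def)
qed

text \<open>
  Variation of constants, with the integral against \<open>dw\<close> integrated by parts so that it makes sense for
  every continuous \<open>w\<close>. The function \<open>G s = \<eta> (t - s) (v s - w s) + (\<eta>' (t - s) - \<theta> \<eta> (t - s)) u s\<close> has
  derivative \<open>w s * \<eta>' (t - s)\<close>: read backwards in time, \<open>\<eta>\<close> solves the adjoint equation, and the other terms
  cancel. The solution \<open>\<eta>\<close> with \<open>\<eta> 0 = 0\<close> and \<open>\<eta>' 0 = 1\<close> yields \<open>u t\<close>; its derivative, with the initial
  values \<open>1\<close> and \<open>\<theta>\<close>, yields \<open>v t\<close>.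
\<close>

lemma damped_oscillator_duality:
  fixes u v w :: "real \<Rightarrow> real"
  assumes cont: "continuous_on {0..T} u" "continuous_on {0..T} v" "continuous_on {0..T} w"
    and u: "\<And>t. t \<in> {0..T} \<Longrightarrow> u t = (LINT s:{0..t}|lborel. v s)"
    and v: "\<And>t. t \<in> {0..T} \<Longrightarrow>
      v t = - \<kappa> * (LINT s:{0..t}|lborel. u s) + \<theta> * (LINT s:{0..t}|lborel. v s) + w t"
    and \<eta>: "\<And>x. (\<eta> has_real_derivative \<eta>' x) (at x)"
    and \<eta>': "\<And>x. (\<eta>' has_real_derivative - \<kappa> * \<eta> x + \<theta> * \<eta>' x) (at x)"
    and t: "t \<in> {0..T}"
  shows "\<eta> 0 * v t + (\<eta>' 0 - \<theta> * \<eta> 0) * u t = \<eta> 0 * w t + (LINT s:{0..t}|lborel. w s * \<eta>' (t - s))"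
proof -
  define A where "A s = v s - w s" for s
  have du: "(u has_real_derivative v x) (at x within {0..T})" if "x \<in> {0..T}" for x
    by (rule has_field_derivative_transform_within[OF set_lebesgue_integral_has_derivative[OF
        cont(2) that] zero_less_one that])
       (simp add: u)
  have dA: "(A has_real_derivative - \<kappa> * u x + \<theta> * v x) (at x within {0..T})" if "x \<in> {0..T}" for x
  proof (rule has_field_derivative_transform_within[OF _ zero_less_one that])
    show "((\<lambda>t. - \<kappa> * (LINT s:{0..t}|lborel. u s) + \<theta> * (LINT s:{0..t}|lborel. v s))
        has_real_derivative - \<kappa> * u x + \<theta> * v x) (at x within {0..T})"
      by (rule DERIV_add; rule DERIV_cmult; rule set_lebesgue_integral_has_derivative[OF _ that])
         (rule cont)+
  qed (simp add: A_def v)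
  define G where "G s = \<eta> (t - s) * A s + (\<eta>' (t - s) - \<theta> * \<eta> (t - s)) * u s" for s
  have "(LINT s:{0..t}|lborel. w s * \<eta>' (t - s)) = G t - G 0"
  proof (rule set_lebesgue_integral_eq_diff)
    have "continuous_on UNIV \<eta>'" by (rule DERIV_continuous_on[OF \<eta>'])
    then have "continuous_on {0..t} (\<lambda>s. \<eta>' (t - s))"
      by (rule continuous_on_compose2) (auto intro!: continuous_intros)
    moreover have "continuous_on {0..t} w" by (rule continuous_on_subset[OF cont(3)]) (use t in auto)
    ultimately show "continuous_on {0..t} (\<lambda>s. w s * \<eta>' (t - s))" by (intro continuous_on_mult)
    fix x assume "x \<in> {0..t}"
    then have x: "x \<in> {0..T}" and sub: "{0..t} \<subseteq> {0..T}" using t by auto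
    have lin: "((\<lambda>s. t - s) has_real_derivative - 1) (at x within {0..t})"
      by (auto intro!: derivative_eq_intros)
    have d\<eta>: "((\<lambda>s. \<eta> (t - s)) has_real_derivative - \<eta>' (t - x)) (at x within {0..t})"
      using DERIV_chain2[OF \<eta> lin] by simp
    have d\<eta>': "((\<lambda>s. \<eta>' (t - s)) has_real_derivative - (- \<kappa> * \<eta> (t - x)
        + \<theta> * \<eta>' (t - x))) (at x within {0..t})"
      using DERIV_chain2[OF \<eta>' lin] by simp
    have "(G has_real_derivative
        (- \<eta>' (t - x)) * A x + (- \<kappa> * u x + \<theta> * v x) * \<eta> (t - x)
        + ((- (- \<kappa> * \<eta> (t - x) + \<theta> * \<eta>' (t - x)) - \<theta> * - \<eta>' (t - x)) * u x
          + v x * (\<eta>' (t - x) - \<theta> * \<eta> (t - x)))) (at x within {0..t})"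
      unfolding G_def[abs_def]
      by (rule DERIV_add; rule DERIV_mult)
         (rule DERIV_diff DERIV_cmult d\<eta> d\<eta>' DERIV_subset[OF du[OF x] sub] DERIV_subset[OF dA[OF x] sub])+
    then show "(G has_real_derivative w x * \<eta>' (t - x)) (at x within {0..t})"
      by (rule DERIV_cong) (simp add: A_def algebra_simps)
  qed (use t in auto)
  moreover have "u 0 = 0" "A 0 = 0"
    using u[of 0] v[of 0] t set_lebesgue_integral_Icc_self[of 0] by (simp_all add: A_def)
  ultimately show ?thesis by (simp add: G_def A_def algebra_simps)
qed

section \<open>Impulse responses and their variances\<close>

text \<open>
  The solution of \<open>x'' + 2 b x' + (l\<^sup>2 + b\<^sup>2) x = 0\<close> with \<open>x 0 = 0\<close> and \<open>x' 0 = 1\<close>.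
\<close>

definition displacement_kernel :: "real \<Rightarrow> real \<Rightarrow> real \<Rightarrow> real" where
  "displacement_kernel b l r = exp (- b * r) * sin (l * r) / l"

definition velocity_kernel :: "real \<Rightarrow> real \<Rightarrow> real \<Rightarrow> real" where
  "velocity_kernel b l r = exp (- b * r) * (cos (l * r) - b / l * sin (l * r))"

lemma kernel_0: "displacement_kernel b l 0 = 0" "velocity_kernel b l 0 = 1"
  by (simp_all add: displacement_kernel_def velocity_kernel_def)

lemma displacement_kernel_deriv:
  assumes "l \<noteq> 0"
  shows "(displacement_kernel b l has_real_derivative velocity_kernel b l x) (at x)"
  unfolding displacement_kernel_def[abs_def] velocity_kernel_def
  by (auto intro!: derivative_eq_intros simp: field_simps assms)

lemma velocity_kernel_deriv:
  assumes "l \<noteq> 0"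
  shows "(velocity_kernel b l has_real_derivative - (l\<^sup>2 + b\<^sup>2) * displacement_kernel b l x
      + (- 2 * b) * velocity_kernel b l x) (at x)"
  unfolding displacement_kernel_def velocity_kernel_def[abs_def]
  by (auto intro!: derivative_eq_intros simp: field_simps power2_eq_square assms)

lemma velocity_kernel_deriv2:
  assumes "l \<noteq> 0"
  shows "((\<lambda>x. - (l\<^sup>2 + b\<^sup>2) * displacement_kernel b l x
      + (- 2 * b) * velocity_kernel b l x) has_real_derivative
    - (l\<^sup>2 + b\<^sup>2) * velocity_kernel b l x + (- 2 * b) * (- (l\<^sup>2 + b\<^sup>2) * displacement_kernel b l x
        + (- 2 * b) * velocity_kernel b l x)) (at x)"
  by (rule DERIV_add; rule DERIV_cmult; rule displacement_kernel_deriv velocity_kernel_deriv; rule assms)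

lemma kernel_bounds:
  assumes "0 < l" "0 \<le> r" "r \<le> T" "\<bar>b\<bar> \<le> 1"
  shows "\<bar>displacement_kernel b l r\<bar> \<le> exp T / l" and "\<bar>velocity_kernel b l r\<bar> \<le> exp T * (1 + \<bar>b\<bar> / l)"
proof -
  have "- b * r \<le> \<bar>b\<bar> * r" using assms by (intro mult_right_mono) auto
  also have "\<dots> \<le> 1 * T" using assms by (intro mult_mono) auto
  finally have e: "exp (- b * r) \<le> exp T" by simp
  show "\<bar>displacement_kernel b l r\<bar> \<le> exp T / l"
    unfolding displacement_kernel_def
        using e assms abs_sin_le_one[of "l * r"] mult_mono[OF e abs_sin_le_one[of "l * r"]]
    by (simp add: abs_mult divide_right_mono)
  have "\<bar>cos (l * r) - b / l * sin (l * r)\<bar>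
      \<le> \<bar>cos (l * r)\<bar> + \<bar>b / l * sin (l * r)\<bar>" by (rule abs_triangle_ineq4)
  also have "\<dots> \<le> 1 + \<bar>b\<bar> / l"
    using assms abs_sin_le_one[of "l * r"] mult_left_mono[OF abs_sin_le_one[of "l * r"], of "\<bar>b\<bar> / l"]
    by (intro add_mono) (auto simp: abs_mult)
  finally show "\<bar>velocity_kernel b l r\<bar> \<le> exp T * (1 + \<bar>b\<bar> / l)"
    unfolding velocity_kernel_def using e by (auto simp: abs_mult intro!: mult_mono)
qed

definition exp_primitive :: "real \<Rightarrow> real \<Rightarrow> real" where
  "exp_primitive \<theta> r = (if \<theta> = 0 then r else (exp (\<theta> * r) - 1) / \<theta>)"

text \<open>
  The primitive of \<open>exp (\<theta> r) cos (m r)\<close> that vanishes at 0; it is of order \<open>1 / m\<close>.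
\<close>

definition exp_cos_primitive :: "real \<Rightarrow> real \<Rightarrow> real \<Rightarrow> real" where
  "exp_cos_primitive \<theta> m r = (exp (\<theta> * r) * (\<theta> * cos (m * r) + m * sin (m * r)) - \<theta>) / (\<theta>\<^sup>2 + m\<^sup>2)"

lemma exp_primitive_deriv: "(exp_primitive \<theta> has_real_derivative exp (\<theta> * r)) (at r within S)"
  unfolding exp_primitive_def[abs_def]
  by (cases "\<theta> = 0") (auto intro!: derivative_eq_intros simp: field_simps)

lemma exp_cos_primitive_deriv:
  assumes "m \<noteq> 0"
  shows "(exp_cos_primitive \<theta> m has_real_derivative exp (\<theta> * r) * cos (m * r)) (at r within S)"
proof -
  have "\<theta>\<^sup>2 + m\<^sup>2 \<noteq> 0" using assms by (simp add: sum_power2_eq_zero_iff)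
  moreover have "((\<lambda>r. exp (\<theta> * r) * (\<theta> * cos (m * r) + m * sin (m * r)) - \<theta>)
      has_real_derivative (\<theta>\<^sup>2 + m\<^sup>2) * (exp (\<theta> * r) * cos (m * r))) (at r within S)"
    by (auto intro!: derivative_eq_intros simp: power2_eq_square algebra_simps)
  ultimately show ?thesis
    unfolding exp_cos_primitive_def[abs_def]
    using DERIV_cdivide[of _ "(\<theta>\<^sup>2 + m\<^sup>2) * (exp (\<theta> * r) * cos (m * r))" r S "\<theta>\<^sup>2 + m\<^sup>2"] by fastforce
qed

text \<open>
  The primitive of the squared kernel that vanishes at 0, written out by means of
  \<open>2 sin\<^sup>2 x = 1 - cos (2 x)\<close>. It is the variance of the displacement at time \<open>r\<close>.
\<close>

definition displacement_variance :: "real \<Rightarrow> real \<Rightarrow> real \<Rightarrow> real" where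
  "displacement_variance b l r = (exp_primitive (- 2 * b) r - exp_cos_primitive (- 2 * b) (2 * l) r)
      / (2 * l\<^sup>2)"

text \<open>
  The primitive of the squared velocity kernel, obtained from the equation of motion by integrating
  \<open>(x x')' = x'\<^sup>2 + x x''\<close>.
\<close>

definition velocity_variance :: "real \<Rightarrow> real \<Rightarrow> real \<Rightarrow> real" where
  "velocity_variance b l r = (l\<^sup>2 + b\<^sup>2) * displacement_variance b l r
      + displacement_kernel b l r * velocity_kernel b l r + b * (displacement_kernel b l r)\<^sup>2"

lemma displacement_variance_0: "displacement_variance b l 0 = 0" "velocity_variance b l 0 = 0"
  by (simp_all add: displacement_variance_def velocity_variance_def exp_primitive_def
      exp_cos_primitive_def kernel_0)

lemma displacement_variance_deriv:
  assumes "l \<noteq> 0"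
  shows "(displacement_variance b l has_real_derivative (displacement_kernel b l r)\<^sup>2) (at r)"
proof -
  have "(displacement_variance b l has_real_derivative
      (exp (- 2 * b * r) - exp (- 2 * b * r) * cos (2 * l * r)) / (2 * l\<^sup>2)) (at r)"
    unfolding displacement_variance_def[abs_def]
    by (rule DERIV_cdivide, rule DERIV_diff[OF exp_primitive_deriv exp_cos_primitive_deriv])
        (use assms in simp)
  moreover have "(exp (- 2 * b * r) - exp (- 2 * b * r) * cos (2 * l * r)) / (2 * l\<^sup>2)
      = (displacement_kernel b l r)\<^sup>2"
  proof -
    have e: "exp (- 2 * b * r) = (exp (- b * r))\<^sup>2" by (simp add: exp_double[symmetric] mult.assoc)
    have c: "cos (2 * l * r) = 1 - 2 * (sin (l * r))\<^sup>2"
      using cos_double_sin[of "l * r"] by (simp only: mult.assoc)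
    show ?thesis
      unfolding e c displacement_kernel_def power_divide power_mult_distrib by (simp add: algebra_simps)
  qed
  ultimately show ?thesis by (simp only:)
qed

lemma velocity_variance_deriv:
  assumes "l \<noteq> 0"
  shows "(velocity_variance b l has_real_derivative (velocity_kernel b l r)\<^sup>2) (at r)"
  unfolding velocity_variance_def[abs_def]
  by (rule derivative_eq_intros refl displacement_variance_deriv displacement_kernel_deriv
      velocity_kernel_deriv assms)+
     (simp add: power2_eq_square algebra_simps)

text \<open>
  The difference is the oscillating part of the primitive.
\<close>

lemma displacement_variance_error:
  assumes b: "\<bar>b\<bar> \<le> 1" and l: "0 < l" and r: "0 \<le> r" "r \<le> T"
  shows "\<bar>2 * l\<^sup>2 * displacement_variance b l r - exp_primitive (- 2 * b) r\<bar>
      \<le> (exp (2 * T) * (2 + 2 * l) + 2) / (4 * l\<^sup>2)"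
proof -
  let ?\<theta> = "- 2 * b"
  have e: "exp (?\<theta> * r) \<le> exp (2 * T)"
  proof -
    have "?\<theta> * r \<le> 2 * r" using b r by (intro mult_right_mono) auto
    then show ?thesis using r by simp
  qed
  have c1: "\<bar>?\<theta> * cos (2 * l * r)\<bar> \<le> 2 * 1"
    unfolding abs_mult[of ?\<theta>] using b by (intro mult_mono) auto
  have c2: "\<bar>2 * l * sin (2 * l * r)\<bar> \<le> 2 * l * 1"
    unfolding abs_mult[of "2 * l"] using l by (intro mult_mono) auto
  have "\<bar>exp (?\<theta> * r) * (?\<theta> * cos (2 * l * r) + 2 * l * sin (2 * l * r)) - ?\<theta>\<bar>
      \<le> exp (?\<theta> * r) * \<bar>?\<theta> * cos (2 * l * r) + 2 * l * sin (2 * l * r)\<bar> + \<bar>?\<theta>\<bar>"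
    using abs_triangle_ineq4[of "exp (?\<theta> * r) * (?\<theta> * cos (2 * l * r) + 2 * l * sin (2 * l * r))" ?\<theta>]
    by (simp add: abs_mult)
  also have "\<dots> \<le> exp (2 * T) * (2 + 2 * l) + 2"
    using e b c1 c2 by (intro add_mono mult_mono) auto
  finally have "\<bar>exp_cos_primitive ?\<theta> (2 * l) r\<bar> \<le> (exp (2 * T) * (2 + 2 * l) + 2) / (4 * l\<^sup>2)"
    unfolding exp_cos_primitive_def abs_divide
    using l b by (intro frac_le) (auto simp: power_mult_distrib)
  moreover have "2 * l\<^sup>2 * displacement_variance b l r - exp_primitive ?\<theta> r
      = - exp_cos_primitive ?\<theta> (2 * l) r"
    using l by (simp add: displacement_variance_def)
  ultimately show ?thesis by simp
qed

lemma integral_exp_primitive: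
  assumes "0 < T"
  shows "(LINT t:{0..T}|lborel. exp_primitive \<theta> t / 2) = C_const \<theta> T"
proof (cases "\<theta> = 0")
  case True
  have "(LINT t:{0..T}|lborel. t / 2) = T\<^sup>2 / 4 - 0\<^sup>2 / 4"
    by (rule set_lebesgue_integral_eq_diff)
       (use assms in \<open>auto intro!: continuous_intros derivative_eq_intros\<close>)
  then show ?thesis using True by (simp add: exp_primitive_def C_const_def)
next
  case False
  have "(LINT t:{0..T}|lborel. (exp (\<theta> * t) - 1) / \<theta> / 2)
      = (exp (\<theta> * T) - \<theta> * T) / (2 * \<theta>\<^sup>2) - (exp (\<theta> * 0) - \<theta> * 0) / (2 * \<theta>\<^sup>2)"
    by (rule set_lebesgue_integral_eq_diff)
       (use assms False in \<open>auto intro!: continuous_intros derivative_eq_intros simp: field_simps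
           power2_eq_square\<close>)
  then show ?thesis using False by (simp add: exp_primitive_def C_const_def diff_divide_distrib)
qed

lemma one_plus_less_exp:
  fixes x :: real
  assumes "x \<noteq> 0"
  shows "1 + x < exp x"
proof (cases "0 \<le> 1 + x / 2")
  case True
  have "(1 + x / 2)\<^sup>2 = 1 + x + x\<^sup>2 / 4" by (simp add: power2_sum power_divide)
  moreover have "0 < x\<^sup>2" using assms by simp
  ultimately have "1 + x < (1 + x / 2)\<^sup>2" by linarith
  also have "\<dots> \<le> (exp (x / 2))\<^sup>2" using True by (intro power_mono exp_ge_add_one_self)
  also have "\<dots> = exp x" by (simp add: exp_double[symmetric])
  finally show ?thesis .
next
  case False
  then show ?thesis using exp_gt_zero[of x] by linarith
qed

lemma C_const_pos:
  assumes "0 < T"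
  shows "0 < C_const \<theta> T"
proof (cases "\<theta> = 0")
  case False
  then have "1 + \<theta> * T < exp (\<theta> * T)" using assms by (intro one_plus_less_exp) auto
  then show ?thesis using False by (simp add: C_const_def)
qed (use assms in \<open>simp add: C_const_def\<close>)

section \<open>Integrals of continuous processes\<close>

context prob_space
begin

text \<open>
  The Cauchy-Schwarz inequality \<open>E (\<integral> X)\<^sup>2 \<le> (t - s) \<integral> E X\<^sup>2\<close>, proved on Riemann sums, which involve finitely
  many times only.
\<close>

lemma integral_square_bound:
  fixes X :: "real \<Rightarrow> 'a \<Rightarrow> real"
  assumes X: "\<And>t. t \<in> {0..T} \<Longrightarrow> X t \<in> borel_measurable M"
      "\<And>t. t \<in> {0..T} \<Longrightarrow> integrable M (\<lambda>\<omega>. (X t \<omega>)\<^sup>2)"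
      "\<And>t. t \<in> {0..T} \<Longrightarrow> expectation (\<lambda>\<omega>. (X t \<omega>)\<^sup>2) \<le> B"
    and cont: "AE \<omega> in M. continuous_on {0..T} (\<lambda>t. X t \<omega>)"
    and st: "0 \<le> s" "s \<le> t" "t \<le> T"
    and Y: "Y \<in> borel_measurable M" "AE \<omega> in M. Y \<omega>
        = (LINT r:{0..t}|lborel. X r \<omega>) - (LINT r:{0..s}|lborel. X r \<omega>)"
  shows "integrable M (\<lambda>\<omega>. (Y \<omega>)\<^sup>2)" and "expectation (\<lambda>\<omega>. (Y \<omega>)\<^sup>2) \<le> (t - s)\<^sup>2 * B"
proof -
  define d where "d = t - s"
  have d: "0 \<le> d" using st by (simp add: d_def)
  define Z where "Z n \<omega> = (\<Sum>j<Suc n. d / real (Suc n) * X (s + grid d n j) \<omega>)" for n \<omega>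
  have mem: "s + grid d n j \<in> {0..T}" if "j < Suc n" for n j
    using grid_mem[OF d, of j n] that st by (auto simp: d_def)
  have Zm: "Z n \<in> borel_measurable M" for n
    unfolding Z_def[abs_def] by (intro borel_measurable_sum borel_measurable_times
        borel_measurable_const X(1) mem) simp
  have Zsq: "(Z n \<omega>)\<^sup>2 \<le> d * (d / real (Suc n)) * (\<Sum>j<Suc n. (X (s + grid d n j) \<omega>)\<^sup>2)" for n \<omega>
    unfolding Z_def by (rule square_mean_sum_le)
  have iS: "integrable M (\<lambda>\<omega>. d * (d / real (Suc n)) * (\<Sum>j<Suc n. (X (s + grid d n j) \<omega>)\<^sup>2))" for n
    by (intro integrable_mult_right Bochner_Integration.integrable_sum X(2) mem) simp
  have iZ: "integrable M (\<lambda>\<omega>. (Z n \<omega>)\<^sup>2)" for n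
  proof (rule Bochner_Integration.integrable_bound[OF iS[of n]])
    show "(\<lambda>\<omega>. (Z n \<omega>)\<^sup>2) \<in> borel_measurable M" using Zm[of n] by simp
  qed (use order_trans[OF Zsq abs_ge_self] in \<open>simp only: real_norm_def abs_power2 AE_I2\<close>)
  have EZ: "expectation (\<lambda>\<omega>. (Z n \<omega>)\<^sup>2) \<le> d\<^sup>2 * B" for n
  proof -
    have "expectation (\<lambda>\<omega>. (Z n \<omega>)\<^sup>2)
        \<le> expectation (\<lambda>\<omega>. d * (d / real (Suc n)) * (\<Sum>j<Suc n. (X (s + grid d n j) \<omega>)\<^sup>2))"
      by (rule integral_mono[OF iZ iS Zsq])
    also have "\<dots> = d * (d / real (Suc n)) * (\<Sum>j<Suc n. expectation (\<lambda>\<omega>. (X (s + grid d n j) \<omega>)\<^sup>2))"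
      by (subst integral_mult_right_zero, subst Bochner_Integration.integral_sum) (auto intro!: X(2) mem)
    also have "\<dots> \<le> d * (d / real (Suc n)) * (\<Sum>j<Suc n. B)"
      using d by (intro mult_left_mono sum_mono X(3) mem) auto
    also have "\<dots> = d\<^sup>2 * B" by (simp add: power2_eq_square del: of_nat_Suc)
    finally show ?thesis .
  qed
  have lim: "AE \<omega> in M. (\<lambda>n. Z n \<omega>) \<longlonglongrightarrow> Y \<omega>"
    using cont Y(2)
  proof eventually_elim
    case (elim \<omega>)
    let ?F = "\<lambda>t. LINT r:{0..t}|lborel. X r \<omega>"
    have c: "continuous_on {0..d} (\<lambda>r. X (s + r) \<omega>)"
      by (rule continuous_on_compose2[OF elim(1)])
          (use st in \<open>auto intro!: continuous_intros simp: d_def\<close>)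
    have "(LINT r:{0..d}|lborel. X (s + r) \<omega>) = ?F (s + d) - ?F (s + 0)"
    proof (rule set_lebesgue_integral_eq_diff[OF d c])
      fix r assume r: "r \<in> {0..d}"
      have "((\<lambda>r. s + r) has_real_derivative 1) (at r within {0..d})"
        by (auto intro!: derivative_eq_intros)
      moreover have "(?F has_real_derivative X (s + r) \<omega>) (at (s + r) within (\<lambda>r. s + r) ` {0..d})"
        by (rule DERIV_subset[OF set_lebesgue_integral_has_derivative[OF elim(1)]])
           (use r st in \<open>auto simp: d_def\<close>)
      ultimately show "((\<lambda>r. ?F (s + r)) has_real_derivative X (s + r) \<omega>) (at r within {0..d})"
        using DERIV_image_chain[of ?F "X (s + r) \<omega>" "\<lambda>r. s + r" r "{0..d}" 1] by (simp add: comp_def)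
    qed
    then have "(LINT r:{0..d}|lborel. X (s + r) \<omega>) = Y \<omega>" using elim(2) by (simp add: d_def)
    with riemann_sum_tendsto[OF d c] show ?case by (simp only: Z_def)
  qed
  show "integrable M (\<lambda>\<omega>. (Y \<omega>)\<^sup>2)" "expectation (\<lambda>\<omega>. (Y \<omega>)\<^sup>2) \<le> (t - s)\<^sup>2 * B"
    using limit_second_moment(1,2)[OF Zm Y(1) iZ EZ lim] by (simp_all add: d_def)
qed

text \<open>
  The Riemann sums of the pathwise integral have bounded second moments by the Cauchy-Schwarz
  inequality, so their means converge to the mean of the integral.
\<close>

lemma square_integral_moments:
  fixes X :: "real \<Rightarrow> 'a \<Rightarrow> real"
  assumes T: "0 \<le> T" and X: "\<And>t. t \<in> {0..T} \<Longrightarrow> L4 (X t)"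
      "\<And>t. t \<in> {0..T} \<Longrightarrow> expectation (\<lambda>\<omega>. X t \<omega> ^ 4) \<le> K"
      "\<And>t. t \<in> {0..T} \<Longrightarrow> expectation (\<lambda>\<omega>. (X t \<omega>)\<^sup>2) = G t"
    and G: "continuous_on {0..T} G"
    and cont: "\<And>\<omega>. \<omega> \<in> space M \<Longrightarrow> continuous_on {0..T} (\<lambda>t. X t \<omega>)"
  defines "V \<equiv> \<lambda>\<omega>. LINT t:{0..T}|lborel. (X t \<omega>)\<^sup>2"
  shows "V \<in> borel_measurable M" and "integrable M (\<lambda>\<omega>. (V \<omega>)\<^sup>2)"
    and "expectation V = (LINT t:{0..T}|lborel. G t)" and "expectation (\<lambda>\<omega>. (V \<omega>)\<^sup>2) \<le> T\<^sup>2 * K"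
    and "\<And>N p. (\<And>t. t \<in> {0..T} \<Longrightarrow> factors_through M N p (X t)) \<Longrightarrow> factors_through M N p V"
proof -
  define Z where "Z n \<omega> = (\<Sum>j<Suc n. T / real (Suc n) * (X (grid T n j) \<omega>)\<^sup>2)" for n \<omega>
  have mem: "grid T n j \<in> {0..T}" if "j < Suc n" for n j
    using grid_mem[OF T, of j n] that by auto
  have Xm: "X t \<in> borel_measurable M" if "t \<in> {0..T}" for t
    using L4_measurable[OF X(1)[OF that]] .
  have Zm: "Z n \<in> borel_measurable M" for n
    unfolding Z_def[abs_def]
    by (intro borel_measurable_sum borel_measurable_times borel_measurable_const
        borel_measurable_power Xm mem) simp
  have lim: "(\<lambda>n. Z n \<omega>) \<longlonglongrightarrow> V \<omega>" if "\<omega> \<in> space M" for \<omega>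
    unfolding Z_def V_def by (rule riemann_sum_tendsto[OF T]) (intro continuous_intros cont that)
  show Vm: "V \<in> borel_measurable M"
    by (rule borel_measurable_LIMSEQ_real[OF lim Zm])
  have Zsq: "(Z n \<omega>)\<^sup>2 \<le> T * (T / real (Suc n)) * (\<Sum>j<Suc n. X (grid T n j) \<omega> ^ 4)" for n \<omega>
    using square_mean_sum_le[of T n "\<lambda>j. (X (grid T n j) \<omega>)\<^sup>2"]
    unfolding Z_def by (simp add: power_mult[symmetric] del: sum.lessThan_Suc)
  have iS: "integrable M (\<lambda>\<omega>. T * (T / real (Suc n)) * (\<Sum>j<Suc n. X (grid T n j) \<omega> ^ 4))" for n
    by (intro integrable_mult_right Bochner_Integration.integrable_sum L4_integrable_4 X(1) mem) simp
  have iZ: "integrable M (\<lambda>\<omega>. (Z n \<omega>)\<^sup>2)" for n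
  proof (rule Bochner_Integration.integrable_bound[OF iS[of n]])
    show "(\<lambda>\<omega>. (Z n \<omega>)\<^sup>2) \<in> borel_measurable M" using Zm[of n] by simp
  qed (use order_trans[OF Zsq abs_ge_self] in \<open>simp only: real_norm_def abs_power2 AE_I2\<close>)
  have EZ: "expectation (\<lambda>\<omega>. (Z n \<omega>)\<^sup>2) \<le> T\<^sup>2 * K" for n
  proof -
    have "expectation (\<lambda>\<omega>. (Z n \<omega>)\<^sup>2)
        \<le> expectation (\<lambda>\<omega>. T * (T / real (Suc n)) * (\<Sum>j<Suc n. X (grid T n j) \<omega> ^ 4))"
      by (rule integral_mono[OF iZ iS Zsq])
    also have "\<dots> = T * (T / real (Suc n)) * (\<Sum>j<Suc n. expectation (\<lambda>\<omega>. X (grid T n j) \<omega> ^ 4))"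
      by (subst integral_mult_right_zero, subst Bochner_Integration.integral_sum) (auto intro!:
          L4_integrable_4 X(1) mem)
    also have "\<dots> \<le> T * (T / real (Suc n)) * (\<Sum>j<Suc n. K)"
      using T by (intro mult_left_mono sum_mono X(2) mem) auto
    also have "\<dots> = T\<^sup>2 * K" by (simp add: power2_eq_square del: of_nat_Suc)
    finally show ?thesis .
  qed
  have limAE: "AE \<omega> in M. (\<lambda>n. Z n \<omega>) \<longlonglongrightarrow> V \<omega>" using lim by auto
  note l = limit_second_moment[OF Zm Vm iZ EZ limAE]
  show "integrable M (\<lambda>\<omega>. (V \<omega>)\<^sup>2)" "expectation (\<lambda>\<omega>. (V \<omega>)\<^sup>2) \<le> T\<^sup>2 * K" by (rule l)+
  have "expectation (Z n) = (\<Sum>j<Suc n. T / real (Suc n) * G (grid T n j))" for n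
  proof -
    have "expectation (Z n) = (\<Sum>j<Suc n. expectation (\<lambda>\<omega>. T / real (Suc n) * (X (grid T n j) \<omega>)\<^sup>2))"
      unfolding Z_def[abs_def]
      by (intro Bochner_Integration.integral_sum integrable_mult_right L4_integrable_2 X(1) mem) simp
    also have "\<dots> = (\<Sum>j<Suc n. T / real (Suc n) * G (grid T n j))"
      by (intro sum.cong refl) (simp add: X(3)[OF mem])
    finally show ?thesis .
  qed
  then have "(\<lambda>n. expectation (Z n)) \<longlonglongrightarrow> (LINT t:{0..T}|lborel. G t)"
    using riemann_sum_tendsto[OF T G] by (simp only:)
  then show "expectation V = (LINT t:{0..T}|lborel. G t)"
    by (rule LIMSEQ_unique[OF l(4)])
  fix N :: "'c measure" and p
  assume f: "\<And>t. t \<in> {0..T} \<Longrightarrow> factors_through M N p (X t)"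
  have "factors_through M N p (Z n)" for n
    unfolding Z_def[abs_def] power2_eq_square
    by (intro factors_through_sum factors_through_mult factors_through_const f mem) auto
  then show "factors_through M N p V" by (rule factors_through_limit[OF _ limAE])
qed

end

context brownian_basis
begin

text \<open>
  The variable \<open>X\<close> is the integral of \<open>\<eta> (t - s)\<close> against \<open>dw(s)\<close>, integrated by parts. Summation by parts
  turns the sums \<open>\<Sum>j. \<eta> (t - s\<^sub>j) (w(s\<^sub>j\<^sub>+\<^sub>1) - w(s\<^sub>j))\<close> into Stieltjes sums that converge for every continuous
  path, and the moments of these sums are known. The function \<open>E\<close> is a primitive of \<open>\<eta>\<^sup>2\<close>.
\<close>

lemma wiener_integral_moments:
  assumes t: "0 \<le> t" and \<eta>: "\<And>x. (\<eta> has_real_derivative \<eta>' x) (at x)" and \<eta>': "continuous_on UNIV \<eta>'"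
    and B: "\<And>x. x \<in> {0..t} \<Longrightarrow> \<bar>\<eta> x\<bar> \<le> B"
    and E: "\<And>x. (E has_real_derivative (\<eta> x)\<^sup>2) (at x)"
    and X: "X \<in> borel_measurable M" "AE \<omega> in M. X \<omega>
        = \<eta> 0 * w t \<omega> + (LINT s:{0..t}|lborel. w s \<omega> * \<eta>' (t - s))"
  shows "L4 X" and "expectation (\<lambda>\<omega>. (X \<omega>)\<^sup>2) = E t - E 0"
    and "expectation (\<lambda>\<omega>. X \<omega> ^ 4) \<le> B ^ 4 * moment_const t"
    and "\<And>N p. (\<And>s. 0 \<le> s \<Longrightarrow> factors_through M N p (w s)) \<Longrightarrow> factors_through M N p X"
proof -
  let ?H = "\<lambda>s (\<omega>::'a). \<eta> (t - s)"
  let ?S = "riemann_sum t ?H"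
  have H4: "expectation (\<lambda>\<omega>. ?H s \<omega> ^ 4) \<le> B ^ 4" if "s \<in> {0..t}" for s
  proof -
    have "\<bar>\<eta> (t - s)\<bar> ^ 4 \<le> B ^ 4" using B[of "t - s"] that by (intro power_mono) auto
    then show ?thesis by (simp add: prob_space)
  qed
  have R: "L4 (?S n)" "expectation (\<lambda>\<omega>. (?S n \<omega>)\<^sup>2)
      = (\<Sum>j<Suc n. t / real (Suc n) * expectation (\<lambda>\<omega>. (?H (grid t n j) \<omega>)\<^sup>2))"
    "expectation (\<lambda>\<omega>. ?S n \<omega> ^ 4) \<le> B ^ 4 * moment_const t" for n
    by (rule riemann_sum_moments[OF t _ _ H4]; simp)+
  have cont\<eta>: "continuous_on UNIV \<eta>" by (rule DERIV_continuous_on[OF \<eta>])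
  have ct: "continuous_on {0..t} (\<lambda>s. f (t - s))" if "continuous_on UNIV f" for f :: "real \<Rightarrow> real"
    by (rule continuous_on_compose2[OF that]) (auto intro!: continuous_intros)
  have wcont: "continuous_on {0..t} (\<lambda>s. w s \<omega>)" if "\<omega> \<in> space M" for \<omega>
    using brownian that unfolding brownian_motion_def continuous_paths_on_def
    by (auto intro: continuous_on_subset)
  have w0: "AE \<omega> in M. w 0 \<omega> = 0" using brownian by (simp add: brownian_motion_def)
  have lim: "AE \<omega> in M. (\<lambda>n. ?S n \<omega>) \<longlonglongrightarrow> X \<omega>"
    using X(2) w0 AE_space
  proof eventually_elim
    case (elim \<omega>)
    let ?h = "\<lambda>s. \<eta> (t - s)"
    have lin: "((\<lambda>s. t - s) has_real_derivative - 1) (at x within S)" for x S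
      by (auto intro!: derivative_eq_intros)
    have "(\<lambda>n. \<Sum>j<Suc n. w (grid t n (Suc j)) \<omega> * (?h (grid t n (Suc j)) - ?h (grid t n j)))
        \<longlonglongrightarrow> (LINT s:{0..t}|lborel. w s \<omega> * - \<eta>' (t - s))"
    proof (rule stieltjes_sum_tendsto[OF t wcont[OF elim(3)], where \<tau> = "\<lambda>n j. grid t n (Suc j)"])
      show "continuous_on {0..t} (\<lambda>s. - \<eta>' (t - s))" by (intro continuous_on_minus ct \<eta>')
      show "(?h has_real_derivative - \<eta>' (t - x)) (at x within {0..t})" for x
        using DERIV_chain2[OF \<eta> lin] by simp
    qed (use t in \<open>auto intro!: grid_mono\<close>)
    then have "(\<lambda>n. ?h t * w t \<omega> - (\<Sum>j<Suc n. w (grid t n (Suc j)) \<omega> * (?h (grid t n (Suc j)) - ?h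
        (grid t n j))))
        \<longlonglongrightarrow> ?h t * w t \<omega> - (LINT s:{0..t}|lborel. w s \<omega> * - \<eta>' (t - s))"
      by (intro tendsto_intros)
    moreover have "?h t * w t \<omega> - (\<Sum>j<Suc n. w (grid t n (Suc j)) \<omega> * (?h (grid t n (Suc j)) - ?h
        (grid t n j)))
        = ?S n \<omega>" for n
    proof -
      have "(\<Sum>j<Suc n. ?h (grid t n (Suc j)) * w (grid t n (Suc j)) \<omega> - ?h (grid t n j) * w (grid t
          n j) \<omega>)
          = ?h t * w t \<omega>"
        by (subst sum_lessThan_telescope[of "\<lambda>j. ?h (grid t n j) * w (grid t n j) \<omega>"
            "Suc n"]) (simp add: elim(2))
      then have "?h t * w t \<omega> - (\<Sum>j<Suc n. w (grid t n (Suc j)) \<omega> * (?h (grid t n (Suc j)) - ?h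
          (grid t n j)))
        = (\<Sum>j<Suc n. (?h (grid t n (Suc j)) * w (grid t n (Suc j)) \<omega> - ?h (grid t n j) * w (grid t n j) \<omega>)
            - w (grid t n (Suc j)) \<omega> * (?h (grid t n (Suc j)) - ?h (grid t n j)))"
        by (simp only: sum_subtractf)
      also have "\<dots> = ?S n \<omega>"
        unfolding riemann_sum_def wsum_def incr_def by (intro sum.cong refl) (simp add: algebra_simps)
      finally show ?thesis .
    qed
    moreover have "?h t * w t \<omega> - (LINT s:{0..t}|lborel. w s \<omega> * - \<eta>' (t - s)) = X \<omega>"
      by (simp add: elim(1) set_lebesgue_integral_def)
    ultimately show ?case by (simp only:)
  qed
  have lim2: "AE \<omega> in M. (\<lambda>n. (?S n \<omega>)\<^sup>2) \<longlonglongrightarrow> (X \<omega>)\<^sup>2"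
    using lim by eventually_elim (intro tendsto_intros)
  have S2m: "(\<lambda>\<omega>. (?S n \<omega>)\<^sup>2) \<in> borel_measurable M" "(\<lambda>\<omega>. (X \<omega>)\<^sup>2) \<in> borel_measurable M" for n
    using L4_measurable[OF R(1)[of n]] X(1) by auto
  have S4: "integrable M (\<lambda>\<omega>. ((?S n \<omega>)\<^sup>2)\<^sup>2)" "expectation (\<lambda>\<omega>. ((?S n \<omega>)\<^sup>2)\<^sup>2)
      \<le> B ^ 4 * moment_const t" for n
    using L4_integrable_4[OF R(1)[of n]] R(3)[of n] by (simp_all add: power_mult[symmetric])
  note l = limit_second_moment[OF S2m S4 lim2]
  show "L4 X" "expectation (\<lambda>\<omega>. X \<omega> ^ 4) \<le> B ^ 4 * moment_const t"
    using l(1,2) X(1) by (simp_all add: L4_def power_mult[symmetric])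
  have "(\<lambda>n. \<Sum>j<Suc n. t / real (Suc n) * (\<eta> (t - grid t n j))\<^sup>2) \<longlonglongrightarrow> (LINT s:{0..t}|lborel. (\<eta> (t - s))\<^sup>2)"
    by (rule riemann_sum_tendsto[OF t]) (intro continuous_intros ct cont\<eta>)
  moreover have "(LINT s:{0..t}|lborel. (\<eta> (t - s))\<^sup>2) = - E (t - t) - - E (t - 0)"
  proof (rule set_lebesgue_integral_eq_diff[OF t])
    show "continuous_on {0..t} (\<lambda>s. (\<eta> (t - s))\<^sup>2)" by (intro continuous_intros ct cont\<eta>)
    have lin: "((\<lambda>s. t - s) has_real_derivative - 1) (at x within S)" for x S
      by (auto intro!: derivative_eq_intros)
    show "((\<lambda>s. - E (t - s)) has_real_derivative (\<eta> (t - x))\<^sup>2) (at x within {0..t})" for x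
      using DERIV_minus[OF DERIV_chain2[OF E lin]] by simp
  qed
  ultimately have "(\<lambda>n. expectation (\<lambda>\<omega>. (?S n \<omega>)\<^sup>2)) \<longlonglongrightarrow> E t - E 0"
    unfolding R(2) by (simp add: prob_space del: sum.lessThan_Suc)
  then show "expectation (\<lambda>\<omega>. (X \<omega>)\<^sup>2) = E t - E 0" by (rule LIMSEQ_unique[OF l(4)])
  fix N :: "'b measure" and p
  assume f: "\<And>s. 0 \<le> s \<Longrightarrow> factors_through M N p (w s)"
  have "factors_through M N p (?S n)" for n
    unfolding riemann_sum_def wsum_def[abs_def] incr_def
    using grid_mem[OF t, of _ n]
    by (intro factors_through_sum factors_through_mult factors_through_diff f factors_through_const) auto
  then show "factors_through M N p X" by (rule factors_through_limit[OF _ lim])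
qed

end

section \<open>A single Fourier mode\<close>

lemma moment_const_mono: "0 \<le> s \<Longrightarrow> s \<le> t \<Longrightarrow> moment_const s \<le> moment_const t"
  unfolding moment_const_def by (intro mult_mono) auto

lemma moment_const_nonneg: "0 \<le> t \<Longrightarrow> 0 \<le> moment_const t"
  unfolding moment_const_def by simp

text \<open>
  One Fourier mode, in terms of its frequency \<open>l\<close> and damping \<open>b\<close>: for the mode number \<open>k\<close> one has
  \<open>l\<^sup>2 + b\<^sup>2 = \<theta>\<^sub>1 k\<^sup>2\<close> and \<open>- 2 b = \<theta>\<^sub>2\<close>.
\<close>

locale wave_mode = brownian_basis M F w
  for M :: "'a measure" and F :: "real \<Rightarrow> 'a measure" and w +
  fixes T b l :: real and u v :: "real \<Rightarrow> 'a \<Rightarrow> real"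
  assumes T_pos: "0 < T" and l_pos: "0 < l" and b_le_1: "\<bar>b\<bar> \<le> 1"
    and adapted: "adapted_on F {0..T} u" "adapted_on F {0..T} v"
    and paths: "continuous_paths_on M {0..T} u" "continuous_paths_on M {0..T} v"
    and equations: "AE \<omega> in M. \<forall>t\<in>{0..T}. u t \<omega> = (LINT s:{0..t}|lborel. v s \<omega>) \<and>
      v t \<omega> = - (l\<^sup>2 + b\<^sup>2) * (LINT s:{0..t}|lborel. u s \<omega>)
          + (- 2 * b) * (LINT s:{0..t}|lborel. v s \<omega>) + w t \<omega>"
begin

lemma uv_measurable_F: "t \<in> {0..T} \<Longrightarrow> u t \<in> borel_measurable (F t)" "t \<in> {0..T}
    \<Longrightarrow> v t \<in> borel_measurable (F t)"
  using adapted by (auto simp: adapted_on_def)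

lemma uv_measurable: "t \<in> {0..T} \<Longrightarrow> u t \<in> borel_measurable M" "t \<in> {0..T} \<Longrightarrow> v t \<in> borel_measurable M"
  using uv_measurable_F measurable_F_M by blast+

lemma uv_continuous:
  "\<omega> \<in> space M \<Longrightarrow> continuous_on {0..T} (\<lambda>t. u t \<omega>)" "\<omega> \<in> space M \<Longrightarrow> continuous_on {0..T} (\<lambda>t. v t \<omega>)"
  using paths by (auto simp: continuous_paths_on_def)

lemma w_continuous: "\<omega> \<in> space M \<Longrightarrow> continuous_on {0..T} (\<lambda>t. w t \<omega>)"
  using brownian unfolding brownian_motion_def continuous_paths_on_def by (auto intro:
      continuous_on_subset)

text \<open>
  The duality with the displacement kernel and with its derivative.
\<close>

lemma kernel_representation:
  "AE \<omega> in M. \<forall>t\<in>{0..T}.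
     u t \<omega> = displacement_kernel b l 0 * w t \<omega>
         + (LINT s:{0..t}|lborel. w s \<omega> * velocity_kernel b l (t - s)) \<and>
     v t \<omega> = velocity_kernel b l 0 * w t \<omega> + (LINT s:{0..t}|lborel. w s \<omega> *
       (- (l\<^sup>2 + b\<^sup>2) * displacement_kernel b l (t - s) + (- 2 * b) * velocity_kernel b l (t - s)))"
  using equations AE_space
proof eventually_elim
  case (elim \<omega>)
  have l0: "l \<noteq> 0" using l_pos by simp
  note c = uv_continuous[OF elim(2)] w_continuous[OF elim(2)]
  show ?case
  proof
    fix t assume t: "t \<in> {0..T}"
    have e: "u t \<omega> = (LINT s:{0..t}|lborel. v s \<omega>)"
      "v t \<omega> = - (l\<^sup>2 + b\<^sup>2) * (LINT s:{0..t}|lborel. u s \<omega>)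
          + (- 2 * b) * (LINT s:{0..t}|lborel. v s \<omega>) + w t \<omega>"
      if "t \<in> {0..T}" for t using elim(1) that by blast+
    note d = damped_oscillator_duality[where u = "\<lambda>t. u t \<omega>" and v = "\<lambda>t. v t \<omega>" and w
        = "\<lambda>t. w t \<omega>", OF c e]
    show "u t \<omega> = displacement_kernel b l 0 * w t \<omega>
        + (LINT s:{0..t}|lborel. w s \<omega> * velocity_kernel b l (t - s)) \<and>
     v t \<omega> = velocity_kernel b l 0 * w t \<omega> + (LINT s:{0..t}|lborel. w s \<omega> *
       (- (l\<^sup>2 + b\<^sup>2) * displacement_kernel b l (t - s) + (- 2 * b) * velocity_kernel b l (t - s)))"
      using d[OF _ _ displacement_kernel_deriv[OF l0] velocity_kernel_deriv[OF l0] t]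
        d[OF _ _ velocity_kernel_deriv[OF l0] velocity_kernel_deriv2[OF l0] t]
      by (simp add: kernel_0)
  qed
qed

abbreviation u_bound where "u_bound \<equiv> exp T / l"
abbreviation v_bound where "v_bound \<equiv> exp T * (1 + \<bar>b\<bar> / l)"

lemma u_moments:
  assumes t: "t \<in> {0..T}"
  shows "L4 (u t)" and "expectation (\<lambda>\<omega>. (u t \<omega>)\<^sup>2) = displacement_variance b l t"
    and "expectation (\<lambda>\<omega>. u t \<omega> ^ 4) \<le> u_bound ^ 4 * moment_const T"
    and "\<And>N p. (\<And>s. 0 \<le> s \<Longrightarrow> factors_through M N p (w s)) \<Longrightarrow> factors_through M N p (u t)"
proof -
  have l0: "l \<noteq> 0" using l_pos by simp
  have t0: "0 \<le> t" using t by simp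
  have c: "continuous_on UNIV (velocity_kernel b l)" by (rule DERIV_continuous_on[OF
      velocity_kernel_deriv[OF l0]])
  have B: "\<bar>displacement_kernel b l x\<bar> \<le> u_bound" if "x \<in> {0..t}" for x
    using kernel_bounds(1)[OF l_pos, of x T b] that t b_le_1 by auto
  have rep: "AE \<omega> in M. u t \<omega>
      = displacement_kernel b l 0 * w t \<omega> + (LINT s:{0..t}|lborel. w s \<omega> * velocity_kernel b l (t - s))"
    using kernel_representation by eventually_elim (use t in blast)
  note W = wiener_integral_moments[OF t0 displacement_kernel_deriv[OF l0] c B
      displacement_variance_deriv[OF l0] uv_measurable(1)[OF t] rep]
  show "L4 (u t)" and "expectation (\<lambda>\<omega>. (u t \<omega>)\<^sup>2) = displacement_variance b l t"
    using W(1,2) by (simp_all add: displacement_variance_0)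
  show "expectation (\<lambda>\<omega>. u t \<omega> ^ 4) \<le> u_bound ^ 4 * moment_const T"
  proof -
    have "moment_const t \<le> moment_const T" using t by (intro moment_const_mono) auto
    then show ?thesis by (intro order_trans[OF W(3)] mult_left_mono) auto
  qed
  show "factors_through M N p (u t)" if "\<And>s. 0 \<le> s
      \<Longrightarrow> factors_through M N p (w s)" for N :: "'b measure" and p
    by (rule W(4)) (use that in auto)
qed

lemma v_moments:
  assumes t: "t \<in> {0..T}"
  shows "L4 (v t)" and "expectation (\<lambda>\<omega>. (v t \<omega>)\<^sup>2) = velocity_variance b l t"
    and "expectation (\<lambda>\<omega>. v t \<omega> ^ 4) \<le> v_bound ^ 4 * moment_const T"
    and "\<And>N p. (\<And>s. 0 \<le> s \<Longrightarrow> factors_through M N p (w s)) \<Longrightarrow> factors_through M N p (v t)"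
proof -
  have l0: "l \<noteq> 0" using l_pos by simp
  have t0: "0 \<le> t" using t by simp
  have c: "continuous_on UNIV (\<lambda>x. - (l\<^sup>2 + b\<^sup>2) * displacement_kernel b l x
      + (- 2 * b) * velocity_kernel b l x)"
    by (rule DERIV_continuous_on[OF velocity_kernel_deriv2[OF l0]])
  have B: "\<bar>velocity_kernel b l x\<bar> \<le> v_bound" if "x \<in> {0..t}" for x
    using kernel_bounds(2)[OF l_pos, of x T b] that t b_le_1 by auto
  have rep: "AE \<omega> in M. v t \<omega> = velocity_kernel b l 0 * w t \<omega> + (LINT s:{0..t}|lborel. w s \<omega> *
       (- (l\<^sup>2 + b\<^sup>2) * displacement_kernel b l (t - s) + (- 2 * b) * velocity_kernel b l (t - s)))"
    using kernel_representation by eventually_elim (use t in blast)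
  note W = wiener_integral_moments[OF t0 velocity_kernel_deriv[OF l0] c B velocity_variance_deriv[OF
      l0] uv_measurable(2)[OF t] rep]
  show "L4 (v t)" and "expectation (\<lambda>\<omega>. (v t \<omega>)\<^sup>2) = velocity_variance b l t"
    using W(1,2) by (simp_all add: displacement_variance_0)
  show "expectation (\<lambda>\<omega>. v t \<omega> ^ 4) \<le> v_bound ^ 4 * moment_const T"
  proof -
    have "moment_const t \<le> moment_const T" using t by (intro moment_const_mono) auto
    then show ?thesis by (intro order_trans[OF W(3)] mult_left_mono) auto
  qed
  show "factors_through M N p (v t)" if "\<And>s. 0 \<le> s
      \<Longrightarrow> factors_through M N p (w s)" for N :: "'b measure" and p
    by (rule W(4)) (use that in auto)
qed

lemma variances_continuous:
  "continuous_on S (displacement_variance b l)" "continuous_on S (velocity_variance b l)"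
proof -
  have l0: "l \<noteq> 0" using l_pos by simp
  show "continuous_on S (displacement_variance b l)" "continuous_on S (velocity_variance b l)"
    using DERIV_continuous_on[of UNIV, OF displacement_variance_deriv[OF l0]]
      DERIV_continuous_on[of UNIV, OF velocity_variance_deriv[OF l0]]
    by (auto intro: continuous_on_subset)
qed

lemmas u_square_integral = square_integral_moments[OF less_imp_le[OF T_pos] u_moments(1)
    u_moments(3) u_moments(2)
    variances_continuous(1) uv_continuous(1)]
lemmas v_square_integral = square_integral_moments[OF less_imp_le[OF T_pos] v_moments(1)
    v_moments(3) v_moments(2)
    variances_continuous(2) uv_continuous(2)]

lemma variances_bounded:
  obtains B where "\<And>t. t \<in> {0..T} \<Longrightarrow> displacement_variance b l t \<le> B" "\<And>t. t \<in> {0..T}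
      \<Longrightarrow> velocity_variance b l t \<le> B"
proof -
  have "bounded (displacement_variance b l ` {0..T} \<union> velocity_variance b l ` {0..T})"
    by (intro bounded_Un[THEN iffD2] conjI compact_imp_bounded compact_continuous_image
        variances_continuous compact_Icc)
  then obtain B where B: "\<And>x. x
      \<in> displacement_variance b l ` {0..T} \<union> velocity_variance b l ` {0..T} \<Longrightarrow> norm x \<le> B"
    by (auto simp: bounded_iff)
  show thesis
  proof (rule that[of B])
    fix t assume "t \<in> {0..T}"
    then show "displacement_variance b l t \<le> B" "velocity_variance b l t \<le> B"
      using B[of "displacement_variance b l t"] B[of "velocity_variance b l t"] by auto
  qed
qed

text \<open>
  The displacement is the integral of the velocity, and the velocity is a Brownian motion plus the
  integral of a process with bounded second moments; integrals contribute \<open>O((t - s)\<^sup>2)\<close> and the Brownian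
  increment contributes \<open>t - s\<close>.
\<close>

lemma increment_bound:
  obtains C where
    "\<And>s t. 0 \<le> s \<Longrightarrow> s \<le> t \<Longrightarrow> t \<le> T \<Longrightarrow> expectation (\<lambda>\<omega>. (u t \<omega> - u s \<omega>)\<^sup>2) \<le> C * (t - s)"
    "\<And>s t. 0 \<le> s \<Longrightarrow> s \<le> t \<Longrightarrow> t \<le> T \<Longrightarrow> expectation (\<lambda>\<omega>. (v t \<omega> - v s \<omega>)\<^sup>2) \<le> C * (t - s)"
proof -
  obtain B where B: "\<And>t. t \<in> {0..T} \<Longrightarrow> displacement_variance b l t \<le> B" "\<And>t. t \<in> {0..T}
      \<Longrightarrow> velocity_variance b l t \<le> B"
    by (rule variances_bounded) blast
  have B0: "0 \<le> B" using B(1)[of 0] T_pos by (simp add: displacement_variance_0)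
  define m where "m t \<omega> = - (l\<^sup>2 + b\<^sup>2) * u t \<omega> + (- 2 * b) * v t \<omega>" for t \<omega>
  define Bm where "Bm = 2 * (l\<^sup>2 + b\<^sup>2)\<^sup>2 * B + 2 * (2 * b)\<^sup>2 * B"
  have Bm0: "0 \<le> Bm" using B0 by (simp add: Bm_def)
  have mm: "m t \<in> borel_measurable M" if "t \<in> {0..T}" for t
    unfolding m_def[abs_def] using uv_measurable[OF that] by simp
  have msq: "(m t \<omega>)\<^sup>2 \<le> 2 * (l\<^sup>2 + b\<^sup>2)\<^sup>2 * (u t \<omega>)\<^sup>2 + 2 * (2 * b)\<^sup>2 * (v t \<omega>)\<^sup>2" for t \<omega>
  proof -
    show ?thesis
      using square_add_le[of "- (l\<^sup>2 + b\<^sup>2) * u t \<omega>" "(- 2 * b) * v t \<omega>"]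
      unfolding m_def by (simp only: power_mult_distrib power2_minus mult.assoc)
  qed
  have i0: "integrable M (\<lambda>\<omega>. 2 * (l\<^sup>2 + b\<^sup>2)\<^sup>2 * (u t \<omega>)\<^sup>2 + 2 * (2 * b)\<^sup>2 * (v t \<omega>)\<^sup>2)" if "t \<in> {0..T}" for t
    using L4_integrable_2[OF u_moments(1)[OF that]] L4_integrable_2[OF v_moments(1)[OF that]] by simp
  have im: "integrable M (\<lambda>\<omega>. (m t \<omega>)\<^sup>2)" if "t \<in> {0..T}" for t
  proof (rule Bochner_Integration.integrable_bound[OF i0[OF that]])
    show "(\<lambda>\<omega>. (m t \<omega>)\<^sup>2) \<in> borel_measurable M" using mm[OF that] by simp
  qed (use order_trans[OF msq abs_ge_self] in \<open>simp only: real_norm_def abs_power2 AE_I2\<close>)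
  have Em: "expectation (\<lambda>\<omega>. (m t \<omega>)\<^sup>2) \<le> Bm" if t: "t \<in> {0..T}" for t
  proof -
    have "expectation (\<lambda>\<omega>. (m t \<omega>)\<^sup>2)
        \<le> expectation (\<lambda>\<omega>. 2 * (l\<^sup>2 + b\<^sup>2)\<^sup>2 * (u t \<omega>)\<^sup>2 + 2 * (2 * b)\<^sup>2 * (v t \<omega>)\<^sup>2)"
      by (rule integral_mono[OF im[OF t] i0[OF t] msq])
    also have "\<dots> = 2 * (l\<^sup>2 + b\<^sup>2)\<^sup>2 * displacement_variance b l t + 2 * (2 * b)\<^sup>2 * velocity_variance b l t"
      using L4_integrable_2[OF u_moments(1)[OF t]] L4_integrable_2[OF v_moments(1)[OF t]]
      by (simp add: u_moments(2)[OF t] v_moments(2)[OF t])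
    also have "\<dots> \<le> Bm" unfolding Bm_def using B[OF t] by (intro add_mono mult_left_mono) auto
    finally show ?thesis .
  qed
  have sq: "(t - s)\<^sup>2 * x \<le> (T * x) * (t - s)" if "0 \<le> s" "s \<le> t" "t \<le> T" "0 \<le> x" for s t x
  proof -
    have "(t - s) * (t - s) * x \<le> (T * (t - s)) * x" using that by (intro mult_right_mono) auto
    then show ?thesis by (simp add: power2_eq_square mult_ac)
  qed
  show thesis
  proof (rule that[of "T * B + 2 * (T * Bm) + 2"])
    fix s t assume st: "0 \<le> s" "s \<le> t" "t \<le> T"
    then have mem: "s \<in> {0..T}" "t \<in> {0..T}" by auto
    have "expectation (\<lambda>\<omega>. (u t \<omega> - u s \<omega>)\<^sup>2) \<le> (t - s)\<^sup>2 * B"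
    proof (rule integral_square_bound(2)[of T v])
      show "AE \<omega> in M. u t \<omega> - u s \<omega> = (LINT r:{0..t}|lborel. v r \<omega>) - (LINT r:{0..s}|lborel. v r \<omega>)"
        using equations by eventually_elim (use mem in simp)
    qed (use uv_measurable mem st uv_continuous(2) L4_integrable_2[OF v_moments(1)] B(2)
        v_moments(2) in auto)
    also have "\<dots> \<le> (T * B) * (t - s)" by (rule sq[OF st B0])
    also have "\<dots> \<le> (T * B + 2 * (T * Bm) + 2) * (t - s)"
      using T_pos Bm0 st by (intro mult_right_mono) auto
    finally show "expectation (\<lambda>\<omega>. (u t \<omega> - u s \<omega>)\<^sup>2) \<le> (T * B + 2 * (T * Bm) + 2) * (t - s)" .
    define Y where "Y \<omega> = (v t \<omega> - v s \<omega>) - incr s t \<omega>" for \<omega>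
    have Y: "integrable M (\<lambda>\<omega>. (Y \<omega>)\<^sup>2) \<and> expectation (\<lambda>\<omega>. (Y \<omega>)\<^sup>2) \<le> (t - s)\<^sup>2 * Bm"
    proof -
      have Ym: "Y \<in> borel_measurable M"
        unfolding Y_def[abs_def] using uv_measurable(2)[OF mem(1)] uv_measurable(2)[OF mem(2)]
            incr_measurable[OF st(1,2)] by simp
      have cm: "AE \<omega> in M. continuous_on {0..T} (\<lambda>t. m t \<omega>)"
        unfolding m_def by (intro AE_I2 continuous_intros uv_continuous)
      have Yi: "AE \<omega> in M. Y \<omega> = (LINT r:{0..t}|lborel. m r \<omega>) - (LINT r:{0..s}|lborel. m r \<omega>)"
        using equations AE_space
      proof eventually_elim
        case (elim \<omega>)
        have "(LINT r:{0..x}|lborel. m r \<omega>)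
          = - (l\<^sup>2 + b\<^sup>2) * (LINT r:{0..x}|lborel. u r \<omega>) + (- 2 * b) * (LINT r:{0..x}|lborel. v r \<omega>)"
          if "x \<in> {0..T}" for x
        proof -
          have "set_integrable lborel {0..x} (\<lambda>r. u r \<omega>)" "set_integrable lborel {0..x} (\<lambda>r. v r \<omega>)"
            using that by (auto intro!: borel_integrable_atLeastAtMost' continuous_on_subset[OF
                uv_continuous(1)[OF elim(2)]]
                continuous_on_subset[OF uv_continuous(2)[OF elim(2)]])
          then show ?thesis unfolding m_def by (simp add: set_integral_add set_integral_diff)
        qed
        then have i: "(LINT r:{0..x}|lborel. m r \<omega>) = v x \<omega> - w x \<omega>" if "x \<in> {0..T}" for x
          using elim(1) that by simp
        show ?case using i[OF mem(1)] i[OF mem(2)] by (simp add: Y_def incr_def)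
      qed
      show ?thesis
        using integral_square_bound[OF mm im Em cm st Ym Yi] by blast
    qed
    have i1: "integrable M (\<lambda>\<omega>. 2 * (Y \<omega>)\<^sup>2 + 2 * (incr s t \<omega>)\<^sup>2)"
      using Y incr_moments(1)[OF st(1,2), of 2] by simp
    have le: "(v t \<omega> - v s \<omega>)\<^sup>2 \<le> 2 * (Y \<omega>)\<^sup>2 + 2 * (incr s t \<omega>)\<^sup>2" for \<omega>
    proof -
      show ?thesis using square_add_le[of "Y \<omega>" "incr s t \<omega>"] by (simp add: Y_def)
    qed
    have i2: "integrable M (\<lambda>\<omega>. (v t \<omega> - v s \<omega>)\<^sup>2)"
    proof (rule Bochner_Integration.integrable_bound[OF i1])
      show "(\<lambda>\<omega>. (v t \<omega> - v s \<omega>)\<^sup>2) \<in> borel_measurable M"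
        using uv_measurable(2)[OF mem(1)] uv_measurable(2)[OF mem(2)] by simp
    qed (use order_trans[OF le abs_ge_self] in \<open>simp only: real_norm_def abs_power2 AE_I2\<close>)
    have "expectation (\<lambda>\<omega>. (v t \<omega> - v s \<omega>)\<^sup>2) \<le> expectation (\<lambda>\<omega>. 2 * (Y \<omega>)\<^sup>2 + 2 * (incr s t \<omega>)\<^sup>2)"
      by (rule integral_mono[OF i2 i1 le])
    also have "\<dots> = 2 * expectation (\<lambda>\<omega>. (Y \<omega>)\<^sup>2) + 2 * (t - s)"
      using Y incr_moments(1)[OF st(1,2), of 2] incr_moments(3)[OF st(1,2)] by simp
    also have "\<dots> \<le> 2 * ((T * Bm) * (t - s)) + 2 * (t - s)"
      using Y sq[OF st Bm0] by linarith
    also have "\<dots> = (2 * (T * Bm) + 2) * (t - s)" by (simp add: algebra_simps)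
    also have "\<dots> \<le> (T * B + 2 * (T * Bm) + 2) * (t - s)"
      using T_pos B0 st by (intro mult_right_mono) auto
    finally show "expectation (\<lambda>\<omega>. (v t \<omega> - v s \<omega>)\<^sup>2) \<le> (T * B + 2 * (T * Bm) + 2) * (t - s)" .
  qed
qed

lemma ito_integral_u:
  assumes ito: "has_ito_integral M F w T u L"
  shows "L4 L" and "expectation L = 0"
    and "expectation (\<lambda>\<omega>. (L \<omega>)\<^sup>2) = (LINT t:{0..T}|lborel. displacement_variance b l t)"
    and "expectation (\<lambda>\<omega>. L \<omega> ^ 4) \<le> u_bound ^ 4 * moment_const T * moment_const T"
    and "\<And>N p. (\<And>s. 0 \<le> s \<Longrightarrow> factors_through M N p (w s)) \<Longrightarrow> factors_through M N p L"
proof -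
  obtain C where C: "\<And>s t. 0 \<le> s \<Longrightarrow> s \<le> t \<Longrightarrow> t \<le> T \<Longrightarrow> expectation (\<lambda>\<omega>. (u t \<omega> - u s \<omega>)\<^sup>2) \<le> C * (t - s)"
    by (rule increment_bound) blast
  have "(\<lambda>n. \<Sum>j<Suc n. T / real (Suc n) * expectation (\<lambda>\<omega>. (u (grid T n j) \<omega>)\<^sup>2))
     = (\<lambda>n. \<Sum>j<Suc n. T / real (Suc n) * displacement_variance b l (grid T n j))"
    using grid_mem[of T] T_pos by (intro ext sum.cong refl) (subst u_moments(2); force)
  then have var: "(\<lambda>n. \<Sum>j<Suc n. T / real (Suc n) * expectation (\<lambda>\<omega>. (u (grid T n j) \<omega>)\<^sup>2))
     \<longlonglongrightarrow> (LINT t:{0..T}|lborel. displacement_variance b l t)"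
    using riemann_sum_tendsto[OF less_imp_le[OF T_pos] variances_continuous(1)] by (simp only:)
  note I = ito_integral_moments[OF T_pos ito L4_integrable_4[OF u_moments(1)] u_moments(3) C var]
  show "L4 L" "expectation L = 0" "expectation (\<lambda>\<omega>. (L \<omega>)\<^sup>2)
      = (LINT t:{0..T}|lborel. displacement_variance b l t)"
    "expectation (\<lambda>\<omega>. L \<omega> ^ 4) \<le> u_bound ^ 4 * moment_const T * moment_const T"
    by (rule I; assumption)+
  show "factors_through M N p L" if "\<And>s. 0 \<le> s \<Longrightarrow> factors_through M N p (w s)" for N :: "'b measure" and p
    by (rule I(5)) (use that u_moments(4) in auto)
qed

lemma ito_integral_v:
  assumes ito: "has_ito_integral M F w T v L"
  shows "L4 L" and "expectation L = 0"
    and "expectation (\<lambda>\<omega>. (L \<omega>)\<^sup>2) = (LINT t:{0..T}|lborel. velocity_variance b l t)"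
    and "expectation (\<lambda>\<omega>. L \<omega> ^ 4) \<le> v_bound ^ 4 * moment_const T * moment_const T"
    and "\<And>N p. (\<And>s. 0 \<le> s \<Longrightarrow> factors_through M N p (w s)) \<Longrightarrow> factors_through M N p L"
proof -
  obtain C where C: "\<And>s t. 0 \<le> s \<Longrightarrow> s \<le> t \<Longrightarrow> t \<le> T \<Longrightarrow> expectation (\<lambda>\<omega>. (v t \<omega> - v s \<omega>)\<^sup>2) \<le> C * (t - s)"
    by (rule increment_bound) blast
  have "(\<lambda>n. \<Sum>j<Suc n. T / real (Suc n) * expectation (\<lambda>\<omega>. (v (grid T n j) \<omega>)\<^sup>2))
     = (\<lambda>n. \<Sum>j<Suc n. T / real (Suc n) * velocity_variance b l (grid T n j))"
    using grid_mem[of T] T_pos by (intro ext sum.cong refl) (subst v_moments(2); force)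
  then have var: "(\<lambda>n. \<Sum>j<Suc n. T / real (Suc n) * expectation (\<lambda>\<omega>. (v (grid T n j) \<omega>)\<^sup>2))
     \<longlonglongrightarrow> (LINT t:{0..T}|lborel. velocity_variance b l t)"
    using riemann_sum_tendsto[OF less_imp_le[OF T_pos] variances_continuous(2)] by (simp only:)
  note I = ito_integral_moments[OF T_pos ito L4_integrable_4[OF v_moments(1)] v_moments(3) C var]
  show "L4 L" "expectation L = 0" "expectation (\<lambda>\<omega>. (L \<omega>)\<^sup>2)
      = (LINT t:{0..T}|lborel. velocity_variance b l t)"
    "expectation (\<lambda>\<omega>. L \<omega> ^ 4) \<le> v_bound ^ 4 * moment_const T * moment_const T"
    by (rule I; assumption)+
  show "factors_through M N p L" if "\<And>s. 0 \<le> s \<Longrightarrow> factors_through M N p (w s)" for N :: "'b measure" and p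
    by (rule I(5)) (use that v_moments(4) in auto)
qed

text \<open>
  \<open>v\<close> is the derivative of \<open>u\<close>, and \<open>u\<close> starts at 0.
\<close>

lemma integral_u_times_v:
  "AE \<omega> in M. (LINT t:{0..T}|lborel. u t \<omega> * v t \<omega>) = (u T \<omega>)\<^sup>2 / 2"
  using equations AE_space
proof eventually_elim
  case (elim \<omega>)
  note c = uv_continuous[OF elim(2)]
  have du: "((\<lambda>t. u t \<omega>) has_real_derivative v x \<omega>) (at x within {0..T})" if "x \<in> {0..T}" for x
    by (rule has_field_derivative_transform_within[OF set_lebesgue_integral_has_derivative[OF c(2)
        that] zero_less_one that])
       (use elim(1) in simp)
  have "(LINT t:{0..T}|lborel. u t \<omega> * v t \<omega>) = (u T \<omega>)\<^sup>2 / 2 - (u 0 \<omega>)\<^sup>2 / 2"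
  proof (rule set_lebesgue_integral_eq_diff)
    show "continuous_on {0..T} (\<lambda>t. u t \<omega> * v t \<omega>)" by (intro continuous_on_mult c)
    show "((\<lambda>t. (u t \<omega>)\<^sup>2 / 2) has_real_derivative u x \<omega> * v x \<omega>) (at x within {0..T})" if "x
        \<in> {0..T}" for x
      unfolding power2_eq_square
      by (rule DERIV_cong[OF DERIV_cdivide[OF DERIV_mult[OF du[OF that] du[OF that]], of 2]]) simp
  qed (use T_pos in simp)
  moreover have "u 0 \<omega> = 0" using elim(1) T_pos set_lebesgue_integral_Icc_self[of 0] by simp
  ultimately show ?case by simp
qed

text \<open>
  The integral against \<open>dv\<close> is defined through some drift of \<open>v\<close>. Its indefinite integral is that of the
  drift of the equation, so the two drifts agree for almost all times.
\<close>

lemma ito_process_integral_decomposition: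
  assumes int: "has_ito_process_integral M F w T v H K"
    and cont: "\<And>\<omega>. \<omega> \<in> space M \<Longrightarrow> continuous_on {0..T} (\<lambda>t. H t \<omega>)"
  obtains L where "has_ito_integral M F w T H L"
    "AE \<omega> in M. K \<omega> = - (l\<^sup>2 + b\<^sup>2) * (LINT t:{0..T}|lborel. H t \<omega> * u t \<omega>)
       + (- 2 * b) * (LINT t:{0..T}|lborel. H t \<omega> * v t \<omega>) + L \<omega>"
proof -
  obtain \<mu> L where ito: "ito_process M F w T \<mu> v" "has_ito_integral M F w T H L"
    and H\<mu>: "AE \<omega> in M. set_integrable lborel {0..T} (\<lambda>t. H t \<omega> * \<mu> t \<omega>)"
    and K: "AE \<omega> in M. K \<omega> = (LINT t:{0..T}|lborel. H t \<omega> * \<mu> t \<omega>) + L \<omega>"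
    using int unfolding has_ito_process_integral_def by blast
  have \<mu>: "AE \<omega> in M. set_integrable lborel {0..T} (\<lambda>t. \<mu> t \<omega>)"
    "AE \<omega> in M. \<forall>t\<in>{0..T}. v t \<omega> = v 0 \<omega> + (LINT s:{0..t}|lborel. \<mu> s \<omega>) + (w t \<omega> - w 0 \<omega>)"
    using ito(1) unfolding ito_process_def by blast+
  have "AE \<omega> in M. K \<omega> = - (l\<^sup>2 + b\<^sup>2) * (LINT t:{0..T}|lborel. H t \<omega> * u t \<omega>)
       + (- 2 * b) * (LINT t:{0..T}|lborel. H t \<omega> * v t \<omega>) + L \<omega>"
    using equations \<mu> H\<mu> K AE_space
  proof eventually_elim
    case (elim \<omega>)
    note c = uv_continuous[OF elim(6)] cont[OF elim(6)]
    define m where "m t = - (l\<^sup>2 + b\<^sup>2) * u t \<omega> + (- 2 * b) * v t \<omega>" for t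
    have cm: "continuous_on {0..T} m" unfolding m_def by (intro continuous_intros c)
    have ae: "AE t in lborel. t \<in> {0..T} \<longrightarrow> \<mu> t \<omega> = m t"
    proof (rule AE_eq_of_indefinite_integral_eq[OF elim(2) borel_integrable_atLeastAtMost'[OF cm]])
      fix t assume t: "t \<in> {0..T}"
      have "set_integrable lborel {0..t} (\<lambda>r. u r \<omega>)" "set_integrable lborel {0..t} (\<lambda>r. v r \<omega>)"
        using t by (auto intro!: borel_integrable_atLeastAtMost' continuous_on_subset[OF c(1)]
            continuous_on_subset[OF c(2)])
      then have "(LINT r:{0..t}|lborel. m r)
          = - (l\<^sup>2 + b\<^sup>2) * (LINT r:{0..t}|lborel. u r \<omega>) + (- 2 * b) * (LINT r:{0..t}|lborel. v r \<omega>)"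
        unfolding m_def by (simp add: set_integral_add set_integral_diff)
      also have "\<dots> = v t \<omega> - w t \<omega>" using elim(1) t by simp
      also have "\<dots> = (LINT s:{0..t}|lborel. \<mu> s \<omega>) + (v 0 \<omega> - w 0 \<omega>)"
          using bspec[OF elim(3) t] by linarith
      also have "v 0 \<omega> = w 0 \<omega>" using elim(1) T_pos set_lebesgue_integral_Icc_self[of 0] by simp
      finally show "(LINT s:{0..t}|lborel. \<mu> s \<omega>) = (LINT s:{0..t}|lborel. m s)" by simp
    qed
    have Hm: "continuous_on {0..T} (\<lambda>t. H t \<omega> * m t)" by (intro continuous_on_mult c cm)
    have "(LINT t:{0..T}|lborel. H t \<omega> * \<mu> t \<omega>) = (LINT t:{0..T}|lborel. H t \<omega> * m t)"
      unfolding set_lebesgue_integral_def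
    proof (rule integral_cong_AE)
      show "(\<lambda>t. indicator {0..T} t *\<^sub>R (H t \<omega> * \<mu> t \<omega>)) \<in> borel_measurable lborel"
        using elim(4) unfolding set_integrable_def by (rule borel_measurable_integrable)
      show "(\<lambda>t. indicator {0..T} t *\<^sub>R (H t \<omega> * m t)) \<in> borel_measurable lborel"
        using borel_integrable_atLeastAtMost'[OF Hm]
            unfolding set_integrable_def by (rule borel_measurable_integrable)
      show "AE t in lborel. indicator {0..T} t *\<^sub>R (H t \<omega> * \<mu> t \<omega>) = indicator {0..T} t *\<^sub>R (H t \<omega> * m t)"
        using ae by eventually_elim (auto split: split_indicator)
    qed
    also have "\<dots> = (LINT t:{0..T}|lborel. - (l\<^sup>2 + b\<^sup>2) * (H t \<omega> * u t \<omega>) + (- 2 * b) * (H t \<omega> * v t \<omega>))"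
      unfolding m_def by (rule arg_cong[where f = "set_lebesgue_integral lborel {0..T}"])
        (rule ext, simp only: distrib_left mult.left_commute)
    also have "\<dots> = - (l\<^sup>2 + b\<^sup>2) * (LINT t:{0..T}|lborel. H t \<omega> * u t \<omega>)
       + (- 2 * b) * (LINT t:{0..T}|lborel. H t \<omega> * v t \<omega>)"
    proof -
      have "set_integrable lborel {0..T} (\<lambda>t. H t \<omega> * u t \<omega>)"
          "set_integrable lborel {0..T} (\<lambda>t. H t \<omega> * v t \<omega>)"
        by (intro borel_integrable_atLeastAtMost' continuous_on_mult c)+
      then show ?thesis by (simp add: set_integral_add set_integral_diff)
    qed
    finally show ?case using elim(5) by simp
  qed
  with ito(2) show thesis by (rule that)
qed

end

section \<open>High frequency limits\<close>

lemma set_integral_tendsto_uniform: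
  fixes f :: "nat \<Rightarrow> real \<Rightarrow> real"
  assumes T: "0 \<le> T" and f: "\<And>n. continuous_on {0..T} (f n)" and g: "continuous_on {0..T} g"
    and c: "\<forall>\<^sub>F n in sequentially. \<forall>t\<in>{0..T}. \<bar>f n t - g t\<bar> \<le> c n" "c \<longlonglongrightarrow> 0"
  shows "(\<lambda>n. LINT t:{0..T}|lborel. f n t) \<longlonglongrightarrow> (LINT t:{0..T}|lborel. g t)"
proof -
  have "\<forall>\<^sub>F n in sequentially. norm ((LINT t:{0..T}|lborel. f n t) - (LINT t:{0..T}|lborel. g t))
      \<le> c n * T"
    using c(1)
  proof eventually_elim
    case (elim n)
    have cd: "continuous_on {0..T} (\<lambda>t. f n t - g t)" by (intro continuous_intros f g)
    have "(LINT t:{0..T}|lborel. f n t) - (LINT t:{0..T}|lborel. g t)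
        = (LINT t:{0..T}|lborel. f n t - g t)"
      by (intro set_integral_diff(2)[symmetric] borel_integrable_atLeastAtMost' f g)
    also have "\<dots> = integral {0..T} (\<lambda>t. f n t - g t)"
      by (intro set_borel_integral_eq_integral(2) borel_integrable_atLeastAtMost' cd)
    also have "norm \<dots> \<le> c n * (T - 0)"
      by (rule integral_bound[OF T cd]) (use elim in auto)
    finally show ?case by simp
  qed
  moreover have "(\<lambda>n. c n * T) \<longlonglongrightarrow> 0" using tendsto_mult_right[OF c(2), of T] by simp
  ultimately have "(\<lambda>n. (LINT t:{0..T}|lborel. f n t) - (LINT t:{0..T}|lborel. g t)) \<longlonglongrightarrow> 0"
    by (rule Lim_null_comparison)
  then show ?thesis by (simp add: LIM_zero_iff)
qed

text \<open>
  The squared sine and cosine of a high frequency average to \<open>1 / 2\<close>, leaving half of the double integral of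
  \<open>exp (- 2 b r)\<close>; this is where the constant of the theorem comes from. The error is \<open>O(1 / l)\<close>, uniformly on
  \<open>[0,T]\<close>.
\<close>

lemma displacement_variance_integral_tendsto:
  fixes l :: "nat \<Rightarrow> real"
  assumes T: "0 < T" and b: "\<bar>b\<bar> \<le> 1" and l: "\<And>n. 0 < l n" and lim: "filterlim l at_top sequentially"
  shows "(\<lambda>n. (l n)\<^sup>2 * (LINT t:{0..T}|lborel. displacement_variance b (l n) t)) \<longlonglongrightarrow> C_const (- 2 * b) T"
    and "(\<lambda>n. LINT t:{0..T}|lborel. velocity_variance b (l n) t) \<longlonglongrightarrow> C_const (- 2 * b) T"
proof -
  have l0: "l n \<noteq> 0" for n using l[of n] by simp
  have inv: "(\<lambda>n. 1 / l n) \<longlonglongrightarrow> 0"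
    by (rule tendsto_divide_0[OF tendsto_const filterlim_at_top_imp_at_infinity[OF lim]])
  have ce: "continuous_on {0..T} (displacement_variance b (l n))"
      "continuous_on {0..T} (velocity_variance b (l n))"
    "continuous_on {0..T} (displacement_kernel b (l n))"
        "continuous_on {0..T} (velocity_kernel b (l n))" for n
    by (rule continuous_on_subset[OF DERIV_continuous_on[of UNIV], OF displacement_variance_deriv[OF
        l0] subset_UNIV]
        continuous_on_subset[OF DERIV_continuous_on[of UNIV], OF velocity_variance_deriv[OF l0]
            subset_UNIV]
        continuous_on_subset[OF DERIV_continuous_on[of UNIV], OF displacement_kernel_deriv[OF l0]
            subset_UNIV]
        continuous_on_subset[OF DERIV_continuous_on[of UNIV], OF velocity_kernel_deriv[OF l0]
            subset_UNIV])+
  have cp: "continuous_on {0..T} (exp_primitive (- 2 * b))"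
    by (rule DERIV_continuous_on[OF exp_primitive_deriv])
  have P: "(LINT t:{0..T}|lborel. exp_primitive (- 2 * b) t) = 2 * C_const (- 2 * b) T"
    unfolding integral_exp_primitive[OF T, symmetric] by simp
  have "(\<lambda>n. (2 * exp (2 * T) + 2) / 4 * (1 / l n)\<^sup>2 + exp (2 * T) / 2 * (1 / l n))
      \<longlonglongrightarrow> (2 * exp (2 * T) + 2) / 4 * 0\<^sup>2 + exp (2 * T) / 2 * 0"
    by (intro tendsto_intros inv)
  moreover have "(exp (2 * T) * (2 + 2 * l n) + 2) / (4 * (l n)\<^sup>2)
      = (2 * exp (2 * T) + 2) / 4 * (1 / l n)\<^sup>2 + exp (2 * T) / 2 * (1 / l n)" for n
    using l0[of n] by (simp add: field_simps power2_eq_square)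
  ultimately have e0: "(\<lambda>n. (exp (2 * T) * (2 + 2 * l n) + 2) / (4 * (l n)\<^sup>2)) \<longlonglongrightarrow> 0" by simp
  have "(\<lambda>n. LINT t:{0..T}|lborel. 2 * (l n)\<^sup>2 * displacement_variance b (l n) t)
      \<longlonglongrightarrow> 2 * C_const (- 2 * b) T"
    unfolding P[symmetric]
  proof (rule set_integral_tendsto_uniform[OF less_imp_le[OF T] _ cp _ e0])
    show "continuous_on {0..T} (\<lambda>t. 2 * (l n)\<^sup>2 * displacement_variance b (l n) t)" for n
      by (intro continuous_intros ce)
    show "\<forall>\<^sub>F n in sequentially. \<forall>t\<in>{0..T}. \<bar>2 * (l n)\<^sup>2 * displacement_variance b (l n) t -
        exp_primitive (- 2 * b) t\<bar>
        \<le> (exp (2 * T) * (2 + 2 * l n) + 2) / (4 * (l n)\<^sup>2)"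
      using displacement_variance_error[OF b l] by (intro always_eventually) auto
  qed
  then have "(\<lambda>n. (1 / 2) * (2 * (l n)\<^sup>2 * (LINT t:{0..T}|lborel. displacement_variance b (l n) t)))
      \<longlonglongrightarrow> (1 / 2) * (2 * C_const (- 2 * b) T)"
    by (intro tendsto_mult_left) simp
  then show 1: "(\<lambda>n. (l n)\<^sup>2 * (LINT t:{0..T}|lborel. displacement_variance b (l n) t))
      \<longlonglongrightarrow> C_const (- 2 * b) T"
    by simp
  define rest where "rest n t = displacement_kernel b (l n) t * velocity_kernel b (l n) t
      + b * (displacement_kernel b (l n) t)\<^sup>2" for n t
  have cr: "continuous_on {0..T} (rest n)" for n
    unfolding rest_def by (intro continuous_intros ce)
  define B where "B n = (exp T * (1 / l n)) * (exp T * (1 + \<bar>b\<bar> * (1 / l n)))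
      + (exp T * (1 / l n))\<^sup>2" for n
  have "(\<lambda>n. (exp T * (1 / l n)) * (exp T * (1 + \<bar>b\<bar> * (1 / l n))) + (exp T * (1 / l n))\<^sup>2)
      \<longlonglongrightarrow> (exp T * 0) * (exp T * (1 + \<bar>b\<bar> * 0)) + (exp T * 0)\<^sup>2"
    by (intro tendsto_intros inv)
  then have B0: "B \<longlonglongrightarrow> 0" by (simp add: B_def[abs_def])
  have "(\<lambda>n. LINT t:{0..T}|lborel. rest n t) \<longlonglongrightarrow> (LINT t:{0..T}|lborel. 0)"
  proof (rule set_integral_tendsto_uniform[OF less_imp_le[OF T] cr continuous_on_const _ B0])
    have "\<bar>rest n t - 0\<bar> \<le> B n" if t: "t \<in> {0..T}" for n t
    proof -
      have k: "\<bar>displacement_kernel b (l n) t\<bar> \<le> exp T / l n" "\<bar>velocity_kernel b (l n) t\<bar>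
          \<le> exp T * (1 + \<bar>b\<bar> / l n)"
        using kernel_bounds[OF l _ _ b, of t T n] t by auto
      have "\<bar>rest n t\<bar> \<le> \<bar>displacement_kernel b (l n) t\<bar> * \<bar>velocity_kernel b (l n) t\<bar>
          + \<bar>b\<bar> * \<bar>displacement_kernel b (l n) t\<bar>\<^sup>2"
        unfolding rest_def by (rule order_trans[OF abs_triangle_ineq]) (simp add: abs_mult)
      also have "\<dots> \<le> (exp T / l n) * (exp T * (1 + \<bar>b\<bar> / l n)) + 1 * (exp T / l n)\<^sup>2"
        using k b l[of n] by (intro add_mono mult_mono power_mono) auto
      finally show ?thesis by (simp add: B_def)
    qed
    then show "\<forall>\<^sub>F n in sequentially. \<forall>t\<in>{0..T}. \<bar>rest n t - 0\<bar> \<le> B n"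
      by (intro always_eventually) blast
  qed
  then have r0: "(\<lambda>n. LINT t:{0..T}|lborel. rest n t) \<longlonglongrightarrow> 0" by (simp add: set_lebesgue_integral_def)
  have eq: "(LINT t:{0..T}|lborel. velocity_variance b (l n) t)
      = (1 + b\<^sup>2 * (1 / l n)\<^sup>2) * ((l n)\<^sup>2 * (LINT t:{0..T}|lborel. displacement_variance b (l n) t))
        + (LINT t:{0..T}|lborel. rest n t)" for n
  proof -
    have "(LINT t:{0..T}|lborel. velocity_variance b (l n) t)
        = (LINT t:{0..T}|lborel. ((l n)\<^sup>2 + b\<^sup>2) * displacement_variance b (l n) t + rest n t)"
      by (simp add: velocity_variance_def rest_def add.assoc)
    also have "\<dots> = (LINT t:{0..T}|lborel. ((l n)\<^sup>2 + b\<^sup>2) * displacement_variance b (l n) t)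
        + (LINT t:{0..T}|lborel. rest n t)"
      by (intro set_integral_add(2) borel_integrable_atLeastAtMost' cr continuous_intros ce)
    also have "(LINT t:{0..T}|lborel. ((l n)\<^sup>2 + b\<^sup>2) * displacement_variance b (l n) t)
        = ((l n)\<^sup>2 + b\<^sup>2) * (LINT t:{0..T}|lborel. displacement_variance b (l n) t)" by simp
    also have "(l n)\<^sup>2 + b\<^sup>2 = (1 + b\<^sup>2 * (1 / l n)\<^sup>2) * (l n)\<^sup>2"
      using l0[of n] by (simp add: power_divide field_simps)
    finally show ?thesis by (simp add: mult.assoc)
  qed
  have "(\<lambda>n. (1 + b\<^sup>2 * (1 / l n)\<^sup>2) * ((l n)\<^sup>2 * (LINT t:{0..T}|lborel. displacement_variance b (l n) t))
        + (LINT t:{0..T}|lborel. rest n t)) \<longlonglongrightarrow> (1 + b\<^sup>2 * 0\<^sup>2) * C_const (- 2 * b) T + 0"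
    by (intro tendsto_intros inv 1 r0)
  then show "(\<lambda>n. LINT t:{0..T}|lborel. velocity_variance b (l n) t) \<longlonglongrightarrow> C_const (- 2 * b) T"
    unfolding eq by simp
qed

section \<open>Averages over independent modes\<close>

lemma weighted_average_tendsto:
  fixes y :: "nat \<Rightarrow> real"
  assumes y: "y \<longlonglongrightarrow> m" and c: "(\<lambda>N. (\<Sum>k=1..N. real k ^ q) / real N ^ (q + 1)) \<longlonglongrightarrow> c"
  shows "(\<lambda>N. (\<Sum>k=1..N. real k ^ q * y k) / real N ^ (q + 1)) \<longlonglongrightarrow> c * m"
proof -
  have "(\<lambda>N. (\<Sum>k=1..N. real k ^ q * (y k - m)) / real N ^ (q + 1)) \<longlonglongrightarrow> 0"
  proof (rule tendstoI)
    fix e :: real assume e: "0 < e"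
    obtain n0 where n0: "\<And>k. n0 \<le> k \<Longrightarrow> \<bar>y k - m\<bar> < e / 2"
      using LIMSEQ_D[OF y, of "e / 2"] e by auto
    define A where "A = (\<Sum>k=1..n0. real k ^ q * \<bar>y k - m\<bar>)"
    have A: "0 \<le> A" by (simp add: A_def sum_nonneg)
    have "\<forall>\<^sub>F N in sequentially. A / real N < e / 2"
      by (rule order_tendstoD(2)[OF lim_const_over_n]) (use e in simp)
    then show "\<forall>\<^sub>F N in sequentially. dist ((\<Sum>k=1..N. real k ^ q * (y k - m)) / real N ^ (q + 1)) 0 < e"
      using eventually_ge_at_top[of "max n0 1"]
    proof eventually_elim
      case (elim N)
      have N: "n0 \<le> N" "1 \<le> real N" using elim by auto
      have "\<bar>\<Sum>k=1..N. real k ^ q * (y k - m)\<bar> \<le> (\<Sum>k=1..N. real k ^ q * \<bar>y k - m\<bar>)"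
        by (rule order_trans[OF sum_abs]) (simp add: abs_mult)
      also have "\<dots> = A + (\<Sum>k\<in>{n0<..N}. real k ^ q * \<bar>y k - m\<bar>)"
        unfolding A_def using N(1)
        by (subst sum.union_disjoint[symmetric]) (auto intro!: sum.cong)
      also have "(\<Sum>k\<in>{n0<..N}. real k ^ q * \<bar>y k - m\<bar>) \<le> (\<Sum>k\<in>{n0<..N}. real N ^ q * (e / 2))"
        using n0 by (intro sum_mono mult_mono power_mono) (auto intro: less_imp_le)
      also have "\<dots> \<le> real N * (real N ^ q * (e / 2))"
        using e by (simp add: mult_right_mono)
      finally have "\<bar>\<Sum>k=1..N. real k ^ q * (y k - m)\<bar> \<le> A + real N ^ (q + 1) * (e / 2)"
        by (simp add: mult_ac)
      then have "\<bar>\<Sum>k=1..N. real k ^ q * (y k - m)\<bar> / real N ^ (q + 1)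
          \<le> (A + real N ^ (q + 1) * (e / 2)) / real N ^ (q + 1)"
        by (intro divide_right_mono) auto
      also have "\<dots> = A / real N ^ (q + 1) + e / 2" using N(2) by (simp add: add_divide_distrib)
      also have "A / real N ^ (q + 1) \<le> A / real N"
        using A N(2) self_le_power[OF N(2), of "q + 1"] by (intro divide_left_mono) auto
      finally have "\<bar>\<Sum>k=1..N. real k ^ q * (y k - m)\<bar> / real N ^ (q + 1) < e" using elim(1) by linarith
      then show ?case by (simp add: abs_divide)
    qed
  qed
  from tendsto_add[OF this tendsto_mult_right[OF c, of m]]
  have "(\<lambda>N. (\<Sum>k=1..N. real k ^ q * (y k - m)) / real N ^ (q + 1)
      + (\<Sum>k=1..N. real k ^ q) / real N ^ (q + 1) * m) \<longlonglongrightarrow> c * m"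
    by simp
  moreover have "(\<Sum>k=1..N. real k ^ q * (y k - m)) / real N ^ (q + 1)
      + (\<Sum>k=1..N. real k ^ q) / real N ^ (q + 1) * m
      = (\<Sum>k=1..N. real k ^ q * y k) / real N ^ (q + 1)" for N
    by (simp add: right_diff_distrib sum_subtractf diff_divide_distrib sum_distrib_right[symmetric])
  ultimately show ?thesis by simp
qed

lemma power_sum_averages:
  "(\<lambda>N. (\<Sum>k=1..N. real k ^ 0) / real N ^ (0 + 1)) \<longlonglongrightarrow> 1"
  "(\<lambda>N. (\<Sum>k=1..N. real k ^ 1) / real N ^ (1 + 1)) \<longlonglongrightarrow> 1 / 2"
  "(\<lambda>N. (\<Sum>k=1..N. real k ^ 2) / real N ^ (2 + 1)) \<longlonglongrightarrow> 1 / 3"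
proof -
  have inv: "(\<lambda>N. 1 / real N) \<longlonglongrightarrow> 0" by (rule lim_const_over_n)
  have ev: "\<forall>\<^sub>F N in sequentially. 0 < real N"
    using eventually_gt_at_top[of 0] by eventually_elim simp
  show "(\<lambda>N. (\<Sum>k=1..N. real k ^ 0) / real N ^ (0 + 1)) \<longlonglongrightarrow> 1"
    by (rule Lim_transform_eventually[OF tendsto_const]) (use ev in eventually_elim, simp)
  have s1: "(\<Sum>k=1..N. real k ^ 1) = real N * (real N + 1) / 2" for N
    by (induction N) (auto simp: field_simps)
  have "(\<lambda>N. (1 + 1 / real N) / 2) \<longlonglongrightarrow> (1 + 0) / 2" by (intro tendsto_intros inv) auto
  then show "(\<lambda>N. (\<Sum>k=1..N. real k ^ 1) / real N ^ (1 + 1)) \<longlonglongrightarrow> 1 / 2"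
    unfolding s1 add_0_right
    by (rule Lim_transform_eventually) (use ev in eventually_elim, simp add: field_simps power2_eq_square)
  have s2: "(\<Sum>k=1..N. real k ^ 2) = real N * (real N + 1) * (2 * real N + 1) / 6" for N
    by (induction N) (auto simp: field_simps power2_eq_square)
  have "(\<lambda>N. (1 + 1 / real N) * (2 + 1 / real N) / 6)
      \<longlonglongrightarrow> (1 + 0) * (2 + 0) / 6" by (intro tendsto_intros inv) auto
  then have "(\<lambda>N. (1 + 1 / real N) * (2 + 1 / real N) / 6) \<longlonglongrightarrow> 1 / 3" by simp
  then show "(\<lambda>N. (\<Sum>k=1..N. real k ^ 2) / real N ^ (2 + 1)) \<longlonglongrightarrow> 1 / 3"
    unfolding s2
    by (rule Lim_transform_eventually) (use ev in eventually_elim, simp add: field_simps power3_eq_cube)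
qed

context prob_space
begin

lemma factors_orthogonal:
  assumes indep: "indep_vars (\<lambda>_. N) p {1..}" and kl: "1 \<le> k" "1 \<le> l" "k \<noteq> (l::nat)"
    and fac: "factors_through M N (p k) X" "factors_through M N (p l) Y"
    and int: "integrable M X" "integrable M Y" and X0: "expectation X = 0"
  shows "expectation (\<lambda>\<omega>. X \<omega> * Y \<omega>) = 0"
proof -
  have "indep_vars (\<lambda>_. N) p {k, l}" by (rule indep_vars_subset[OF indep]) (use kl in auto)
  moreover have "factors_through M N (p i) (if i = k then X else Y)" if "i \<in> {k, l}" for i
    using that fac by auto
  ultimately obtain Z where Z: "indep_vars (\<lambda>_. borel) Z {k, l}"
    "\<forall>i\<in>{k, l}. AE \<omega> in M. (if i = k then X else Y) \<omega> = Z i \<omega>"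
    using factors_through_indep[of N p "{k, l}" "\<lambda>i. if i = k then X else Y"] by blast
  have ae: "AE \<omega> in M. X \<omega> = Z k \<omega>" "AE \<omega> in M. Y \<omega> = Z l \<omega>"
    using bspec[OF Z(2), of k] bspec[OF Z(2), of l] kl by auto
  have Zm: "Z k \<in> borel_measurable M" "Z l \<in> borel_measurable M"
    using Z(1) unfolding indep_vars_def2 by auto
  have iZ: "integrable M (Z k)" "integrable M (Z l)"
    using integrable_cong_AE[THEN iffD1, OF _ _ ae(1) int(1)] integrable_cong_AE[THEN iffD1, OF _ _
        ae(2) int(2)] int Zm by auto
  have EZ: "expectation (Z k) = 0"
    using integral_cong_AE[OF _ Zm(1) ae(1)] int(1) X0 by simp
  have "expectation (\<lambda>\<omega>. X \<omega> * Y \<omega>) = expectation (\<lambda>\<omega>. \<Prod>i\<in>{k, l}. Z i \<omega>)"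
  proof (rule integral_cong_AE)
    show "AE \<omega> in M. X \<omega> * Y \<omega> = (\<Prod>i\<in>{k, l}. Z i \<omega>)"
      using ae by eventually_elim (use kl in simp)
    show "(\<lambda>\<omega>. \<Prod>i\<in>{k, l}. Z i \<omega>) \<in> borel_measurable M" using Zm kl by simp
  qed (use int in auto)
  also have "\<dots> = (\<Prod>i\<in>{k, l}. expectation (Z i))"
    by (rule indep_vars_lebesgue_integral[OF _ Z(1)]) (use iZ in auto)
  also have "\<dots> = 0" using kl EZ by simp
  finally show ?thesis .
qed

text \<open>
  Functions of different paths are uncorrelated after centring; the deterministic averages of the means
  converge on their own.
\<close>

lemma strong_law_factors:
  assumes indep: "indep_vars (\<lambda>_. N) p {1::nat..}"
    and fac: "\<And>k. 1 \<le> k \<Longrightarrow> factors_through M N (p k) (Y k)"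
    and Y: "\<And>k. 1 \<le> k \<Longrightarrow> Y k \<in> borel_measurable M" "\<And>k. 1 \<le> k \<Longrightarrow> integrable M (\<lambda>\<omega>. (Y k \<omega>)\<^sup>2)"
      "\<And>k. 1 \<le> k \<Longrightarrow> expectation (\<lambda>\<omega>. (Y k \<omega>)\<^sup>2) \<le> K"
    and mean: "(\<lambda>k. expectation (Y k)) \<longlonglongrightarrow> m"
    and c: "(\<lambda>n. (\<Sum>k=1..n. real k ^ q) / real n ^ (q + 1)) \<longlonglongrightarrow> c"
  shows "AE \<omega> in M. (\<lambda>n. (\<Sum>k=1..n. real k ^ q * Y k \<omega>) / real n ^ (q + 1)) \<longlonglongrightarrow> c * m"
proof -
  define y where "y k = expectation (Y k)" for k
  define X where "X k \<omega> = (if 1 \<le> k then real k ^ q * (Y k \<omega> - y k) else 0)" for k \<omega>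
  have iY: "integrable M (Y k)" if "1 \<le> k" for k
    by (rule square_integrable_imp_integrable[OF Y(1,2)[OF that]])
  have iC: "integrable M (\<lambda>\<omega>. (Y k \<omega> - y k)\<^sup>2)" if "1 \<le> k" for k
    using iY[OF that] Y(2)[OF that] by (simp add: power2_diff)
  have "AE \<omega> in M. (\<lambda>n. (\<Sum>k=1..n. X k \<omega>) / real n ^ (q + 1)) \<longlonglongrightarrow> 0"
  proof (rule strong_law_uncorrelated)
    show "X k \<in> borel_measurable M" for k using Y(1)[of k] by (cases "1 \<le> k") (auto simp: X_def[abs_def])
    show "integrable M (\<lambda>\<omega>. (X k \<omega>)\<^sup>2)" if "1 \<le> k" for k
      using that iC[OF that] by (simp add: X_def power_mult_distrib)
    show "expectation (\<lambda>\<omega>. (X k \<omega>)\<^sup>2) \<le> K * real k ^ (2 * q)" if k: "1 \<le> k" for k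
    proof -
      have "expectation (\<lambda>\<omega>. (X k \<omega>)\<^sup>2) = real k ^ (2 * q) * expectation (\<lambda>\<omega>. (Y k \<omega> - y k)\<^sup>2)"
        using k by (simp add: X_def power_mult_distrib power_mult[symmetric] mult.commute)
      also have "expectation (\<lambda>\<omega>. (Y k \<omega> - y k)\<^sup>2) = expectation (\<lambda>\<omega>. (Y k \<omega>)\<^sup>2) - (y k)\<^sup>2"
        unfolding y_def by (rule variance_eq[OF iY[OF k] Y(2)[OF k]])
      also have "real k ^ (2 * q) * \<dots> \<le> real k ^ (2 * q) * K"
        using Y(3)[OF k] zero_le_power2[of "y k"] by (intro mult_left_mono) (linarith, simp)
      finally show ?thesis by (simp only: mult.commute)
    qed
    show "expectation (\<lambda>\<omega>. X k \<omega> * X l \<omega>) = 0" if kl: "1 \<le> k" "1 \<le> l" "k \<noteq> l" for k l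
    proof -
      have "expectation (\<lambda>\<omega>. (Y k \<omega> - y k) * (Y l \<omega> - y l)) = 0"
        by (rule factors_orthogonal[OF indep kl])
           (use kl iY in \<open>auto intro!: factors_through_diff fac factors_through_const simp: y_def
               prob_space\<close>)
      moreover have "X k \<omega> * X l \<omega> = real k ^ q * real l ^ q * ((Y k \<omega> - y k) * (Y l \<omega> - y l))" for \<omega>
        using kl by (simp add: X_def)
      ultimately show ?thesis by simp
    qed
  qed
  then show ?thesis
  proof eventually_elim
    case (elim \<omega>)
    have "(\<lambda>n. (\<Sum>k=1..n. X k \<omega>) / real n ^ (q + 1) + (\<Sum>k=1..n. real k ^ q * y k) / real n ^ (q + 1))
        \<longlonglongrightarrow> 0 + c * m"
      by (intro tendsto_add elim weighted_average_tendsto c) (use mean in \<open>simp add: y_def[abs_def]\<close>)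
    moreover have "(\<Sum>k=1..n. X k \<omega>) / real n ^ (q + 1) + (\<Sum>k=1..n. real k ^ q * y k) / real n ^ (q + 1)
        = (\<Sum>k=1..n. real k ^ q * Y k \<omega>) / real n ^ (q + 1)" for n
    proof -
      have "(\<Sum>k=1..n. X k \<omega>) + (\<Sum>k=1..n. real k ^ q * y k) = (\<Sum>k=1..n. real k ^ q * Y k \<omega>)"
        unfolding sum.distrib[symmetric] by (intro sum.cong refl) (simp add: X_def algebra_simps)
      then show ?thesis by (simp add: add_divide_distrib[symmetric])
    qed
    ultimately show ?case by simp
  qed
qed

text \<open>
  The terms agree almost surely with independent ones, to which the central limit theorem applies. The bound on
  the second moments is the tightness that Slutsky's theorem asks for.
\<close>

lemma clt_factors:
  assumes indep: "indep_vars (\<lambda>_. N) p {1::nat..}"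
    and fac: "\<And>k. 1 \<le> k \<Longrightarrow> factors_through M N (p k) (Y k)"
    and Y: "\<And>k. 1 \<le> k \<Longrightarrow> L4 (Y k)" "\<And>k. 1 \<le> k \<Longrightarrow> expectation (Y k) = 0"
      "\<And>k. 1 \<le> k \<Longrightarrow> expectation (\<lambda>\<omega>. Y k \<omega> ^ 4) \<le> K"
    and c: "\<And>n k. k \<in> {1..n} \<Longrightarrow> \<bar>c n k\<bar> \<le> d / sqrt (real n)"
    and var: "(\<lambda>n. \<Sum>k=1..n. (c n k)\<^sup>2 * expectation (\<lambda>\<omega>. (Y k \<omega>)\<^sup>2)) \<longlonglongrightarrow> s2"
  defines "S \<equiv> \<lambda>n \<omega>. \<Sum>k=1..n. c n k * Y k \<omega>"
  shows "\<And>t. (\<lambda>n. char (distr M borel (S n)) t) \<longlonglongrightarrow> complex_of_real (exp (- (t\<^sup>2 * s2) / 2))"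
    and "\<And>n. S n \<in> borel_measurable M" and "\<And>n. integrable M (\<lambda>\<omega>. (S n \<omega>)\<^sup>2)"
    and "\<exists>B. \<forall>n. expectation (\<lambda>\<omega>. (S n \<omega>)\<^sup>2) \<le> B"
proof -
  have Ym: "Y k \<in> borel_measurable M" if "1 \<le> k" for k using L4_measurable[OF Y(1)[OF that]] .
  show Sm: "S n \<in> borel_measurable M" for n
    unfolding S_def using Ym by (intro borel_measurable_sum borel_measurable_times
        borel_measurable_const) auto
  have term_meas: "(\<lambda>\<omega>. c n k * Y k \<omega>) \<in> borel_measurable M"
    and term_int: "integrable M (\<lambda>\<omega>. (c n k * Y k \<omega>)\<^sup>2)" if "k \<in> {1..n}" for n k
    using that Ym[of k] L4_integrable_2[OF Y(1)[of k]] by (auto simp: power_mult_distrib)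
  have term_orth: "expectation (\<lambda>\<omega>. c n k * Y k \<omega> * (c n l * Y l \<omega>)) = 0"
    if "k \<in> {1..n}" "l \<in> {1..n}" and kl: "k \<noteq> l" for n k l
  proof -
    have k: "1 \<le> k" and l: "1 \<le> l" using that by auto
    have "expectation (\<lambda>\<omega>. Y k \<omega> * Y l \<omega>) = 0"
      by (rule factors_orthogonal[OF indep k l kl fac[OF k] fac[OF l]])
         (use Y k l L4_integrable_1 in auto)
    then have "c n k * c n l * expectation (\<lambda>\<omega>. Y k \<omega> * Y l \<omega>) = 0" by simp
    moreover have "c n k * Y k \<omega> * (c n l * Y l \<omega>) = c n k * c n l * (Y k \<omega> * Y l \<omega>)" for \<omega>
      by (simp only: mult_ac)
    ultimately show ?thesis by (simp only: integral_mult_right_zero)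
  qed
  have sq: "integrable M (\<lambda>\<omega>. (S n \<omega>)\<^sup>2) \<and>
    expectation (\<lambda>\<omega>. (S n \<omega>)\<^sup>2) = (\<Sum>k=1..n. expectation (\<lambda>\<omega>. (c n k * Y k \<omega>)\<^sup>2))" for n
    unfolding S_def
    using expectation_square_sum_uncorrelated[OF term_meas finite_atLeastAtMost term_int term_orth]
        by simp
  then show "integrable M (\<lambda>\<omega>. (S n \<omega>)\<^sup>2)" for n by blast
  have "expectation (\<lambda>\<omega>. (S n \<omega>)\<^sup>2) = (\<Sum>k=1..n. (c n k)\<^sup>2 * expectation (\<lambda>\<omega>. (Y k \<omega>)\<^sup>2))" for n
    using sq[of n] by (simp add: power_mult_distrib)
  then have "(\<lambda>n. expectation (\<lambda>\<omega>. (S n \<omega>)\<^sup>2)) \<longlonglongrightarrow> s2" using var by simp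
  then have "Bseq (\<lambda>n. expectation (\<lambda>\<omega>. (S n \<omega>)\<^sup>2))" by (intro convergent_imp_Bseq convergentI)
  then show "\<exists>B. \<forall>n. expectation (\<lambda>\<omega>. (S n \<omega>)\<^sup>2) \<le> B"
    unfolding Bseq_def real_norm_def by (meson abs_le_D1)
  obtain Z where Z: "indep_vars (\<lambda>_. borel) Z {1..}" "\<forall>k\<in>{1..}. AE \<omega> in M. Y k \<omega> = Z k \<omega>"
    using factors_through_indep[OF indep, of Y] fac by auto
  have ae: "AE \<omega> in M. Y k \<omega> = Z k \<omega>" if "1 \<le> k" for k using Z(2) that by simp
  have Zm: "Z k \<in> borel_measurable M" if "1 \<le> k" for k
    using Z(1) that unfolding indep_vars_def2 by auto
  have EZ: "expectation (\<lambda>\<omega>. Z k \<omega> ^ j) = expectation (\<lambda>\<omega>. Y k \<omega> ^ j)" if "1 \<le> k" for k j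
    by (rule integral_cong_AE) (use Ym[OF that] Zm[OF that] ae[OF that] in auto)
  fix t
  have "(\<lambda>n. char (distr M borel (\<lambda>\<omega>. \<Sum>k=1..n. c n k * Z k \<omega>)) t)
      \<longlonglongrightarrow> complex_of_real (exp (- (t\<^sup>2 * s2) / 2))"
  proof (rule lyapunov_clt_char[OF Z(1) _ _ _ c])
    fix k :: nat assume k: "1 \<le> k"
    show "expectation (Z k) = 0" using EZ[OF k, of 1] Y(2)[OF k] by simp
    show "expectation (\<lambda>\<omega>. Z k \<omega> ^ 4) \<le> K" using EZ[OF k, of 4] Y(3)[OF k] by simp
    have "AE \<omega> in M. Y k \<omega> ^ 4 = Z k \<omega> ^ 4" using ae[OF k] by eventually_elim simp
    then show "integrable M (\<lambda>\<omega>. Z k \<omega> ^ 4)"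
      using integrable_cong_AE[of "\<lambda>\<omega>. Y k \<omega> ^ 4" M "\<lambda>\<omega>. Z k \<omega> ^ 4"] L4_integrable_4[OF Y(1)[OF k]]
          Ym[OF k] Zm[OF k] by simp
  next
    have "(\<Sum>k=1..n. (c n k)\<^sup>2 * expectation (\<lambda>\<omega>. (Z k \<omega>)\<^sup>2))
        = (\<Sum>k=1..n. (c n k)\<^sup>2 * expectation (\<lambda>\<omega>. (Y k \<omega>)\<^sup>2))" for n
      by (intro sum.cong refl) (simp add: EZ)
    then show "(\<lambda>n. \<Sum>k=1..n. (c n k)\<^sup>2 * expectation (\<lambda>\<omega>. (Z k \<omega>)\<^sup>2)) \<longlonglongrightarrow> s2" using var by simp
  qed auto
  moreover have "distr M borel (\<lambda>\<omega>. \<Sum>k=1..n. c n k * Z k \<omega>) = distr M borel (S n)" for n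
  proof (rule distr_cong_AE)
    have "AE \<omega> in M. \<forall>k\<in>{1..n}. Y k \<omega> = Z k \<omega>" by (subst AE_finite_all) (use ae in auto)
    then show "AE \<omega> in M. (\<Sum>k=1..n. c n k * Z k \<omega>) = S n \<omega>"
      unfolding S_def by eventually_elim (auto intro!: sum.cong)
    show "(\<lambda>\<omega>. \<Sum>k=1..n. c n k * Z k \<omega>) \<in> borel_measurable M"
      using Zm by (intro borel_measurable_sum borel_measurable_times borel_measurable_const) auto
  qed (use Sm in auto)
  ultimately show "(\<lambda>n. char (distr M borel (S n)) t) \<longlonglongrightarrow> complex_of_real (exp (- (t\<^sup>2 * s2) / 2))"
    by simp
qed

end

section \<open>Consistency and asymptotic normality of the estimators\<close>

text \<open>
  The lower case quantities are the sums divided by the powers of \<open>N\<close> that make them converge.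
\<close>

lemma mle_error_formulas:
  fixes N :: real and A1 A2 I1 I2 I12 :: real
  assumes N: "0 < N" and d: "j1 * j2 - j12\<^sup>2 \<noteq> 0"
    and J: "I1 = j1 * N ^ 3" "I2 = j2 * N" "I12 = j12 * N ^ 2" and M: "m1' = m1 * N ^ 2" "m2' = m2 * N"
    and B: "A1 = \<theta>\<^sub>1 * I1 - \<theta>\<^sub>2 * I12 - m1'" "A2 = - \<theta>\<^sub>1 * I12 + \<theta>\<^sub>2 * I2 + m2'"
  shows "(A1 * I2 + A2 * I12) / (I1 * I2 - I12\<^sup>2) - \<theta>\<^sub>1 = (m2 * j12 - m1 * j2) / (j1 * j2 - j12\<^sup>2) / N"
    and "(A1 * I12 + A2 * I1) / (I1 * I2 - I12\<^sup>2) - \<theta>\<^sub>2 = (m2 * j1 - m1 * j12) / (j1 * j2 - j12\<^sup>2)"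
proof -
  define d where "d = j1 * j2 - j12\<^sup>2"
  have D: "I1 * I2 - I12\<^sup>2 = N ^ 4 * d"
    unfolding J d_def by (simp add: power2_eq_square power3_eq_cube power4_eq_xxxx algebra_simps)
  have d0: "d \<noteq> 0" using assms(2) by (simp add: d_def)
  then have D0: "I1 * I2 - I12\<^sup>2 \<noteq> 0" using N by (simp add: D)
  have "A1 * I2 + A2 * I12 = \<theta>\<^sub>1 * (I1 * I2 - I12\<^sup>2) + (m2' * I12 - m1' * I2)"
    unfolding B by (simp add: power2_eq_square algebra_simps)
  moreover have "m2' * I12 - m1' * I2 = N ^ 3 * (m2 * j12 - m1 * j2)"
    unfolding J M by (simp add: power2_eq_square power3_eq_cube algebra_simps)
  ultimately have "(A1 * I2 + A2 * I12) / (I1 * I2 - I12\<^sup>2) - \<theta>\<^sub>1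
      = N ^ 3 * (m2 * j12 - m1 * j2) / (N ^ 4 * d)"
    using D0 by (simp add: add_divide_distrib D)
  also have "\<dots> = (m2 * j12 - m1 * j2) / d / N"
    using N d0 by (simp add: power3_eq_cube power4_eq_xxxx)
  finally show "(A1 * I2 + A2 * I12) / (I1 * I2 - I12\<^sup>2) - \<theta>\<^sub>1
      = (m2 * j12 - m1 * j2) / (j1 * j2 - j12\<^sup>2) / N"
    by (simp only: d_def)
  have "A1 * I12 + A2 * I1 = \<theta>\<^sub>2 * (I1 * I2 - I12\<^sup>2) + (m2' * I1 - m1' * I12)"
    unfolding B by (simp add: power2_eq_square algebra_simps)
  moreover have "m2' * I1 - m1' * I12 = N ^ 4 * (m2 * j1 - m1 * j12)"
    unfolding J M by (simp add: power2_eq_square power3_eq_cube power4_eq_xxxx algebra_simps)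
  ultimately have "(A1 * I12 + A2 * I1) / (I1 * I2 - I12\<^sup>2) - \<theta>\<^sub>2
      = N ^ 4 * (m2 * j1 - m1 * j12) / (N ^ 4 * d)"
    using D0 by (simp add: add_divide_distrib D)
  also have "\<dots> = (m2 * j1 - m1 * j12) / d" using N d0 by simp
  finally show "(A1 * I12 + A2 * I1) / (I1 * I2 - I12\<^sup>2) - \<theta>\<^sub>2 = (m2 * j1 - m1 * j12) / (j1 * j2 - j12\<^sup>2)"
    by (simp only: d_def)
qed

theorem theorem3p1:
  fixes M :: "'a measure" and F :: "real \<Rightarrow> 'a measure"
    and W :: "(real \<Rightarrow> real) \<Rightarrow> real \<Rightarrow> 'a \<Rightarrow> real"
    and u v :: "nat \<Rightarrow> real \<Rightarrow> 'a \<Rightarrow> real" and P Q :: "nat \<Rightarrow> 'a \<Rightarrow> real"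
    and T a b \<theta>\<^sub>1 \<theta>\<^sub>2 :: real
  assumes "stochastic_basis M F"
    and "0 < T" and "1 \<le> a" and "2 * \<bar>b\<bar> \<le> 1" and "\<theta>\<^sub>1 = a\<^sup>2" and "\<theta>\<^sub>2 = - 2 * b"
    and "cylindrical_brownian_motion M F W"
    and "wave_solution M F T \<theta>\<^sub>1 \<theta>\<^sub>2 W u v"
    and "\<And>k. 1 \<le> k \<Longrightarrow> has_ito_process_integral M F (W (sine_basis k)) T (v k) (u k) (P k)"
    and "\<And>k. 1 \<le> k \<Longrightarrow> has_ito_process_integral M F (W (sine_basis k)) T (v k) (v k) (Q k)"
  shows "(AE \<omega> in M. (\<lambda>N. mle1 T u v P Q N \<omega>) \<longlonglongrightarrow> \<theta>\<^sub>1) \<and>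
         (AE \<omega> in M. (\<lambda>N. mle2 T u v P Q N \<omega>) \<longlonglongrightarrow> \<theta>\<^sub>2) \<and>
         weak_conv_m
           (\<lambda>N. distr M borel (\<lambda>\<omega>. real N powr (3 / 2) * (mle1 T u v P Q N \<omega> - \<theta>\<^sub>1)))
           (normal_law 0 (3 * \<theta>\<^sub>1 / C_const \<theta>\<^sub>2 T)) \<and>
         weak_conv_m
           (\<lambda>N. distr M borel (\<lambda>\<omega>. real N powr (1 / 2) * (mle2 T u v P Q N \<omega> - \<theta>\<^sub>2)))
           (normal_law 0 (1 / C_const \<theta>\<^sub>2 T))"
proof -
  interpret stochastic_basis M F by (rule assms(1))
  note T = assms(2)
  have a1: "1 \<le> a\<^sup>2" using assms(3) by (simp add: one_le_power)
  have b: "\<bar>b\<bar> \<le> 1 / 2" using assms(4) by simp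
  have b2: "b\<^sup>2 \<le> 1 / 4"
    using power_mono[OF b, of 2] by (simp add: power_divide)
  have \<theta>1: "0 < \<theta>\<^sub>1" "1 \<le> \<theta>\<^sub>1" using a1 assms(5) by auto
  define C where "C = C_const \<theta>\<^sub>2 T"
  have C: "0 < C" unfolding C_def by (rule C_const_pos[OF T])
  \<comment> \<open>The frequency of the mode \<open>k\<close>. The value at 0 only keeps it positive for all indices.\<close>
  define l where "l k = (if k = 0 then 1 else sqrt (\<theta>\<^sub>1 * (real k)\<^sup>2 - b\<^sup>2))" for k :: nat
  have kk: "1 \<le> (real k)\<^sup>2" if "1 \<le> k" for k using that by (simp add: one_le_power)
  have tk: "(real k)\<^sup>2 \<le> \<theta>\<^sub>1 * (real k)\<^sup>2" for k using mult_right_mono[OF \<theta>1(2), of "(real k)\<^sup>2"] by simp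
  have l_sq: "(l k)\<^sup>2 + b\<^sup>2 = \<theta>\<^sub>1 * (real k)\<^sup>2" if "1 \<le> k" for k
  proof -
    have "0 \<le> \<theta>\<^sub>1 * (real k)\<^sup>2 - b\<^sup>2" using kk[OF that] tk[of k] b2 by linarith
    then show ?thesis using that by (simp add: l_def)
  qed
  have l_ge: "real k / 2 \<le> l k" if "1 \<le> k" for k
  proof -
    have "(real k / 2)\<^sup>2 \<le> \<theta>\<^sub>1 * (real k)\<^sup>2 - b\<^sup>2"
      unfolding power_divide using kk[OF that] tk[of k] b2 by simp
    from real_le_rsqrt[OF this] show ?thesis using that by (simp add: l_def)
  qed
  have l_pos: "0 < l k" for k
  proof (cases "k = 0")
    case False
    then have "0 < real k / 2" "real k / 2 \<le> l k" using l_ge[of k] by auto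
    then show ?thesis by linarith
  qed (simp add: l_def)
  have l_top: "filterlim l at_top sequentially"
  proof (rule filterlim_at_top_mono)
    show "filterlim (\<lambda>k. (1 / 2) * real k) at_top sequentially"
      by (rule filterlim_tendsto_pos_mult_at_top[OF tendsto_const _ filterlim_real_sequentially]) simp
    show "\<forall>\<^sub>F k in sequentially. (1 / 2) * real k \<le> l k"
      using eventually_ge_at_top[of 1] by eventually_elim (use l_ge in simp)
  qed
  have bm: "brownian_motion M F (W (sine_basis k))" if "1 \<le> k" for k
    using assms(7) that unfolding cylindrical_brownian_motion_def by blast
  have mode: "wave_mode M F (W (sine_basis k)) T b (l k) (u k) (v k)" if k: "1 \<le> k" for k
  proof (intro wave_mode.intro brownian_basis.intro wave_mode_axioms.intro brownian_basis_axioms.intro)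
    note ws = assms(8)[unfolded wave_solution_def, rule_format, OF k]
    show "adapted_on F {0..T} (u k)" "adapted_on F {0..T} (v k)"
      "continuous_paths_on M {0..T} (u k)" "continuous_paths_on M {0..T} (v k)"
      using ws by blast+
    show "AE \<omega> in M. \<forall>t\<in>{0..T}. u k t \<omega> = (LINT s:{0..t}|lborel. v k s \<omega>) \<and>
      v k t \<omega> = - ((l k)\<^sup>2 + b\<^sup>2) * (LINT s:{0..t}|lborel. u k s \<omega>)
        + (- 2 * b) * (LINT s:{0..t}|lborel. v k s \<omega>) + W (sine_basis k) t \<omega>"
      using ws unfolding l_sq[OF k] assms(6)[symmetric] by (simp only: mult_minus_left)
    show "stochastic_basis M F" by (rule assms(1))
  qed (use T l_pos b bm k in auto)

  define U where "U k \<omega> = (LINT t:{0..T}|lborel. (u k t \<omega>)\<^sup>2)" for k \<omega>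
  define V where "V k \<omega> = (LINT t:{0..T}|lborel. (v k t \<omega>)\<^sup>2)" for k \<omega>

  have "\<forall>k. \<exists>L. 1 \<le> k \<longrightarrow> has_ito_integral M F (W (sine_basis k)) T (u k) L \<and>
    (AE \<omega> in M. P k \<omega> = - (\<theta>\<^sub>1 * (real k)\<^sup>2) * U k \<omega> + \<theta>\<^sub>2 * ((u k T \<omega>)\<^sup>2 / 2) + L \<omega>)"
  proof
    fix k
    show "\<exists>L. 1 \<le> k \<longrightarrow> has_ito_integral M F (W (sine_basis k)) T (u k) L \<and>
    (AE \<omega> in M. P k \<omega> = - (\<theta>\<^sub>1 * (real k)\<^sup>2) * U k \<omega> + \<theta>\<^sub>2 * ((u k T \<omega>)\<^sup>2 / 2) + L \<omega>)"
  proof (cases "1 \<le> k")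
    case True
    interpret m: wave_mode M F "W (sine_basis k)" T b "l k" "u k" "v k" by (rule mode[OF True])
    obtain L where L: "has_ito_integral M F (W (sine_basis k)) T (u k) L"
      "AE \<omega> in M. P k \<omega> = - ((l k)\<^sup>2 + b\<^sup>2) * (LINT t:{0..T}|lborel. u k t \<omega> * u k t \<omega>)
       + (- 2 * b) * (LINT t:{0..T}|lborel. u k t \<omega> * v k t \<omega>) + L \<omega>"
      using m.ito_process_integral_decomposition[OF assms(9)[OF True] m.uv_continuous(1)] by blast
    have "AE \<omega> in M. P k \<omega> = - (\<theta>\<^sub>1 * (real k)\<^sup>2) * U k \<omega> + \<theta>\<^sub>2 * ((u k T \<omega>)\<^sup>2 / 2) + L \<omega>"
      using L(2) m.integral_u_times_v
      by eventually_elim (simp only: U_def power2_eq_square[of "u k _ _"] l_sq[OF True] assms(6))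
    with L(1) show ?thesis by blast
  qed simp
  qed
  from choice[OF this] obtain L1 where L1: "\<And>k. 1 \<le> k
      \<Longrightarrow> has_ito_integral M F (W (sine_basis k)) T (u k) (L1 k)"
    and P: "\<And>k. 1 \<le> k \<Longrightarrow> AE \<omega> in M. P k \<omega> = - (\<theta>\<^sub>1 * (real k)\<^sup>2) * U k \<omega> + \<theta>\<^sub>2 * ((u k T \<omega>)\<^sup>2 / 2) + L1 k \<omega>"
    by blast
  have "\<forall>k. \<exists>L. 1 \<le> k \<longrightarrow> has_ito_integral M F (W (sine_basis k)) T (v k) L \<and>
    (AE \<omega> in M. Q k \<omega> = - (\<theta>\<^sub>1 * (real k)\<^sup>2) * ((u k T \<omega>)\<^sup>2 / 2) + \<theta>\<^sub>2 * V k \<omega> + L \<omega>)"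
  proof
    fix k
    show "\<exists>L. 1 \<le> k \<longrightarrow> has_ito_integral M F (W (sine_basis k)) T (v k) L \<and>
    (AE \<omega> in M. Q k \<omega> = - (\<theta>\<^sub>1 * (real k)\<^sup>2) * ((u k T \<omega>)\<^sup>2 / 2) + \<theta>\<^sub>2 * V k \<omega> + L \<omega>)"
  proof (cases "1 \<le> k")
    case True
    interpret m: wave_mode M F "W (sine_basis k)" T b "l k" "u k" "v k" by (rule mode[OF True])
    obtain L where L: "has_ito_integral M F (W (sine_basis k)) T (v k) L"
      "AE \<omega> in M. Q k \<omega> = - ((l k)\<^sup>2 + b\<^sup>2) * (LINT t:{0..T}|lborel. v k t \<omega> * u k t \<omega>)
       + (- 2 * b) * (LINT t:{0..T}|lborel. v k t \<omega> * v k t \<omega>) + L \<omega>"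
      using m.ito_process_integral_decomposition[OF assms(10)[OF True] m.uv_continuous(2)] by blast
    have "AE \<omega> in M. Q k \<omega> = - (\<theta>\<^sub>1 * (real k)\<^sup>2) * ((u k T \<omega>)\<^sup>2 / 2) + \<theta>\<^sub>2 * V k \<omega> + L \<omega>"
      using L(2) m.integral_u_times_v

    proof eventually_elim
      case (elim \<omega>)
      have "(LINT t:{0..T}|lborel. v k t \<omega> * u k t \<omega>) = (LINT t:{0..T}|lborel. u k t \<omega> * v k t \<omega>)"
        by (simp add: mult.commute)
      then show ?case using elim
        by (simp only: V_def power2_eq_square[of "v k _ _"] l_sq[OF True] assms(6))
    qed
    with L(1) show ?thesis by blast
  qed simp
  qed
  from choice[OF this] obtain L2 where L2: "\<And>k. 1 \<le> k
      \<Longrightarrow> has_ito_integral M F (W (sine_basis k)) T (v k) (L2 k)"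
    and Q: "\<And>k. 1 \<le> k \<Longrightarrow> AE \<omega> in M. Q k \<omega> = - (\<theta>\<^sub>1 * (real k)\<^sup>2) * ((u k T \<omega>)\<^sup>2 / 2) + \<theta>\<^sub>2 * V k \<omega> + L2 k \<omega>"
    by blast

  define N where "N = Pi\<^sub>M {0::real..} (\<lambda>_. borel :: real measure)"
  define p where "p k \<omega> = (\<lambda>t\<in>{0..}. W (sine_basis k) t \<omega>)" for k \<omega>
  have indep: "indep_vars (\<lambda>_. N) p {1..}"
    using assms(7) unfolding cylindrical_brownian_motion_def N_def p_def[abs_def] by blast
  have fac_w: "factors_through M N (p k) (W (sine_basis k) t)" if "0 \<le> t" for k t
    by (rule factors_throughI[of "\<lambda>x. x t"])
        (use that in \<open>auto simp: N_def p_def intro!: measurable_component_singleton\<close>)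

  define mc where "mc = moment_const T"
  have mc: "0 \<le> mc" using T by (simp add: mc_def moment_const_nonneg)
  \<comment> \<open>One constant that dominates the moment bounds of all the normalised quantities below.\<close>
  define K where "K = (2 * exp T) ^ 4 * ((1 + T\<^sup>2 + mc) * (1 + mc))"
  have K1: "(2 * exp T) ^ 4 * x \<le> K" if "x \<le> (1 + T\<^sup>2 + mc) * (1 + mc)" for x
    unfolding K_def using that by (intro mult_left_mono) auto
  have Bu: "real k * (exp T / l k) \<le> 2 * exp T" if "1 \<le> k" for k
  proof -
    have "real k \<le> 2 * l k" using l_ge[OF that] by simp
    then have "exp T * real k \<le> exp T * (2 * l k)" by (intro mult_left_mono) auto
    then show ?thesis using l_pos[of k] by (simp add: field_simps)
  qed
  have Bv: "exp T * (1 + \<bar>b\<bar> / l k) \<le> 2 * exp T" if "1 \<le> k" for k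
  proof -
    have "\<bar>b\<bar> \<le> l k" using b l_ge[OF that] that by (simp add: field_simps)
    then have "\<bar>b\<bar> / l k \<le> 1" using l_pos[of k] by simp
    then have "exp T * (1 + \<bar>b\<bar> / l k) \<le> exp T * 2" by (intro mult_left_mono) auto
    then show ?thesis by simp
  qed
  have Bu4: "real k ^ 4 * (exp T / l k) ^ 4 \<le> (2 * exp T) ^ 4" if "1 \<le> k" for k
    unfolding power_mult_distrib[symmetric] using Bu[OF that] l_pos[of k] by (intro power_mono) auto
  have Bv4: "(exp T * (1 + \<bar>b\<bar> / l k)) ^ 4 \<le> (2 * exp T) ^ 4" if "1 \<le> k" for k
    using Bv[OF that] l_pos[of k] by (intro power_mono) auto
  have mcK: "T\<^sup>2 * mc \<le> (1 + T\<^sup>2 + mc) * (1 + mc)" "mc \<le> (1 + T\<^sup>2 + mc) * (1 + mc)" "mc * mc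
      \<le> (1 + T\<^sup>2 + mc) * (1 + mc)"
  proof -
    show "T\<^sup>2 * mc \<le> (1 + T\<^sup>2 + mc) * (1 + mc)" "mc * mc \<le> (1 + T\<^sup>2 + mc) * (1 + mc)"
      using mc by (intro mult_mono; simp)+
    have "1 * mc \<le> (1 + T\<^sup>2 + mc) * (1 + mc)" using mc by (intro mult_mono) auto
    then show "mc \<le> (1 + T\<^sup>2 + mc) * (1 + mc)" by simp
  qed

  \<comment> \<open>The quantities of the mode \<open>k\<close>, scaled so that their moments are bounded in \<open>k\<close>: the sums
    \<open>J\<^sub>1\<close>, \<open>J\<^sub>1\<^sub>2\<close> and \<open>M\<^sub>1\<close> have the terms \<open>k\<^sup>2 Y1\<close>, \<open>k Y3\<close> and \<open>k Y4\<close>. The terms \<open>V\<close> and \<open>L2\<close> of \<open>J\<^sub>2\<close>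
        and \<open>M\<^sub>2\<close> need no scaling.\<close>
  define Y1 where "Y1 k \<omega> = (real k)\<^sup>2 * U k \<omega>" for k \<omega>
  define Y3 where "Y3 k \<omega> = real k * ((u k T \<omega>)\<^sup>2 / 2)" for k \<omega>
  define Y4 where "Y4 k \<omega> = real k * L1 k \<omega>" for k \<omega>
  define y where "y k = (real k)\<^sup>2 * (LINT t:{0..T}|lborel. displacement_variance b (l k) t)" for k
  have Y1: "Y1 k \<in> borel_measurable M" "integrable M (\<lambda>\<omega>. (Y1 k \<omega>)\<^sup>2)"
    "expectation (Y1 k) = y k" "expectation (\<lambda>\<omega>. (Y1 k \<omega>)\<^sup>2) \<le> K" "factors_through M N (p k) (Y1 k)"
    if k: "1 \<le> k" for k
  proof -
    interpret m: wave_mode M F "W (sine_basis k)" T b "l k" "u k" "v k" by (rule mode[OF k])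
    note m = m.u_square_integral
    show "Y1 k \<in> borel_measurable M" "integrable M (\<lambda>\<omega>. (Y1 k \<omega>)\<^sup>2)" "expectation (Y1 k) = y k"
      using m(1-3) by (simp_all add: Y1_def[abs_def] U_def y_def power_mult_distrib)
    have "expectation (\<lambda>\<omega>. (Y1 k \<omega>)\<^sup>2) = real k ^ 4 * expectation (\<lambda>\<omega>. (U k \<omega>)\<^sup>2)"
      by (simp add: Y1_def power_mult_distrib power_mult[symmetric])
    also have "\<dots> \<le> real k ^ 4 * (T\<^sup>2 * ((exp T / l k) ^ 4 * mc))"
      unfolding U_def mc_def by (rule mult_left_mono[OF m(4)]) auto
    also have "\<dots> = (real k ^ 4 * (exp T / l k) ^ 4) * (T\<^sup>2 * mc)" by (simp only: mult_ac)
    also have "\<dots> \<le> (2 * exp T) ^ 4 * (T\<^sup>2 * mc)"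
      using Bu4[OF k] mc by (intro mult_right_mono) auto
    also have "\<dots> \<le> K" by (rule K1[OF mcK(1)])
    finally show "expectation (\<lambda>\<omega>. (Y1 k \<omega>)\<^sup>2) \<le> K" .
    show "factors_through M N (p k) (Y1 k)"
      unfolding Y1_def[abs_def] U_def
      by (intro factors_through_mult factors_through_const m(5) m.u_moments(4) fac_w)
  qed
  have V: "V k \<in> borel_measurable M" "integrable M (\<lambda>\<omega>. (V k \<omega>)\<^sup>2)"
    "expectation (V k) = (LINT t:{0..T}|lborel. velocity_variance b (l k) t)"
    "expectation (\<lambda>\<omega>. (V k \<omega>)\<^sup>2) \<le> K" "factors_through M N (p k) (V k)"
    if k: "1 \<le> k" for k
  proof -
    interpret m: wave_mode M F "W (sine_basis k)" T b "l k" "u k" "v k" by (rule mode[OF k])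
    note m = m.v_square_integral
    show "V k \<in> borel_measurable M" "integrable M (\<lambda>\<omega>. (V k \<omega>)\<^sup>2)"
      "expectation (V k) = (LINT t:{0..T}|lborel. velocity_variance b (l k) t)"
      using m(1-3) by (simp_all add: V_def[abs_def])
    have "expectation (\<lambda>\<omega>. (V k \<omega>)\<^sup>2) \<le> T\<^sup>2 * ((exp T * (1 + \<bar>b\<bar> / l k)) ^ 4 * mc)"
      using m(4) by (simp add: mc_def V_def)
    also have "\<dots> = (exp T * (1 + \<bar>b\<bar> / l k)) ^ 4 * (T\<^sup>2 * mc)" by (simp only: mult_ac)
    also have "\<dots> \<le> (2 * exp T) ^ 4 * (T\<^sup>2 * mc)"
      using Bv4[OF k] mc by (intro mult_right_mono) auto
    also have "\<dots> \<le> K" by (rule K1[OF mcK(1)])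
    finally show "expectation (\<lambda>\<omega>. (V k \<omega>)\<^sup>2) \<le> K" .
    show "factors_through M N (p k) (V k)"
      unfolding V_def[abs_def] by (intro m(5) m.v_moments(4) fac_w)
  qed
  have Y3: "Y3 k \<in> borel_measurable M" "integrable M (\<lambda>\<omega>. (Y3 k \<omega>)\<^sup>2)"
    "0 \<le> expectation (Y3 k)" "expectation (Y3 k) \<le> (1 + K) / real k"
    "expectation (\<lambda>\<omega>. (Y3 k \<omega>)\<^sup>2) \<le> K" "factors_through M N (p k) (Y3 k)"
    if k: "1 \<le> k" for k
  proof -
    interpret m: wave_mode M F "W (sine_basis k)" T b "l k" "u k" "v k" by (rule mode[OF k])
    have TT: "T \<in> {0..T}" using T by simp
    note m = m.u_moments[OF TT]
    note um = L4_measurable[OF m(1)]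
    show "Y3 k \<in> borel_measurable M" using um by (simp add: Y3_def[abs_def])
    show "integrable M (\<lambda>\<omega>. (Y3 k \<omega>)\<^sup>2)"
      using L4_integrable_4[OF m(1)] by (simp add: Y3_def power_mult_distrib power_divide
          power_mult[symmetric])
    show "0 \<le> expectation (Y3 k)" by (simp add: Y3_def[abs_def] integral_nonneg_AE)
    have "real k ^ 4 * expectation (\<lambda>\<omega>. u k T \<omega> ^ 4) \<le> real k ^ 4 * ((exp T / l k) ^ 4 * mc)"
      using m(3) by (intro mult_left_mono) (auto simp: mc_def)
    also have "\<dots> = (real k ^ 4 * (exp T / l k) ^ 4) * mc" by (simp only: mult_ac)
    also have "\<dots> \<le> (2 * exp T) ^ 4 * mc" using Bu4[OF k] mc by (intro mult_right_mono) auto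
    also have "\<dots> \<le> K" by (rule K1[OF mcK(2)])
    finally have u4: "real k ^ 4 * expectation (\<lambda>\<omega>. u k T \<omega> ^ 4) \<le> K" .
    have k4: "real k ^ 2 \<le> real k ^ 4" using k by (intro power_increasing) auto
    have "expectation (\<lambda>\<omega>. (Y3 k \<omega>)\<^sup>2) = (real k)\<^sup>2 / 4 * expectation (\<lambda>\<omega>. u k T \<omega> ^ 4)"
      by (simp add: Y3_def power_mult_distrib power_divide power_mult[symmetric])
    also have "\<dots> \<le> real k ^ 4 * expectation (\<lambda>\<omega>. u k T \<omega> ^ 4)"
    proof (rule mult_right_mono)
      show "(real k)\<^sup>2 / 4 \<le> real k ^ 4" using k4 zero_le_power2[of "real k"] by linarith
    qed (simp add: integral_nonneg_AE)
    finally show "expectation (\<lambda>\<omega>. (Y3 k \<omega>)\<^sup>2) \<le> K" using u4 by linarith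
    have k0: "0 < real k" using k by simp
    have "expectation (\<lambda>\<omega>. (real k * u k T \<omega>)\<^sup>2 / 2) \<le> expectation (\<lambda>\<omega>. 1 + (real k * u k T \<omega>) ^ 4)"
    proof (rule integral_mono)
      show "integrable M (\<lambda>\<omega>. (real k * u k T \<omega>)\<^sup>2 / 2)"
          using L4_integrable_2[OF m(1)] by (simp add: power_mult_distrib)
      show "integrable M (\<lambda>\<omega>. 1 + (real k * u k T \<omega>) ^ 4)"
          using L4_integrable_4[OF m(1)] by (simp add: power_mult_distrib)
      show "(real k * u k T \<omega>)\<^sup>2 / 2 \<le> 1 + (real k * u k T \<omega>) ^ 4" for \<omega>
        using square_le_one_plus_fourth_power[of "real k * u k T \<omega>"] zero_le_power2[of "real k * u k T \<omega>"]
        by linarith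
    qed
    also have "\<dots> \<le> 1 + K"
      using L4_integrable_4[OF m(1)] u4 by (simp add: power_mult_distrib prob_space)
    also have "expectation (\<lambda>\<omega>. (real k * u k T \<omega>)\<^sup>2 / 2) = real k * expectation (Y3 k)"
      by (simp add: Y3_def[abs_def] power_mult_distrib power2_eq_square[of "real k"])
    finally have "real k * expectation (Y3 k) \<le> 1 + K" .
    then show "expectation (Y3 k) \<le> (1 + K) / real k" using k0 by (simp add: field_simps)
    show "factors_through M N (p k) (Y3 k)"
    proof -
      have "factors_through M N (p k) (\<lambda>\<omega>. (real k / 2) * (u k T \<omega> * u k T \<omega>))"
        by (intro factors_through_mult factors_through_const m(4) fac_w)
      moreover have "Y3 k = (\<lambda>\<omega>. (real k / 2) * (u k T \<omega> * u k T \<omega>))"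
        by (simp add: Y3_def[abs_def] power2_eq_square)
      ultimately show ?thesis by simp
    qed
  qed
  have Y4: "L4 (Y4 k)" "expectation (Y4 k) = 0" "expectation (\<lambda>\<omega>. (Y4 k \<omega>)\<^sup>2) = y k"
    "expectation (\<lambda>\<omega>. Y4 k \<omega> ^ 4) \<le> K" "factors_through M N (p k) (Y4 k)"
    if k: "1 \<le> k" for k
  proof -
    interpret m: wave_mode M F "W (sine_basis k)" T b "l k" "u k" "v k" by (rule mode[OF k])
    note m = m.ito_integral_u[OF L1[OF k]]
    show "L4 (Y4 k)" using m(1) by (auto simp: L4_def Y4_def[abs_def] power_mult_distrib)
    show "expectation (Y4 k) = 0" "expectation (\<lambda>\<omega>. (Y4 k \<omega>)\<^sup>2) = y k"
      using m(2,3) by (simp_all add: Y4_def[abs_def] y_def power_mult_distrib)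
    have "expectation (\<lambda>\<omega>. Y4 k \<omega> ^ 4) = real k ^ 4 * expectation (\<lambda>\<omega>. L1 k \<omega> ^ 4)"
      by (simp add: Y4_def power_mult_distrib)
    also have "\<dots> \<le> real k ^ 4 * ((exp T / l k) ^ 4 * mc * mc)"
      using m(4) by (intro mult_left_mono) (auto simp: mc_def)
    also have "\<dots> = (real k ^ 4 * (exp T / l k) ^ 4) * (mc * mc)" by (simp only: mult_ac)
    also have "\<dots> \<le> (2 * exp T) ^ 4 * (mc * mc)" using Bu4[OF k] mc by (intro mult_right_mono) auto
    also have "\<dots> \<le> K" by (rule K1[OF mcK(3)])
    finally show "expectation (\<lambda>\<omega>. Y4 k \<omega> ^ 4) \<le> K" .
    show "factors_through M N (p k) (Y4 k)"
      unfolding Y4_def[abs_def] by (intro factors_through_mult factors_through_const m(5) fac_w)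
  qed
  have L2f: "L4 (L2 k)" "expectation (L2 k) = 0"
    "expectation (\<lambda>\<omega>. (L2 k \<omega>)\<^sup>2) = (LINT t:{0..T}|lborel. velocity_variance b (l k) t)"
    "expectation (\<lambda>\<omega>. L2 k \<omega> ^ 4) \<le> K" "factors_through M N (p k) (L2 k)"
    if k: "1 \<le> k" for k
  proof -
    interpret m: wave_mode M F "W (sine_basis k)" T b "l k" "u k" "v k" by (rule mode[OF k])
    note m = m.ito_integral_v[OF L2[OF k]]
    show "L4 (L2 k)" "expectation (L2 k) = 0"
      "expectation (\<lambda>\<omega>. (L2 k \<omega>)\<^sup>2) = (LINT t:{0..T}|lborel. velocity_variance b (l k) t)"
      by (rule m)+
    have "expectation (\<lambda>\<omega>. L2 k \<omega> ^ 4) \<le> (exp T * (1 + \<bar>b\<bar> / l k)) ^ 4 * (mc * mc)"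
      using m(4) by (simp add: mc_def mult.assoc)
    also have "\<dots> \<le> (2 * exp T) ^ 4 * (mc * mc)" using Bv4[OF k] mc by (intro mult_right_mono) auto
    also have "\<dots> \<le> K" by (rule K1[OF mcK(3)])
    finally show "expectation (\<lambda>\<omega>. L2 k \<omega> ^ 4) \<le> K" .
    show "factors_through M N (p k) (L2 k)" by (intro m(5) fac_w)
  qed
  have L4_sq_le: "expectation (\<lambda>\<omega>. (X \<omega>)\<^sup>2) \<le> 1 + K" if X: "L4 X" "expectation (\<lambda>\<omega>. X \<omega> ^ 4) \<le> K" for X
  proof -
    have "expectation (\<lambda>\<omega>. (X \<omega>)\<^sup>2) \<le> expectation (\<lambda>\<omega>. 1 + X \<omega> ^ 4)"
      by (rule integral_mono) (use L4_integrable_2[OF X(1)] L4_integrable_4[OF X(1)]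
          square_le_one_plus_fourth_power in auto)
    also have "\<dots> \<le> 1 + K" using L4_integrable_4[OF X(1)] X(2) by (simp add: prob_space)
    finally show ?thesis .
  qed

  have ylim: "y \<longlonglongrightarrow> C / \<theta>\<^sub>1"
  proof -
    have inv: "(\<lambda>k. 1 / real k) \<longlonglongrightarrow> 0" by (rule lim_const_over_n)
    have "(\<lambda>k. 1 / (\<theta>\<^sub>1 - b\<^sup>2 * (1 / real k)\<^sup>2) * ((l k)\<^sup>2 * (LINT t:{0..T}|lborel.
        displacement_variance b (l k) t)))
        \<longlonglongrightarrow> 1 / (\<theta>\<^sub>1 - b\<^sup>2 * 0\<^sup>2) * C"
      unfolding C_def assms(6)
      by (intro tendsto_intros inv displacement_variance_integral_tendsto(1)[OF T _ l_pos l_top])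
          (use \<theta>1 b in auto)
    moreover have "\<forall>\<^sub>F k in sequentially. 1 / (\<theta>\<^sub>1 - b\<^sup>2 * (1 / real k)\<^sup>2) * ((l k)\<^sup>2 * (LINT
        t:{0..T}|lborel. displacement_variance b (l k) t)) = y k"
      using eventually_ge_at_top[of 1]
    proof eventually_elim
      case (elim k)
      have k0: "real k \<noteq> 0" using elim by simp
      have "b\<^sup>2 * (1 / real k)\<^sup>2 * (real k)\<^sup>2 = b\<^sup>2" using k0 by (simp add: power_divide)
      then have "(\<theta>\<^sub>1 - b\<^sup>2 * (1 / real k)\<^sup>2) * (real k)\<^sup>2 = (l k)\<^sup>2"
        unfolding left_diff_distrib using l_sq[OF elim] by linarith
      moreover have "(l k)\<^sup>2 \<noteq> 0" using l_pos[of k] by simp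
      ultimately have "1 / (\<theta>\<^sub>1 - b\<^sup>2 * (1 / real k)\<^sup>2) * (l k)\<^sup>2 = (real k)\<^sup>2"
        by (metis (no_types, opaque_lifting) mult_zero_left nonzero_mult_div_cancel_left
            times_divide_eq_left mult_1)
      then show ?case by (simp only: y_def mult.assoc[symmetric])
    qed
    ultimately have "y \<longlonglongrightarrow> 1 / (\<theta>\<^sub>1 - b\<^sup>2 * 0\<^sup>2) * C" by (rule Lim_transform_eventually)
    then show ?thesis by simp
  qed
  have vlim: "(\<lambda>k. LINT t:{0..T}|lborel. velocity_variance b (l k) t) \<longlonglongrightarrow> C"
    unfolding C_def assms(6) by (rule displacement_variance_integral_tendsto(2)[OF T _ l_pos l_top])
        (use b in auto)
  have ev_cong: "f \<longlonglongrightarrow> x" if "g \<longlonglongrightarrow> x" "\<And>k. 1 \<le> k \<Longrightarrow> f k = g k" for f g :: "nat \<Rightarrow> real" and x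
    by (rule Lim_transform_eventually[OF that(1)])
       (use eventually_ge_at_top[of 1] in eventually_elim, use that(2) in simp)

  \<comment> \<open>The five sums, divided by the powers of \<open>n\<close> of the strong law.\<close>
  define j1 where "j1 n \<omega> = (\<Sum>k=1..n. real k ^ 2 * Y1 k \<omega>) / real n ^ (2 + 1)" for n \<omega>
  define j2 where "j2 n \<omega> = (\<Sum>k=1..n. real k ^ 0 * V k \<omega>) / real n ^ (0 + 1)" for n \<omega>
  define j12 where "j12 n \<omega> = (\<Sum>k=1..n. real k ^ 1 * Y3 k \<omega>) / real n ^ (1 + 1)" for n \<omega>
  define m1 where "m1 n \<omega> = (\<Sum>k=1..n. real k ^ 1 * Y4 k \<omega>) / real n ^ (1 + 1)" for n \<omega>
  define m2 where "m2 n \<omega> = (\<Sum>k=1..n. real k ^ 0 * L2 k \<omega>) / real n ^ (0 + 1)" for n \<omega>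
  \<comment> \<open>The error formulas at a point where the denominator does not vanish.\<close>
  define err where "err n \<omega> \<longleftrightarrow>
    mle1 T u v P Q n \<omega> - \<theta>\<^sub>1
      = (m2 n \<omega> * j12 n \<omega> - m1 n \<omega> * j2 n \<omega>) / (j1 n \<omega> * j2 n \<omega> - (j12 n \<omega>)\<^sup>2) / real n \<and>
    mle2 T u v P Q n \<omega> - \<theta>\<^sub>2
      = (m2 n \<omega> * j1 n \<omega> - m1 n \<omega> * j12 n \<omega>) / (j1 n \<omega> * j2 n \<omega> - (j12 n \<omega>)\<^sup>2)" for n \<omega>
  have "AE \<omega> in M. (\<lambda>n. j1 n \<omega>) \<longlonglongrightarrow> 1 / 3 * (C / \<theta>\<^sub>1)"
    unfolding j1_def
    by (rule strong_law_factors[OF indep Y1(5) Y1(1) Y1(2) Y1(4) _ power_sum_averages(3)])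
       (auto intro!: ev_cong[OF ylim] Y1(3))
  moreover have "AE \<omega> in M. (\<lambda>n. j2 n \<omega>) \<longlonglongrightarrow> 1 * C"
    unfolding j2_def
    by (rule strong_law_factors[OF indep V(5) V(1) V(2) V(4) _ power_sum_averages(1)])
       (auto intro!: ev_cong[OF vlim] V(3))
  moreover have "AE \<omega> in M. (\<lambda>n. j12 n \<omega>) \<longlonglongrightarrow> 1 / 2 * 0"
    unfolding j12_def
  proof (rule strong_law_factors[OF indep Y3(6) Y3(1) Y3(2) Y3(5) _ power_sum_averages(2)])
    show "(\<lambda>k. expectation (Y3 k)) \<longlonglongrightarrow> 0"
    proof (rule tendsto_sandwich[of "\<lambda>_. 0"])
      show "\<forall>\<^sub>F k in sequentially. 0 \<le> expectation (Y3 k)"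
        using eventually_ge_at_top[of 1] by eventually_elim (rule Y3(3))
      show "\<forall>\<^sub>F k in sequentially. expectation (Y3 k) \<le> (1 + K) / real k"
        using eventually_ge_at_top[of 1] by eventually_elim (rule Y3(4))
      show "(\<lambda>k. (1 + K) / real k) \<longlonglongrightarrow> 0" by (rule lim_const_over_n)
    qed simp
  qed auto
  moreover have "AE \<omega> in M. (\<lambda>n. m1 n \<omega>) \<longlonglongrightarrow> 1 / 2 * 0"
    unfolding m1_def
    by (rule strong_law_factors[OF indep Y4(5) L4_measurable[OF Y4(1)] L4_integrable_2[OF Y4(1)]
        L4_sq_le[OF Y4(1) Y4(4)] _ power_sum_averages(2)])
       (auto intro!: ev_cong[OF tendsto_const] Y4(2))
  moreover have "AE \<omega> in M. (\<lambda>n. m2 n \<omega>) \<longlonglongrightarrow> 1 * 0"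
    unfolding m2_def
    by (rule strong_law_factors[OF indep L2f(5) L4_measurable[OF L2f(1)] L4_integrable_2[OF L2f(1)]
        L4_sq_le[OF L2f(1) L2f(4)] _ power_sum_averages(1)])
       (auto intro!: ev_cong[OF tendsto_const] L2f(2))
  moreover have "AE \<omega> in M. \<forall>k\<in>{1..}. P k \<omega>
      = - (\<theta>\<^sub>1 * (real k)\<^sup>2) * U k \<omega> + \<theta>\<^sub>2 * ((u k T \<omega>)\<^sup>2 / 2) + L1 k \<omega> \<and>
      Q k \<omega> = - (\<theta>\<^sub>1 * (real k)\<^sup>2) * ((u k T \<omega>)\<^sup>2 / 2) + \<theta>\<^sub>2 * V k \<omega> + L2 k \<omega> \<and>
      (LINT t:{0..T}|lborel. u k t \<omega> * v k t \<omega>) = (u k T \<omega>)\<^sup>2 / 2"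
  proof (subst AE_ball_countable)
    have "AE \<omega> in M. (LINT t:{0..T}|lborel. u k t \<omega> * v k t \<omega>) = (u k T \<omega>)\<^sup>2 / 2" if "1 \<le> k" for k
      by (rule wave_mode.integral_u_times_v[OF mode[OF that]])
    then show "\<forall>k\<in>{1..}. AE \<omega> in M. P k \<omega> = - (\<theta>\<^sub>1 * (real k)\<^sup>2) * U k \<omega> + \<theta>\<^sub>2 * ((u k T \<omega>)\<^sup>2 / 2) + L1 k \<omega> \<and>
      Q k \<omega> = - (\<theta>\<^sub>1 * (real k)\<^sup>2) * ((u k T \<omega>)\<^sup>2 / 2) + \<theta>\<^sub>2 * V k \<omega> + L2 k \<omega> \<and>
      (LINT t:{0..T}|lborel. u k t \<omega> * v k t \<omega>) = (u k T \<omega>)\<^sup>2 / 2"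
      using P Q by (auto intro!: AE_conjI)
  qed simp
  ultimately have path_limits: "AE \<omega> in M. (\<lambda>n. j1 n \<omega>) \<longlonglongrightarrow> C / (3 * \<theta>\<^sub>1) \<and> (\<lambda>n. j2 n \<omega>) \<longlonglongrightarrow> C \<and>
      (\<lambda>n. j12 n \<omega>) \<longlonglongrightarrow> 0 \<and> (\<lambda>n. m1 n \<omega>) \<longlonglongrightarrow> 0 \<and> (\<lambda>n. m2 n \<omega>) \<longlonglongrightarrow> 0 \<and>
      (\<forall>\<^sub>F n in sequentially. err n \<omega>)"
  proof eventually_elim
    case (elim \<omega>)
    have PQ: "P k \<omega> = - (\<theta>\<^sub>1 * (real k)\<^sup>2) * U k \<omega> + \<theta>\<^sub>2 * ((u k T \<omega>)\<^sup>2 / 2) + L1 k \<omega>"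
      "Q k \<omega> = - (\<theta>\<^sub>1 * (real k)\<^sup>2) * ((u k T \<omega>)\<^sup>2 / 2) + \<theta>\<^sub>2 * V k \<omega> + L2 k \<omega>"
      "(LINT t:{0..T}|lborel. u k t \<omega> * v k t \<omega>) = (u k T \<omega>)\<^sup>2 / 2" if "1 \<le> k" for k
      using elim(6) that by auto
    have "(\<lambda>n. j1 n \<omega> * j2 n \<omega> - (j12 n \<omega>)\<^sup>2) \<longlonglongrightarrow> (1 / 3 * (C / \<theta>\<^sub>1)) * (1 * C) - (1 / 2 * 0)\<^sup>2"
      using elim(1-3) by (intro tendsto_intros)
    moreover have "0 < (1 / 3 * (C / \<theta>\<^sub>1)) * (1 * C) - (1 / 2 * 0)\<^sup>2" using C \<theta>1 by simp
    ultimately have "\<forall>\<^sub>F n in sequentially. 0 < j1 n \<omega> * j2 n \<omega> - (j12 n \<omega>)\<^sup>2" by (rule order_tendstoD(1))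
    then have "\<forall>\<^sub>F n in sequentially. err n \<omega>"
      using eventually_ge_at_top[of 1]
    proof eventually_elim
      case (elim n)
      have n: "0 < real n" using elim(2) by simp
      have d0: "j1 n \<omega> * j2 n \<omega> - (j12 n \<omega>)\<^sup>2 \<noteq> 0" using elim(1) by simp
      have J1e: "J1 T u n \<omega> = (\<Sum>k=1..n. real k ^ 2 * Y1 k \<omega>)"
        unfolding J1_def Y1_def U_def by (intro sum.cong refl) (simp add: power2_eq_square power4_eq_xxxx)
      have J2e: "J2 T v n \<omega> = (\<Sum>k=1..n. V k \<omega>)" unfolding J2_def V_def ..
      have J12e: "J12 T u v n \<omega> = (\<Sum>k=1..n. real k * Y3 k \<omega>)"
        unfolding J12_def Y3_def by (intro sum.cong refl) (simp add: PQ(3) power2_eq_square)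
      have B1e: "B1 P n \<omega> = \<theta>\<^sub>1 * J1 T u n \<omega> - \<theta>\<^sub>2 * J12 T u v n \<omega> - (\<Sum>k=1..n. real k * Y4 k \<omega>)"
        unfolding B1_def J1e J12e sum_distrib_left sum_subtractf[symmetric] sum_negf[symmetric]
        by (intro sum.cong refl) (simp add: PQ(1) Y1_def Y3_def Y4_def power2_eq_square algebra_simps)
      have B2e: "B2 Q n \<omega> = - \<theta>\<^sub>1 * J12 T u v n \<omega> + \<theta>\<^sub>2 * J2 T v n \<omega> + (\<Sum>k=1..n. L2 k \<omega>)"
        unfolding B2_def J2e J12e sum_distrib_left sum.distrib[symmetric]
        by (intro sum.cong refl) (simp add: PQ(2) Y3_def power2_eq_square algebra_simps)
      have J: "J1 T u n \<omega> = j1 n \<omega> * real n ^ 3" "J2 T v n \<omega> = j2 n \<omega> * real n" "J12 T u v n \<omega>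
          = j12 n \<omega> * real n ^ 2"
        "(\<Sum>k=1..n. real k * Y4 k \<omega>) = m1 n \<omega> * real n ^ 2" "(\<Sum>k=1..n. L2 k \<omega>) = m2 n \<omega> * real n"
        unfolding J1e J2e J12e j1_def j2_def j12_def m1_def m2_def
            using n by (simp_all add: numeral_eq_Suc)
      show ?case
        unfolding err_def mle1_def mle2_def
        using mle_error_formulas[OF n d0 J B1e B2e] by (rule conjI)
    qed
    then show ?case using elim(1-5) by simp
  qed

  \<comment> \<open>\<open>distr\<close> is the law of a map only if the map is measurable.\<close>
  have mle_measurable: "mle1 T u v P Q n \<in> borel_measurable M" "mle2 T u v P Q n
      \<in> borel_measurable M" for n
  proof -
    have Pm: "P k \<in> borel_measurable M" "Q k \<in> borel_measurable M" if "1 \<le> k" for k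
      using assms(9)[OF that] assms(10)[OF that] unfolding has_ito_process_integral_def by auto
    have uv: "(\<lambda>\<omega>. LINT t:{0..T}|lborel. u k t \<omega> * v k t \<omega>) \<in> borel_measurable M"
      "(\<lambda>\<omega>. LINT t:{0..T}|lborel. (u k t \<omega>)\<^sup>2) \<in> borel_measurable M"
      "(\<lambda>\<omega>. LINT t:{0..T}|lborel. (v k t \<omega>)\<^sup>2) \<in> borel_measurable M"
      if k: "1 \<le> k" for k
    proof -
      interpret m: wave_mode M F "W (sine_basis k)" T b "l k" "u k" "v k" by (rule mode[OF k])
      show "(\<lambda>\<omega>. LINT t:{0..T}|lborel. (u k t \<omega>)\<^sup>2) \<in> borel_measurable M"
        "(\<lambda>\<omega>. LINT t:{0..T}|lborel. (v k t \<omega>)\<^sup>2) \<in> borel_measurable M"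
        using m.u_square_integral(1) m.v_square_integral(1) by auto
      have mem: "grid T n j \<in> {0..T}" if "j < Suc n" for n j using grid_mem[of T j n] T that by auto
      show "(\<lambda>\<omega>. LINT t:{0..T}|lborel. u k t \<omega> * v k t \<omega>) \<in> borel_measurable M"
      proof (rule borel_measurable_LIMSEQ_real)
        show "(\<lambda>n. \<Sum>j<Suc n. T / real (Suc n) * (u k (grid T n j) \<omega> * v k (grid T n j) \<omega>))
            \<longlonglongrightarrow> (LINT t:{0..T}|lborel. u k t \<omega> * v k t \<omega>)" if "\<omega> \<in> space M" for \<omega>
          by (rule riemann_sum_tendsto[OF less_imp_le[OF T]]) (intro continuous_on_mult
              m.uv_continuous that)
        show "(\<lambda>\<omega>. \<Sum>j<Suc n. T / real (Suc n) * (u k (grid T n j) \<omega> * v k (grid T n j) \<omega>))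
            \<in> borel_measurable M" for n
          by (intro borel_measurable_sum borel_measurable_times borel_measurable_const
              m.uv_measurable mem) auto
      qed
    qed
    have [measurable]: "J1 T u n \<in> borel_measurable M" "J2 T v n \<in> borel_measurable M"
      "J12 T u v n \<in> borel_measurable M" "B1 P n \<in> borel_measurable M" "B2 Q n \<in> borel_measurable M"
      unfolding J1_def[abs_def] J2_def[abs_def] J12_def[abs_def] B1_def[abs_def] B2_def[abs_def]
      by (intro borel_measurable_uminus borel_measurable_sum borel_measurable_times
          borel_measurable_const uv Pm; simp)+
    show "mle1 T u v P Q n \<in> borel_measurable M" "mle2 T u v P Q n \<in> borel_measurable M"
      unfolding mle1_def[abs_def] mle2_def[abs_def] by measurable
  qed

  \<comment> \<open>\<open>M\<^sub>1 / n\<^bsup>3/2\<^esup>\<close> and \<open>M\<^sub>2 / n\<^bsup>1/2\<^esup>\<close>.\<close>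
  define X where "X n \<omega> = (\<Sum>k=1..n. real k / (real n * sqrt (real n)) * Y4 k \<omega>)" for n \<omega>
  define Y where "Y n \<omega> = (\<Sum>k=1..n. 1 / sqrt (real n) * L2 k \<omega>)" for n \<omega>
  have varX: "(\<lambda>n. \<Sum>k=1..n. (real k / (real n * sqrt (real n)))\<^sup>2 * expectation (\<lambda>\<omega>. (Y4 k \<omega>)\<^sup>2))
      \<longlonglongrightarrow> 1 / 3 * (C / \<theta>\<^sub>1)"
  proof -
    have "(\<Sum>k=1..n. (real k / (real n * sqrt (real n)))\<^sup>2 * expectation (\<lambda>\<omega>. (Y4 k \<omega>)\<^sup>2))
        = (\<Sum>k=1..n. real k ^ 2 * y k) / real n ^ (2 + 1)" for n
      unfolding sum_divide_distrib power_add[of "real n" 2 1]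
      by (intro sum.cong refl) (simp add: Y4(3) power_divide power_mult_distrib)
    then show ?thesis using weighted_average_tendsto[OF ylim power_sum_averages(3)] by (simp only:)
  qed
  have varY: "(\<lambda>n. \<Sum>k=1..n. (1 / sqrt (real n))\<^sup>2 * expectation (\<lambda>\<omega>. (L2 k \<omega>)\<^sup>2)) \<longlonglongrightarrow> 1 * C"
  proof -
    have "(\<Sum>k=1..n. (1 / sqrt (real n))\<^sup>2 * expectation (\<lambda>\<omega>. (L2 k \<omega>)\<^sup>2))
        = (\<Sum>k=1..n. real k ^ 0 * (LINT t:{0..T}|lborel. velocity_variance b (l k) t)) / real n ^ (0
            + 1)" for n
      unfolding sum_divide_distrib
      by (intro sum.cong refl) (simp add: L2f(3) power_divide)
    then show ?thesis using weighted_average_tendsto[OF vlim power_sum_averages(1)] by (simp only:)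
  qed
  have cX: "\<bar>real k / (real n * sqrt (real n))\<bar> \<le> 1 / sqrt (real n)" if "k \<in> {1..n}" for n k
    using that by (simp add: field_simps)
  have cY: "\<bar>1 / sqrt (real n)\<bar> \<le> 1 / sqrt (real n)" for n :: nat by simp
  have cltX: "\<And>t. (\<lambda>n. char (distr M borel (X n)) t)
      \<longlonglongrightarrow> complex_of_real (exp (- (t\<^sup>2 * (1 / 3 * (C / \<theta>\<^sub>1))) / 2))"
    "\<And>n. X n \<in> borel_measurable M" "\<And>n. integrable M (\<lambda>\<omega>. (X n \<omega>)\<^sup>2)"
    "\<exists>B. \<forall>n. expectation (\<lambda>\<omega>. (X n \<omega>)\<^sup>2) \<le> B"
    unfolding X_def[abs_def]
    by (rule clt_factors[OF indep Y4(5) Y4(1) Y4(2) Y4(4) cX varX]; assumption)+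
  have cltY: "\<And>t. (\<lambda>n. char (distr M borel (Y n)) t) \<longlonglongrightarrow> complex_of_real (exp (- (t\<^sup>2 * (1 * C)) / 2))"
    "\<And>n. Y n \<in> borel_measurable M" "\<And>n. integrable M (\<lambda>\<omega>. (Y n \<omega>)\<^sup>2)"
    "\<exists>B. \<forall>n. expectation (\<lambda>\<omega>. (Y n \<omega>)\<^sup>2) \<le> B"
    unfolding Y_def[abs_def]
    by (rule clt_factors[OF indep L2f(5) L2f(1) L2f(2) L2f(4) cY varY]; assumption)+
  obtain BX BY where BXY: "\<And>n. expectation (\<lambda>\<omega>. (X n \<omega>)\<^sup>2) \<le> BX" "\<And>n. expectation (\<lambda>\<omega>. (Y n \<omega>)\<^sup>2) \<le> BY"
    using cltX(4) cltY(4) by blast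
  have Xm: "X n \<omega> = sqrt (real n) * m1 n \<omega>" and Ym: "Y n \<omega> = sqrt (real n) * m2 n \<omega>" if "1 \<le> n" for n \<omega>
  proof -
    have n: "0 < sqrt (real n)" "real n = sqrt (real n) * sqrt (real n)" using that by auto
    have "X n \<omega> = (\<Sum>k=1..n. real k * Y4 k \<omega>) / (real n * sqrt (real n))"
      unfolding X_def sum_divide_distrib by (simp only: times_divide_eq_left)
    also have "\<dots> = sqrt (real n) * ((\<Sum>k=1..n. real k * Y4 k \<omega>) / (real n * real n))"
      using n(1) by (simp add: field_simps)
    finally show "X n \<omega> = sqrt (real n) * m1 n \<omega>" by (simp add: m1_def)
    have "Y n \<omega> = (\<Sum>k=1..n. L2 k \<omega>) / sqrt (real n)"
      unfolding Y_def sum_divide_distrib by simp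
    also have "\<dots> = sqrt (real n) * ((\<Sum>k=1..n. L2 k \<omega>) / real n)"
      using n(1) by (simp add: field_simps)
    finally show "Y n \<omega> = sqrt (real n) * m2 n \<omega>" by (simp add: m2_def)
  qed

  have "AE \<omega> in M. (\<lambda>N. mle1 T u v P Q N \<omega>) \<longlonglongrightarrow> \<theta>\<^sub>1 \<and> (\<lambda>N. mle2 T u v P Q N \<omega>) \<longlonglongrightarrow> \<theta>\<^sub>2"
    using path_limits
  proof eventually_elim
    case lim: (elim \<omega>)
    have nz: "C / (3 * \<theta>\<^sub>1) * C - 0\<^sup>2 \<noteq> 0" using C \<theta>1 by simp
    have "(\<lambda>n. (m2 n \<omega> * j12 n \<omega> - m1 n \<omega> * j2 n \<omega>) / (j1 n \<omega> * j2 n \<omega> - (j12 n \<omega>)\<^sup>2) * (1 / real n))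
        \<longlonglongrightarrow> (0 * 0 - 0 * C) / (C / (3 * \<theta>\<^sub>1) * C - 0\<^sup>2) * 0"
      using lim nz by (intro tendsto_intros lim_const_over_n) auto
    then have "(\<lambda>n. (m2 n \<omega> * j12 n \<omega> - m1 n \<omega> * j2 n \<omega>) / (j1 n \<omega> * j2 n \<omega> - (j12 n \<omega>)\<^sup>2) / real n) \<longlonglongrightarrow> 0"
      by simp
    then have "(\<lambda>n. mle1 T u v P Q n \<omega> - \<theta>\<^sub>1) \<longlonglongrightarrow> 0"
      by (rule Lim_transform_eventually) (use lim in \<open>auto simp: err_def elim!: eventually_mono\<close>)
    then have mle1_lim: "(\<lambda>n. mle1 T u v P Q n \<omega>) \<longlonglongrightarrow> \<theta>\<^sub>1" by (simp add: LIM_zero_iff)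
    have "(\<lambda>n. (m2 n \<omega> * j1 n \<omega> - m1 n \<omega> * j12 n \<omega>) / (j1 n \<omega> * j2 n \<omega> - (j12 n \<omega>)\<^sup>2))
        \<longlonglongrightarrow> (0 * (C / (3 * \<theta>\<^sub>1)) - 0 * 0) / (C / (3 * \<theta>\<^sub>1) * C - 0\<^sup>2)"
      using lim nz by (intro tendsto_intros) auto
    then have "(\<lambda>n. (m2 n \<omega> * j1 n \<omega> - m1 n \<omega> * j12 n \<omega>) / (j1 n \<omega> * j2 n \<omega> - (j12 n \<omega>)\<^sup>2)) \<longlonglongrightarrow> 0"
      by simp
    then have "(\<lambda>n. mle2 T u v P Q n \<omega> - \<theta>\<^sub>2) \<longlonglongrightarrow> 0"
      by (rule Lim_transform_eventually) (use lim in \<open>auto simp: err_def elim!: eventually_mono\<close>)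
    then have "(\<lambda>n. mle2 T u v P Q n \<omega>) \<longlonglongrightarrow> \<theta>\<^sub>2" by (simp add: LIM_zero_iff)
    with mle1_lim show ?case by blast
  qed
  then have consistent: "(AE \<omega> in M. (\<lambda>N. mle1 T u v P Q N \<omega>) \<longlonglongrightarrow> \<theta>\<^sub>1) \<and>
      (AE \<omega> in M. (\<lambda>N. mle2 T u v P Q N \<omega>) \<longlonglongrightarrow> \<theta>\<^sub>2)"
    by (simp only: AE_conj_iff)

  define Z1 where "Z1 n \<omega> = real n powr (3 / 2) * (mle1 T u v P Q n \<omega> - \<theta>\<^sub>1)" for n \<omega>
  define Z2 where "Z2 n \<omega> = real n powr (1 / 2) * (mle2 T u v P Q n \<omega> - \<theta>\<^sub>2)" for n \<omega>
  have Zm: "Z1 n \<in> borel_measurable M" "Z2 n \<in> borel_measurable M" for n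
    unfolding Z1_def[abs_def] Z2_def[abs_def] using mle_measurable[of n] by simp_all
  \<comment> \<open>In \<open>Z1\<close> the coefficient of \<open>X\<close> converges to \<open>- 3 \<theta>\<^sub>1 / C\<close> and that of \<open>Y\<close> to 0; in \<open>Z2\<close> the coefficient of \<open>Y\<close>
    converges to \<open>1 / C\<close> and that of \<open>X\<close> to 0.\<close>
  define \<alpha> where "\<alpha> n \<omega> = - j2 n \<omega> / (j1 n \<omega> * j2 n \<omega> - (j12 n \<omega>)\<^sup>2)" for n \<omega>
  define \<beta> where "\<beta> n \<omega> = j12 n \<omega> / (j1 n \<omega> * j2 n \<omega> - (j12 n \<omega>)\<^sup>2)" for n \<omega>
  define \<gamma> where "\<gamma> n \<omega> = j1 n \<omega> / (j1 n \<omega> * j2 n \<omega> - (j12 n \<omega>)\<^sup>2)" for n \<omega>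
  have p32: "real n powr (3 / 2) = real n * sqrt (real n)" for n
  proof (cases "n = 0")
    case False
    have "real n powr (1 + 1 / 2) = real n powr 1 * real n powr (1 / 2)" by (rule powr_add)
    then show ?thesis using False by (simp add: powr_half_sqrt)
  qed simp
  have p12: "real n powr (1 / 2) = sqrt (real n)" for n by (simp add: powr_half_sqrt)
  have scaled: "AE \<omega> in M. (\<lambda>n. \<alpha> n \<omega>) \<longlonglongrightarrow> - (3 * \<theta>\<^sub>1 / C) \<and> (\<lambda>n. \<beta> n \<omega>) \<longlonglongrightarrow> 0 \<and> (\<lambda>n. \<gamma> n \<omega>) \<longlonglongrightarrow> 1 / C \<and>
      (\<lambda>n. - \<beta> n \<omega>) \<longlonglongrightarrow> 0 \<and>
      (\<forall>\<^sub>F n in sequentially. Z1 n \<omega> = \<alpha> n \<omega> * X n \<omega> + \<beta> n \<omega> * Y n \<omega>) \<and>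
      (\<forall>\<^sub>F n in sequentially. Z2 n \<omega> = \<gamma> n \<omega> * Y n \<omega> + (- \<beta> n \<omega>) * X n \<omega>)"
    using path_limits
  proof eventually_elim
    case (elim \<omega>)
    have nz: "C / (3 * \<theta>\<^sub>1) * C - 0\<^sup>2 \<noteq> 0" using C \<theta>1 by simp
    have \<alpha>: "(\<lambda>n. \<alpha> n \<omega>) \<longlonglongrightarrow> - C / (C / (3 * \<theta>\<^sub>1) * C - 0\<^sup>2)"
      unfolding \<alpha>_def using elim nz by (intro tendsto_intros) auto
    have \<beta>: "(\<lambda>n. \<beta> n \<omega>) \<longlonglongrightarrow> 0 / (C / (3 * \<theta>\<^sub>1) * C - 0\<^sup>2)"
      unfolding \<beta>_def using elim nz by (intro tendsto_intros) auto
    have \<gamma>: "(\<lambda>n. \<gamma> n \<omega>) \<longlonglongrightarrow> (C / (3 * \<theta>\<^sub>1)) / (C / (3 * \<theta>\<^sub>1) * C - 0\<^sup>2)"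
      unfolding \<gamma>_def using elim nz by (intro tendsto_intros) auto
    have "\<forall>\<^sub>F n in sequentially. err n \<omega>"
      using elim by blast
    then have "\<forall>\<^sub>F n in sequentially. Z1 n \<omega> = \<alpha> n \<omega> * X n \<omega> + \<beta> n \<omega> * Y n \<omega> \<and>
        Z2 n \<omega> = \<gamma> n \<omega> * Y n \<omega> + (- \<beta> n \<omega>) * X n \<omega>"
      using eventually_ge_at_top[of 1]
    proof eventually_elim
      case (elim n)
      have n: "real n \<noteq> 0" using elim(2) by simp
      define d where "d = j1 n \<omega> * j2 n \<omega> - (j12 n \<omega>)\<^sup>2"
      have e: "mle1 T u v P Q n \<omega> - \<theta>\<^sub>1 = (m2 n \<omega> * j12 n \<omega> - m1 n \<omega> * j2 n \<omega>) / d / real n"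
        "mle2 T u v P Q n \<omega> - \<theta>\<^sub>2 = (m2 n \<omega> * j1 n \<omega> - m1 n \<omega> * j12 n \<omega>) / d"
        using elim(1) unfolding err_def by (simp_all only: d_def)
      show ?case
        unfolding Z1_def Z2_def e p32 p12 \<alpha>_def \<beta>_def \<gamma>_def Xm[OF elim(2)] Ym[OF elim(2)] d_def[symmetric]
        using n by (simp add: diff_divide_distrib algebra_simps)
    qed
    then show ?case
      using \<alpha> \<beta> \<gamma> tendsto_minus[OF \<beta>] C \<theta>1 by (auto simp: eventually_conj_iff)
  qed
  have rd: "real_distribution (distr M borel (Z1 n))" "real_distribution (distr M borel (Z2 n))" for n
    using Zm[of n] by (auto intro: real_distribution_distr)
  define B where "B = max BX BY"
  have BB: "expectation (\<lambda>\<omega>. (X n \<omega>)\<^sup>2) \<le> B" "expectation (\<lambda>\<omega>. (Y n \<omega>)\<^sup>2) \<le> B" for n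
    using BXY(1)[of n] BXY(2)[of n] by (auto simp: B_def)
  have "weak_conv_m (\<lambda>n. distr M borel (Z1 n)) (normal_law 0 (3 * \<theta>\<^sub>1 / C))"
  proof (rule levy_continuity[OF rd(1)])
    have s2: "0 < 3 * \<theta>\<^sub>1 / C" using C \<theta>1 by simp
    show "real_distribution (normal_law 0 (3 * \<theta>\<^sub>1 / C))" by (rule real_distribution_normal_law[OF s2])
    fix t
    have "(\<lambda>n. char (distr M borel (Z1 n)) t)
        \<longlonglongrightarrow> complex_of_real (exp (- ((t * - (3 * \<theta>\<^sub>1 / C))\<^sup>2 * (1 / 3 * (C / \<theta>\<^sub>1))) / 2))"
    proof (rule slutsky_char[OF Zm(1) cltX(2) cltY(2) cltX(3) BB(1) cltY(3) BB(2) _ cltX(1)])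
      show "AE \<omega> in M. (\<forall>\<^sub>F n in sequentially. Z1 n \<omega> = \<alpha> n \<omega> * X n \<omega> + \<beta> n \<omega> * Y n \<omega>) \<and>
          (\<lambda>n. \<alpha> n \<omega>) \<longlonglongrightarrow> - (3 * \<theta>\<^sub>1 / C) \<and> (\<lambda>n. \<beta> n \<omega>) \<longlonglongrightarrow> 0"
        using scaled by eventually_elim blast
    qed
    moreover have "(t * - (3 * \<theta>\<^sub>1 / C))\<^sup>2 * (1 / 3 * (C / \<theta>\<^sub>1)) = t\<^sup>2 * (3 * \<theta>\<^sub>1 / C)"
      using C \<theta>1 by (simp add: power2_eq_square field_simps)
    ultimately show "(\<lambda>n. char (distr M borel (Z1 n)) t) \<longlonglongrightarrow> char (normal_law 0 (3 * \<theta>\<^sub>1 / C)) t"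
      by (simp only: char_normal_law[OF s2])
  qed
  moreover have "weak_conv_m (\<lambda>n. distr M borel (Z2 n)) (normal_law 0 (1 / C))"
  proof (rule levy_continuity[OF rd(2)])
    have s2: "0 < 1 / C" using C by simp
    show "real_distribution (normal_law 0 (1 / C))" by (rule real_distribution_normal_law[OF s2])
    fix t
    have "(\<lambda>n. char (distr M borel (Z2 n)) t)
        \<longlonglongrightarrow> complex_of_real (exp (- ((t * (1 / C))\<^sup>2 * (1 * C)) / 2))"
    proof (rule slutsky_char[OF Zm(2) cltY(2) cltX(2) cltY(3) BB(2) cltX(3) BB(1) _ cltY(1)])
      show "AE \<omega> in M. (\<forall>\<^sub>F n in sequentially. Z2 n \<omega> = \<gamma> n \<omega> * Y n \<omega> + (- \<beta> n \<omega>) * X n \<omega>) \<and>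
          (\<lambda>n. \<gamma> n \<omega>) \<longlonglongrightarrow> 1 / C \<and> (\<lambda>n. - \<beta> n \<omega>) \<longlonglongrightarrow> 0"
        using scaled by eventually_elim blast
    qed
    moreover have "(t * (1 / C))\<^sup>2 * (1 * C) = t\<^sup>2 * (1 / C)"
      using C by (simp add: power2_eq_square field_simps)
    ultimately show "(\<lambda>n. char (distr M borel (Z2 n)) t) \<longlonglongrightarrow> char (normal_law 0 (1 / C)) t"
      by (simp only: char_normal_law[OF s2])
  qed
  ultimately show ?thesis
    using consistent unfolding Z1_def[abs_def] Z2_def[abs_def] C_def by blast
qed

end
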